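(* Let $(\zeta_t)_{t\in\mathbb Z}$ be the stationary GARCH$(1,1)$ process described in the context, and let $\alpha$ be as defined there. For $m,n\in\mathbb N$ let the following be mutually independent random variables: - $A_t$, $-m\le t\le -1$, each with distribution function $P(A_{t}\le x)=\sqrt{2/\pi}\int_{\left(\frac{x^{-2}-\beta_1}{\alpha_1}\right)^{1/2}}^{\infty}(\alpha_1z^2+\beta_1)^{\alpha}\exp(-\tfrac12z^2)\,dz$ for $0<x<\beta_1^{-1/2}$; - $S_t^{(\zeta)}$, $-m\le t\le n$, with $P(S_t^{(\zeta)}=1)=P(S_t^{(\zeta)}=-1)=1/2$; - $\epsilon_t^{(\zeta)}$, $2\le t\le n+1$, standard normal; - $\epsilon_1^{(\zeta)}$, symmetric and such that $(\epsilon_1^{(\zeta)})^2/2$ is Gamma distributed with shape parameter $\alpha+1/2$ and scale parameter $1$; - $|\zeta_0|^{(\zeta)}$, with $P(|\zeta_0|^{(\zeta)}>x)=x^{-2\alpha}$ for $x\ge 1$. Then, in the sense of weak convergence, $$\lim_{x\to\infty}\mathcal L\left(\frac{\zeta_{-m}}{x},\dots,\frac{\zeta_0}{x},\dots,\frac{\zeta_n}{x}\;\middle|\;|\zeta_0|>x\right)=\mathcal L\left(Z_{-m},\dots,Z_0,\dots,Z_n\right),$$ where $Z_0=|\zeta_0|^{(\zeta)}S_0^{(\zeta)}$, $$Z_{-t}=|\zeta_0|^{(\zeta)}\left(\prod_{i=1}^{t}A_{-i}\right)\frac{\left((A_{-t}^{-2}-\beta_1)/\alpha_1\right)^{1/2}}{|\epsilon_1^{(\zeta)}|}\,S_{-t}^{(\zeta)},\qquad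 1\le t\le m,$$ $$Z_t=|\zeta_0|^{(\zeta)}\left(\prod_{i=1}^{t}\left(\alpha_1(\epsilon_i^{(\zeta)})^2+\beta_1\right)^{1/2}\right)\frac{|\epsilon_{t+1}^{(\zeta)}|}{|\epsilon_1^{(\zeta)}|}\,S_t^{(\zeta)},\qquad 1\le t\le n.$$
   Context: GARCH$(1,1)$ setting: $\alpha_0>0$, $\alpha_1>0$, $\beta_1\ge 0$, $\alpha_1+\beta_1<1$; $(\epsilon_t)_{t\in\mathbb Z}$ are i.i.d. standard normal; $(\zeta_t,\sigma_t)_{t\in\mathbb Z}$ is the strictly stationary solution of $$\zeta_t=\sigma_t\epsilon_{t+1},\qquad \sigma_t=\sqrt{\alpha_0+\alpha_1\sigma_{t-1}^2\epsilon_t^2+\beta_1\sigma_{t-1}^2},\qquad t\in\mathbb Z,$$ where $(\epsilon_t)_{t>r}$ is independent of $(\sigma_t)_{t\le r}$ for each $r\in\mathbb Z$. $\alpha$ denotes the unique positive solution of $E\left([\alpha_1\epsilon_0^2+\beta_1]^\alpha\right)=1$. Known fact: $\sigma_0^2$ is regularly varying with index $\alpha$, i.e. $\lim_{x\to\infty}P(\sigma_0>ux)/P(\sigma_0>x)=u^{-2\alpha}$ for all $u>0$. Convention: $\beta_1^{-1/2}=\infty$ if $\beta_1=0$. *)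

theory Defs
  imports "HOL-Probability.Probability"
begin

text \<open>Weak convergence along a filter, for measures on the Borel sets of a topology \<open>T\<close>.\<close>

definition weak_conv_along ::
    "'c topology \<Rightarrow> ('i \<Rightarrow> 'c measure) \<Rightarrow> 'c measure \<Rightarrow> 'i filter \<Rightarrow> bool" where
  "weak_conv_along T \<mu> \<nu> F \<longleftrightarrow>
     (\<forall>f :: 'c \<Rightarrow> real. continuous_map T euclideanreal f \<and> bounded (f ` topspace T) \<longrightarrow>
        ((\<lambda>x. \<integral>y. f y \<partial>\<mu> x) \<longlongrightarrow> (\<integral>y. f y \<partial>\<nu>)) F)"

text \<open>
  The law of the finite-dimensional vector \<open>(X\<^sub>t)\<close>, \<open>t \<in> I\<close>, as a measure on the space
  of extensional functions on \<open>I\<close>.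
\<close>

definition fdd :: "'a measure \<Rightarrow> int set \<Rightarrow> (int \<Rightarrow> 'a \<Rightarrow> real) \<Rightarrow> (int \<Rightarrow> real) measure" where
  "fdd M I X = distr M (\<Pi>\<^sub>M t\<in>I. borel) (\<lambda>\<omega>. \<lambda>t\<in>I. X t \<omega>)"

definition gamma_density :: "real \<Rightarrow> real \<Rightarrow> real \<Rightarrow> real" where
  "gamma_density k \<theta> x =
     (if x > 0 then x powr (k - 1) * exp (- x / \<theta>) / (Gamma k * \<theta> powr k) else 0)"

text \<open>
  A strictly stationary solution of the GARCH(1,1) equations, whose volatility up to any time is
  independent of the later innovations.  The equations are only required almost surely.
\<close>

locale garch11 = prob_space M for M :: "'a measure" +
  fixes \<alpha>\<^sub>0 \<alpha>\<^sub>1 \<beta>\<^sub>1 :: real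
    and \<epsilon> \<zeta> \<sigma> :: "int \<Rightarrow> 'a \<Rightarrow> real"
  assumes \<alpha>\<^sub>0_pos: "\<alpha>\<^sub>0 > 0"
    and \<alpha>\<^sub>1_pos: "\<alpha>\<^sub>1 > 0"
    and \<beta>\<^sub>1_nonneg: "\<beta>\<^sub>1 \<ge> 0"
    and coeff_sum: "\<alpha>\<^sub>1 + \<beta>\<^sub>1 < 1"
    and innov_indep: "indep_vars (\<lambda>_. borel) \<epsilon> UNIV"
    and innov_normal: "\<And>t. distributed M lborel (\<epsilon> t) std_normal_density"
    and measurable_\<zeta>: "\<And>t. \<zeta> t \<in> borel_measurable M"
    and measurable_\<sigma>: "\<And>t. \<sigma> t \<in> borel_measurable M"
    and \<zeta>_eq: "\<And>t. AE \<omega> in M. \<zeta> t \<omega> = \<sigma> t \<omega> * \<epsilon> (t + 1) \<omega>"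
    and \<sigma>_eq: "\<And>t. AE \<omega> in M. \<sigma> t \<omega> =
        sqrt (\<alpha>\<^sub>0 + \<alpha>\<^sub>1 * (\<sigma> (t - 1) \<omega>)\<^sup>2 * (\<epsilon> t \<omega>)\<^sup>2 + \<beta>\<^sub>1 * (\<sigma> (t - 1) \<omega>)\<^sup>2)"
    and strictly_stationary: "\<And>h :: int.
        distr M (\<Pi>\<^sub>M t\<in>UNIV. borel) (\<lambda>\<omega> t. (\<zeta> (t + h) \<omega>, \<sigma> (t + h) \<omega>)) =
        distr M (\<Pi>\<^sub>M t\<in>UNIV. borel) (\<lambda>\<omega> t. (\<zeta> t \<omega>, \<sigma> t \<omega>))"
    and future_indep: "\<And>r :: int.
        indep_var (\<Pi>\<^sub>M t\<in>{r<..}. borel) (\<lambda>\<omega>. \<lambda>t\<in>{r<..}. \<epsilon> t \<omega>)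
                  (\<Pi>\<^sub>M t\<in>{..r}. borel) (\<lambda>\<omega>. \<lambda>t\<in>{..r}. \<sigma> t \<omega>)"

text \<open>Indices of the heterogeneous family of independent variables that drive the limit.\<close>

datatype tail_index = IxA int | IxS int | IxE int | IxY

text \<open>
  \<open>A\<close>, \<open>S\<close>, \<open>E\<close>, \<open>Y\<close> stand for \<open>A\<^sub>t\<close>, \<open>S\<^sub>t\<^sup>(\<^sup>\<zeta>\<^sup>)\<close>, \<open>\<epsilon>\<^sub>t\<^sup>(\<^sup>\<zeta>\<^sup>)\<close>, \<open>|\<zeta>\<^sub>0|\<^sup>(\<^sup>\<zeta>\<^sup>)\<close>; \<open>E 1\<close> has its own, non-normal law.
  The components are constrained only at the times that occur in the vector indexed by
  \<open>{- m..n}\<close>.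
\<close>

locale garch11_tail_vars = prob_space N for N :: "'b measure" +
  fixes \<alpha>\<^sub>1 \<beta>\<^sub>1 \<alpha> :: real
    and m n :: nat
    and A S E :: "int \<Rightarrow> 'b \<Rightarrow> real"
    and Y :: "'b \<Rightarrow> real"
  assumes indep: "indep_vars (\<lambda>_. borel)
        (\<lambda>i. case i of IxA t \<Rightarrow> A t | IxS t \<Rightarrow> S t | IxE t \<Rightarrow> E t | IxY \<Rightarrow> Y)
        (IxA ` {- int m..-1} \<union> IxS ` {- int m..int n} \<union> IxE ` {1..int n + 1} \<union> {IxY})"
    and A_cdf: "\<And>t x. t \<in> {- int m..-1} \<Longrightarrow> 0 < x \<Longrightarrow>
        ereal x < (if \<beta>\<^sub>1 = 0 then \<infinity> else ereal (\<beta>\<^sub>1 powr (- 1 / 2))) \<Longrightarrow>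
        prob {\<omega> \<in> space N. A t \<omega> \<le> x} =
          sqrt (2 / pi) * (LINT z:{sqrt ((x powr (- 2) - \<beta>\<^sub>1) / \<alpha>\<^sub>1)..}|lborel.
             (\<alpha>\<^sub>1 * z\<^sup>2 + \<beta>\<^sub>1) powr \<alpha> * exp (- (1 / 2) * z\<^sup>2))"
    and S_pos: "\<And>t. t \<in> {- int m..int n} \<Longrightarrow> prob {\<omega> \<in> space N. S t \<omega> = 1} = 1 / 2"
    and S_neg: "\<And>t. t \<in> {- int m..int n} \<Longrightarrow> prob {\<omega> \<in> space N. S t \<omega> = -1} = 1 / 2"
    and E_normal: "\<And>t. t \<in> {2..int n + 1} \<Longrightarrow> distributed N lborel (E t) std_normal_density"
    and E1_symmetric: "distr N borel (\<lambda>\<omega>. - E 1 \<omega>) = distr N borel (E 1)"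
    and E1_gamma: "distributed N lborel (\<lambda>\<omega>. (E 1 \<omega>)\<^sup>2 / 2) (gamma_density (\<alpha> + 1 / 2) 1)"
    and Y_pareto: "\<And>x. x \<ge> 1 \<Longrightarrow> prob {\<omega> \<in> space N. Y \<omega> > x} = x powr (- 2 * \<alpha>)"

definition garch11_tail_process ::
    "real \<Rightarrow> real \<Rightarrow> (int \<Rightarrow> 'b \<Rightarrow> real) \<Rightarrow> (int \<Rightarrow> 'b \<Rightarrow> real) \<Rightarrow> (int \<Rightarrow> 'b \<Rightarrow> real) \<Rightarrow>
     ('b \<Rightarrow> real) \<Rightarrow> int \<Rightarrow> 'b \<Rightarrow> real" where
  "garch11_tail_process \<alpha>\<^sub>1 \<beta>\<^sub>1 A S E Y t \<omega> =
     (if t = 0 then Y \<omega> * S 0 \<omega>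
      else if t < 0 then
        Y \<omega> * (\<Prod>i = 1..- t. A (- i) \<omega>)
          * (sqrt ((A t \<omega> powi (- 2) - \<beta>\<^sub>1) / \<alpha>\<^sub>1) / \<bar>E 1 \<omega>\<bar>) * S t \<omega>
      else
        Y \<omega> * (\<Prod>i = 1..t. sqrt (\<alpha>\<^sub>1 * (E i \<omega>)\<^sup>2 + \<beta>\<^sub>1))
          * (\<bar>E (t + 1) \<omega>\<bar> / \<bar>E 1 \<omega>\<bar>) * S t \<omega>)"

end

theory Submission
  imports Defs
begin

text \<open>
  Put \<open>s = - m\<close>.  Given the innovations \<open>e = (\<epsilon>\<^sub>i)\<close>, \<open>s < i \<le> n + 1\<close>, the squared volatility is affine in
  \<open>(\<sigma>\<^sub>s)\<^sup>2\<close>, so the scaled path \<open>\<zeta>\<^sub>t / x\<close> is a function of \<open>\<alpha>\<^sub>0 / x\<^sup>2\<close>, \<open>\<sigma>\<^sub>s / x\<close> and \<open>e\<close>, and the event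
  \<open>|\<zeta>\<^sub>0| > x\<close> says that \<open>\<sigma>\<^sub>s / x\<close> exceeds a threshold that tends to \<open>1 / d\<close>, where
  \<open>d = |\<epsilon>\<^sub>1| (\<Prod>s < i \<le> 0. \<alpha>\<^sub>1 \<epsilon>\<^sub>i\<^sup>2 + \<beta>\<^sub>1)\<^sup>1\<^sup>/\<^sup>2\<close>.  Since \<open>\<sigma>\<^sub>s\<close> is independent of \<open>e\<close> and has a regularly varying tail,
  fixing \<open>e\<close> replaces \<open>\<sigma>\<^sub>s / x\<close> in the limit by \<open>Y / d\<close> with \<open>Y\<close> Pareto distributed, at the price of a weight
  \<open>d\<close> to the power \<open>2 \<alpha>\<close>; a Potter bound justifies integrating over \<open>e\<close>.  The weight is a product over the
  coordinates of \<open>e\<close>, so after normalisation it tilts each \<open>\<epsilon>\<^sub>i\<close> separately.  The tilted variables are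
  \<open>|\<epsilon>\<^sub>1|\<close> from the Gamma law and, for \<open>i \<le> 0\<close>, those with \<open>(\<alpha>\<^sub>1 \<epsilon>\<^sub>i\<^sup>2 + \<beta>\<^sub>1)\<^sup>-\<^sup>1\<^sup>/\<^sup>2\<close> distributed as \<open>A\<close>
  at time \<open>i - 1\<close>.
\<close>

section \<open>Laws with a regularly varying tail\<close>

text \<open>Independence is available only forwards in time, so the window is expressed through the
  volatility at its start and the innovations after it. The backward variables \<open>A\<close> then
  need no time reversal: they come out of a change of measure.

  The obstacle is that innovations are unbounded: for fixed \<open>e\<close> the ratio of tails
  converges, but not uniformly in \<open>e\<close>. Normal variables have moments of every order, so
  a Potter bound with a crude integer power suffices for domination.

  Expectations on the exceedance event are divided by the tail of \<sigma>, not by the probability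
  of the event, because only the former is known to vary regularly; the test function 1 then gives
  the latter.

  The equation for \<alpha> says that each weight (\<alpha>_1 z^2 + \<beta>_1)^\<alpha> has mean 1
  under the normal law, so only \<epsilon>_1 contributes to the normalising constant. All weights
  are even, so the tilt acts on absolute values and leaves the signs fair and independent.\<close>

locale regularly_varying_law = real_distribution \<mu> for \<mu> :: "real measure" +
  fixes \<kappa> :: real
  assumes tail_ratio: "u > 0 \<Longrightarrow>
    ((\<lambda>x. measure \<mu> {u * x<..} / measure \<mu> {x<..}) \<longlongrightarrow> u powr (- \<kappa>)) at_top"
begin

abbreviation T :: "real \<Rightarrow> real" where "T x \<equiv> measure \<mu> {x<..}"

lemma tail_antimono: "x \<le> y \<Longrightarrow> T y \<le> T x"
  by (intro finite_measure_mono) auto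

text \<open>A quotient by 0 is 0, so the positive limit of \<open>T (2 * x) / T x\<close> forces
  nonzero denominators for all large arguments; monotonicity carries this back to every
  \<open>x\<close>.\<close>

lemma tail_pos: "T x > 0"
proof -
  have "((\<lambda>x. T (2 * x) / T x) \<longlongrightarrow> 2 powr (- \<kappa>)) at_top"
    by (rule tail_ratio) simp
  then have "eventually (\<lambda>x. T (2 * x) / T x > 0) at_top"
    by (rule order_tendstoD) simp
  then have "eventually (\<lambda>y. T y \<noteq> 0 \<and> y \<ge> x) at_top"
    using eventually_ge_at_top[of x] by eventually_elim auto
  then obtain y where "T y \<noteq> 0" "y \<ge> x"
    by (auto simp: eventually_at_top_linorder)
  then show ?thesis
    using tail_antimono[of x y] measure_nonneg[of \<mu> "{y<..}"] by linarith
qed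

text \<open>Monotonicity of \<open>T\<close> replaces a uniform convergence theorem: once
  \<open>w n\<close> lies on one side of a fixed \<open>u\<close> near \<open>w0\<close>, its ratio
  is bounded by the ratio for \<open>u\<close>, and \<open>u powr (- \<kappa>)\<close> is continuous
  at \<open>w0\<close>.\<close>

lemma tail_ratio_tendsto:
  assumes X: "filterlim X at_top sequentially" and w: "w \<longlonglongrightarrow> w0" "w0 > 0"
  shows "(\<lambda>n. T (X n * w n) / T (X n)) \<longlonglongrightarrow> w0 powr (- \<kappa>)"
proof (rule order_tendstoI)
  have lim: "(\<lambda>n. T (u * X n) / T (X n)) \<longlonglongrightarrow> u powr (- \<kappa>)" if "u > 0" for u
    using filterlim_compose[OF tail_ratio[OF that] X] .
  have cont: "((\<lambda>u. u powr (- \<kappa>)) \<longlongrightarrow> w0 powr (- \<kappa>)) (at w0)"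
    using w(2) by (intro tendsto_intros) auto
  have cont_right: "((\<lambda>u. u powr (- \<kappa>)) \<longlongrightarrow> w0 powr (- \<kappa>)) (at_right w0)"
    by (rule tendsto_mono[OF at_le cont]) simp
  have cont_left: "((\<lambda>u. u powr (- \<kappa>)) \<longlongrightarrow> w0 powr (- \<kappa>)) (at_left w0)"
    by (rule tendsto_mono[OF at_le cont]) simp
  have pos: "eventually (\<lambda>n. X n > 0) sequentially"
    using X by (simp add: filterlim_at_top_dense)
  {
    fix b assume "b < w0 powr (- \<kappa>)"
    then have "eventually (\<lambda>u. b < u powr (- \<kappa>)) (at_right w0)"
      using cont_right by (rule order_tendstoD(1)[rotated])
    then have "eventually (\<lambda>u. b < u powr (- \<kappa>) \<and> u > w0) (at_right w0)"
      using eventually_at_right_less by (rule eventually_conj)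
    then obtain u where u: "b < u powr (- \<kappa>)" "u > w0"
      using eventually_happens'[OF trivial_limit_at_right_real] by blast
    have "eventually (\<lambda>n. b < T (u * X n) / T (X n)) sequentially"
      using lim[of u] u w(2) by (intro order_tendstoD) auto
    moreover have "eventually (\<lambda>n. w n < u) sequentially"
      using w(1) u by (intro order_tendstoD)
    ultimately show "eventually (\<lambda>n. b < T (X n * w n) / T (X n)) sequentially"
      using pos
    proof eventually_elim
      case (elim n)
      then have "T (u * X n) \<le> T (X n * w n)"
        by (intro tail_antimono) (simp add: mult.commute)
      then show ?case
        using elim tail_pos[of "X n"] by (smt (verit) divide_right_mono)
    qed
  }
  {
    fix b assume "b > w0 powr (- \<kappa>)"
    then have "eventually (\<lambda>u. b > u powr (- \<kappa>)) (at_left w0)"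
      using cont_left by (rule order_tendstoD(2)[rotated])
    then have "eventually (\<lambda>u. b > u powr (- \<kappa>) \<and> u \<in> {0<..<w0}) (at_left w0)"
      using eventually_at_left_real[OF w(2)] by (rule eventually_conj)
    then obtain u where u: "b > u powr (- \<kappa>)" "u < w0" "u > 0"
      using eventually_happens'[OF trivial_limit_at_left_real] by auto
    have "eventually (\<lambda>n. b > T (u * X n) / T (X n)) sequentially"
      using lim[of u] u w(2) by (intro order_tendstoD) auto
    moreover have "eventually (\<lambda>n. w n > u) sequentially"
      using w(1) u by (intro order_tendstoD)
    ultimately show "eventually (\<lambda>n. b > T (X n * w n) / T (X n)) sequentially"
      using pos
    proof eventually_elim
      case (elim n)
      then have "T (u * X n) \<ge> T (X n * w n)"
        by (intro tail_antimono) (simp add: mult.commute)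
      then show ?case
        using elim tail_pos[of "X n"] by (smt (verit) divide_right_mono)
    qed
  }
qed

text \<open>Halving a large argument multiplies the tail by at most 2^j; iterating this over powers
  of 2 gives a bound polynomial in \<open>c\<close>. It also covers the case that
  \<open>x / c\<close> falls below \<open>x0\<close>, which occurs because \<open>c\<close> will be
  an unbounded random quantity.\<close>

lemma potter_bound:
  obtains K x0 :: real and j :: nat where "K > 0" "x0 > 0"
    "\<And>x c. x \<ge> x0 \<Longrightarrow> c > 0 \<Longrightarrow> T (x / c) \<le> K * (1 + c\<^sup>2) ^ j * T x"
proof -
  \<comment> \<open>The limit of \<open>T (x / 2) / T x\<close> is 2^\<kappa>, and any integer
    \<open>j\<close> above \<kappa> makes 2^j exceed it strictly.\<close>
  define j where "j = nat \<lceil>\<bar>\<kappa>\<bar>\<rceil> + 1"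
  have "\<kappa> < real j" unfolding j_def by linarith
  then have "(1 / 2) powr (- \<kappa>) < (2::real) ^ j"
    by (simp add: powr_minus powr_divide powr_realpow[symmetric])
  then have "eventually (\<lambda>x. T (1 / 2 * x) / T x < 2 ^ j) at_top"
    by (intro order_tendstoD(2)[OF tail_ratio]) auto
  then have "eventually (\<lambda>x. T (1 / 2 * x) / T x < 2 ^ j \<and> x > 0) at_top"
    using eventually_gt_at_top by (rule eventually_conj)
  then obtain x0 where x0: "\<And>x. x \<ge> x0 \<Longrightarrow> T (1 / 2 * x) / T x < 2 ^ j \<and> x > 0"
    by (auto simp: eventually_at_top_linorder)
  have x0_pos: "x0 > 0" using x0[of x0] by simp
  have half: "T (x / 2) \<le> 2 ^ j * T x" if "x \<ge> x0" for x
    using x0[OF that] tail_pos[of x] by (simp add: field_simps)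
  define K where "K = 1 / T x0"
  have K: "K \<ge> 1" "K > 0" "K * T x0 = 1"
    using tail_pos[of x0] by (auto simp: K_def)
  have dyadic: "T y \<le> K * 2 ^ (j * k) * T (2 ^ k * y)" if "2 ^ k * y \<ge> x0" for k y
    using that
  proof (induction k)
    case 0
    then show ?case using K(1) tail_pos[of y] by simp
  next
    case (Suc k)
    have h: "T (2 ^ k * y) \<le> 2 ^ j * T (2 ^ Suc k * y)"
      using half[OF Suc.prems] by (simp add: mult.assoc)
    show ?case
    proof (cases "2 ^ k * y \<ge> x0")
      case True
      have "T y \<le> K * 2 ^ (j * k) * T (2 ^ k * y)" by (rule Suc.IH[OF True])
      also have "\<dots> \<le> K * 2 ^ (j * k) * (2 ^ j * T (2 ^ Suc k * y))"
        using h K by (intro mult_left_mono) auto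
      finally show ?thesis by (simp add: power_add mult_ac)
    next
      case False
      have "T y \<le> 1" by (rule prob_le_1)
      also have "1 = K * T x0" using K by simp
      also have "\<dots> \<le> K * T (2 ^ k * y)"
        using False K by (intro mult_left_mono tail_antimono) auto
      also have "\<dots> \<le> K * (2 ^ j * T (2 ^ Suc k * y))"
        using h K by (intro mult_left_mono) auto
      also have "\<dots> \<le> K * (2 ^ (j * Suc k) * T (2 ^ Suc k * y))"
        using K tail_pos by (intro mult_left_mono mult_right_mono power_increasing) auto
      finally show ?thesis by (simp add: mult.assoc)
    qed
  qed
  have "T (x / c) \<le> (K * 4 ^ j) * (1 + c\<^sup>2) ^ j * T x" if x: "x \<ge> x0" and c: "c > 0" for x c
  proof -
    have ex: "\<exists>k. c \<le> 2 ^ k"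
      using real_arch_pow[of 2 c] by (auto intro: less_imp_le)
    \<comment> \<open>Minimality gives 2^(k - 1) < c \<le> 1 + c^2, so the accumulated factor
      (2^k)^j stays polynomial in \<open>c\<close>.\<close>
    define k where "k = (LEAST k. c \<le> 2 ^ k)"
    have ck: "c \<le> 2 ^ k" unfolding k_def by (rule LeastI_ex[OF ex])
    have kc: "2 ^ k \<le> 4 * (1 + c\<^sup>2)"
    proof (cases k)
      case (Suc k')
      then have "\<not> c \<le> 2 ^ k'" unfolding k_def by (metis lessI not_less_Least)
      moreover have "c \<le> 1 + c\<^sup>2" using zero_le_power2[of "c - 1/2"]
        by (simp add: power2_eq_square algebra_simps)
      ultimately have "2 ^ k' \<le> 1 + c\<^sup>2" by linarith
      then have "2 * 2 ^ k' \<le> 2 * (1 + c\<^sup>2)" by simp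
      also have "\<dots> \<le> 4 * (1 + c\<^sup>2)" by (intro mult_right_mono) auto
      finally show ?thesis unfolding Suc power_Suc .
    qed (simp add: add_increasing2)
    have xk: "x \<le> 2 ^ k * (x / c)"
      using ck c x x0_pos by (simp add: pos_le_divide_eq mult.commute)
    have "T (x / c) \<le> K * 2 ^ (j * k) * T (2 ^ k * (x / c))"
      using xk x by (intro dyadic) auto
    also have "\<dots> \<le> K * 2 ^ (j * k) * T x"
      using xk K by (intro mult_left_mono tail_antimono) auto
    also have "2 ^ (j * k) = (2 ^ k :: real) ^ j" by (metis power_mult mult.commute)
    also have "K * (2 ^ k) ^ j * T x \<le> K * (4 * (1 + c\<^sup>2)) ^ j * T x"
      using kc K tail_pos[of x] by (intro mult_left_mono mult_right_mono power_mono) auto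
    also have "\<dots> = (K * 4 ^ j) * (1 + c\<^sup>2) ^ j * T x" by (simp only: power_mult_distrib mult.assoc)
    finally show ?thesis .
  qed
  then show thesis
    using that[of "K * 4 ^ j" x0 j] K x0_pos by simp
qed

text \<open>
  Conditioning on the moving threshold \<open>X w\<close> itself absorbs the indicator, so that Skorohod's theorem
  leaves a plain dominated convergence.
\<close>

lemma conditioned_tail_integral_tendsto:
  fixes g :: "nat \<Rightarrow> real \<Rightarrow> real"
  assumes \<nu>: "real_distribution \<nu>" and pareto: "\<And>x. x \<ge> 1 \<Longrightarrow> measure \<nu> {x<..} = x powr (- \<kappa>)"
    and X: "filterlim X at_top sequentially" and w: "w \<longlonglongrightarrow> w0" "w0 > 0"
    and g_meas [measurable]: "\<And>n. g n \<in> borel_measurable borel" "h \<in> borel_measurable borel"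
    and g_bdd: "\<And>n x. \<bar>g n x\<bar> \<le> B"
    and g_lim: "\<And>v v0. v \<longlonglongrightarrow> v0 \<Longrightarrow> (\<lambda>n. g n (v n)) \<longlonglongrightarrow> h v0"
  shows "(\<lambda>n. (\<integral>v. g n (v / X n) * indicator {X n * w n<..} v \<partial>\<mu>) / T (X n))
    \<longlonglongrightarrow> w0 powr (- \<kappa>) * (\<integral>y. h (w0 * y) \<partial>\<nu>)"
proof -
  interpret \<nu>: real_distribution \<nu> by fact
  define b where "b n = X n * w n" for n
  have b_lim: "filterlim b at_top sequentially"
    unfolding b_def using filterlim_tendsto_pos_mult_at_top[OF w X] by (simp add: mult.commute)
  have w_pos: "eventually (\<lambda>n. w n > 0) sequentially"
    using w by (intro order_tendstoD)
  have b_pos: "eventually (\<lambda>n. b n > 0) sequentially"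
    using b_lim by (simp add: filterlim_at_top_dense)
  have X_pos: "eventually (\<lambda>n. X n > 0) sequentially"
    using X by (simp add: filterlim_at_top_dense)
  \<comment> \<open>The law of V / b given V > b. The value \<open>\<nu>\<close> for b \<le> 0 is a
    mere default, since \<open>b n\<close> is eventually positive.\<close>
  define \<rho> where "\<rho> n = (if b n > 0 then distr (uniform_measure \<mu> {b n<..}) borel (\<lambda>v. v / b n) else \<nu>)" for n
  have ps: "prob_space (uniform_measure \<mu> {b n<..})" for n
    using tail_pos[of "b n"] by (intro prob_space_uniform_measure) (auto simp: emeasure_eq_measure)
  have \<rho>: "real_distribution (\<rho> n)" for n
    using \<nu> unfolding \<rho>_def real_distribution_def real_distribution_axioms_def
    by (auto intro!: prob_space.prob_space_distr[OF ps])
  have \<rho>_tail: "measure (\<rho> n) {u<..} = (if u \<ge> 1 then T (u * b n) / T (b n) else 1)" if "b n > 0" for n u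
  proof -
    have "measure (\<rho> n) {u<..} = measure (uniform_measure \<mu> {b n<..}) ((\<lambda>v. v / b n) -` {u<..} \<inter> space \<mu>)"
      using that by (simp add: \<rho>_def measure_distr)
    also have "(\<lambda>v. v / b n) -` {u<..} \<inter> space \<mu> = {u * b n<..}"
      using that by (auto simp: pos_less_divide_eq)
    also have "measure (uniform_measure \<mu> {b n<..}) {u * b n<..} = measure \<mu> ({b n<..} \<inter> {u * b n<..}) / T (b n)"
      using tail_pos[of "b n"] by (intro measure_uniform_measure) (auto simp: emeasure_eq_measure)
    also have "{b n<..} \<inter> {u * b n<..} = (if u \<ge> 1 then {u * b n<..} else {b n<..})"
    proof -
      have "u * b n \<ge> b n" if "u \<ge> 1" using that \<open>b n > 0\<close> by simp
      moreover have "u * b n < b n" if "u < 1" using that \<open>b n > 0\<close> by simp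
      ultimately show ?thesis by (auto simp: not_le)
    qed
    finally show ?thesis using tail_pos[of "b n"] by auto
  qed
  have cdf_tail: "cdf \<theta> u = 1 - measure \<theta> {u<..}" if "real_distribution \<theta>" for \<theta> :: "real measure" and u
  proof -
    interpret \<theta>: real_distribution \<theta> by fact
    have "space \<theta> - {u<..} = {..u}" by auto
    then show ?thesis
      using \<theta>.prob_compl[of "{u<..}"] by (simp add: cdf_def)
  qed
  \<comment> \<open>The distribution functions converge at every point: at or above 1 by regular
    variation, and below 1 because both tails equal 1.\<close>
  have wc: "weak_conv_m \<rho> \<nu>"
    unfolding weak_conv_m_def weak_conv_def
  proof (intro allI impI)
    fix u :: real
    have "(\<lambda>n. measure (\<rho> n) {u<..}) \<longlonglongrightarrow> measure \<nu> {u<..}"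
    proof (cases "u \<ge> 1")
      case True
      have "(\<lambda>n. T (u * b n) / T (b n)) \<longlonglongrightarrow> u powr (- \<kappa>)"
        using True by (intro filterlim_compose[OF tail_ratio b_lim]) auto
      then show ?thesis
        unfolding pareto[OF True]
        by (rule Lim_transform_eventually) (use True in \<open>auto intro: eventually_mono[OF b_pos] simp: \<rho>_tail\<close>)
    next
      case False
      have "1 = measure \<nu> {1<..}" using pareto[of 1] by simp
      also have "\<dots> \<le> measure \<nu> {u<..}" using False by (intro \<nu>.finite_measure_mono) auto
      finally have "measure \<nu> {u<..} = 1" using \<nu>.prob_le_1[of "{u<..}"] by simp
      then show ?thesis
        using False by (auto intro!: tendsto_eventually eventually_mono[OF b_pos] simp: \<rho>_tail)
    qed
    then show "(\<lambda>n. cdf (\<rho> n) u) \<longlonglongrightarrow> cdf \<nu> u"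
      using \<rho> \<nu> by (simp add: cdf_tail) (intro tendsto_intros)
  qed
  obtain \<Omega> :: "real measure" and Ys :: "nat \<Rightarrow> real \<Rightarrow> real" and Y where
    \<Omega>: "prob_space \<Omega>" and Ys [measurable]: "\<And>n. Ys n \<in> borel_measurable \<Omega>"
    and Ys_law: "\<And>n. distr \<Omega> borel (Ys n) = \<rho> n"
    and Y [measurable]: "Y \<in> borel_measurable \<Omega>" and Y_law: "distr \<Omega> borel Y = \<nu>"
    and Y_lim: "\<And>x. x \<in> space \<Omega> \<Longrightarrow> (\<lambda>n. Ys n x) \<longlonglongrightarrow> Y x"
    using Skorohod[OF \<rho> \<nu> wc] by force
  interpret \<Omega>: prob_space \<Omega> by fact
  have "(\<lambda>n. \<integral>x. g n (w n * Ys n x) \<partial>\<Omega>) \<longlonglongrightarrow> (\<integral>x. h (w0 * Y x) \<partial>\<Omega>)"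
  proof (rule integral_dominated_convergence[where w="\<lambda>_. B"])
    show "AE x in \<Omega>. (\<lambda>n. g n (w n * Ys n x)) \<longlonglongrightarrow> h (w0 * Y x)"
      by (intro AE_I2 g_lim tendsto_mult w Y_lim)
  qed (use g_bdd in auto)
  also have "(\<integral>x. h (w0 * Y x) \<partial>\<Omega>) = (\<integral>y. h (w0 * y) \<partial>\<nu>)"
    by (simp add: integral_distr flip: Y_law)
  also have "(\<lambda>n. \<integral>x. g n (w n * Ys n x) \<partial>\<Omega>) = (\<lambda>n. \<integral>y. g n (w n * y) \<partial>\<rho> n)"
    by (simp add: integral_distr flip: Ys_law)
  \<comment> \<open>As w / b = 1 / X, the integrals against \<open>\<rho> n\<close> are expectations
    of g (V / X) given V > b; the factor T (b) / T (X) removes the conditioning and changes the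
    normalisation to T (X).\<close>
  finally have "(\<lambda>n. T (X n * w n) / T (X n) * (\<integral>y. g n (w n * y) \<partial>\<rho> n))
      \<longlonglongrightarrow> w0 powr (- \<kappa>) * (\<integral>y. h (w0 * y) \<partial>\<nu>)"
    by (intro tendsto_mult tail_ratio_tendsto X w)
  then show ?thesis
  proof (rule Lim_transform_eventually)
    show "eventually (\<lambda>n. T (X n * w n) / T (X n) * (\<integral>y. g n (w n * y) \<partial>\<rho> n) =
      (\<integral>v. g n (v / X n) * indicator {X n * w n<..} v \<partial>\<mu>) / T (X n)) sequentially"
      using b_pos w_pos
    proof eventually_elim
      case (elim n)
      have "(\<integral>y. g n (w n * y) \<partial>\<rho> n) = (\<integral>v. g n (w n * (v / b n)) \<partial>uniform_measure \<mu> {b n<..})"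
        using elim by (simp add: \<rho>_def integral_distr)
      also have "\<dots> = (\<integral>v. g n (v / X n) \<partial>uniform_measure \<mu> {b n<..})"
        using elim by (simp add: b_def)
      also have "uniform_measure \<mu> {b n<..} = density \<mu> (\<lambda>v. ennreal (indicator {b n<..} v / T (b n)))"
        unfolding uniform_measure_def emeasure_eq_measure
        using tail_pos[of "b n"]
        by (intro density_cong) (auto simp: divide_ennreal[of 1, simplified] split: split_indicator)
      also have "(\<integral>v. g n (v / X n) \<partial>\<dots>) = (\<integral>v. indicator {b n<..} v / T (b n) * g n (v / X n) \<partial>\<mu>)"
        using tail_pos[of "b n"] by (subst integral_density) auto
      also have "\<dots> = (\<integral>v. g n (v / X n) * indicator {b n<..} v \<partial>\<mu>) / T (b n)"
        by (simp add: mult.commute)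
      finally show ?case
        using tail_pos[of "b n"] by (simp add: b_def)
    qed
  qed
qed

end

section \<open>The volatility recursion\<close>

text \<open>The test functions in \<open>weak_conv_along\<close> are only assumed continuous, so
  measurability has to be derived. Borel sets and product sigma-algebra are known to agree on total
  functions over a countable index type; restriction to \<open>I\<close> transports \<open>f\<close>
  there, and padding with 0 outside \<open>I\<close> brings it back.\<close>

lemma borel_measurable_continuous_map_product:
  fixes f :: "('i::countable \<Rightarrow> real) \<Rightarrow> real"
  assumes "continuous_map (product_topology (\<lambda>_. euclideanreal) I) euclideanreal f"
  shows "f \<in> borel_measurable (PiM I (\<lambda>_. borel))"
proof -
  have "continuous_map euclidean (product_topology (\<lambda>_. euclideanreal) I) (\<lambda>y. restrict y I)"
    unfolding continuous_map_componentwise by (auto intro: continuous_on_product_coordinates)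
  then have "continuous_on UNIV (f \<circ> (\<lambda>y. restrict y I))"
    using continuous_map_compose assms by fastforce
  then have "f \<circ> (\<lambda>y. restrict y I) \<in> borel_measurable (PiM UNIV (\<lambda>_. borel))"
    using borel_measurable_continuous_onI measurable_cong_sets[OF sets_PiM_equal_borel refl] by blast
  moreover have "(\<lambda>y i. if i \<in> I then y i else 0) \<in> PiM I (\<lambda>_. borel :: real measure) \<rightarrow>\<^sub>M PiM UNIV (\<lambda>_. borel)"
  proof (rule measurable_PiM_single')
    fix i show "(\<lambda>y. if i \<in> I then y i else 0) \<in> borel_measurable (PiM I (\<lambda>_. borel :: real measure))"
      by (cases "i \<in> I") auto
  qed (auto simp: space_PiM)
  ultimately have "f \<circ> (\<lambda>y. restrict y I) \<circ> (\<lambda>y i. if i \<in> I then y i else 0) \<in> borel_measurable (PiM I (\<lambda>_. borel))"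
    by (rule measurable_comp[rotated])
  then show ?thesis
  proof (rule measurable_cong[THEN iffD1, rotated])
    fix y assume "y \<in> space (PiM I (\<lambda>_. borel :: real measure))"
    then have "(\<lambda>i\<in>I. if i \<in> I then y i else 0) = y"
      by (auto simp: space_PiM fun_eq_iff PiE_def extensional_def restrict_def)
    then show "(f \<circ> (\<lambda>y. restrict y I) \<circ> (\<lambda>y i. if i \<in> I then y i else 0)) y = f y"
      by simp
  qed
qed

lemma tendsto_continuous_map_product:
  fixes f :: "('i \<Rightarrow> real) \<Rightarrow> real"
  assumes "continuous_map (product_topology (\<lambda>_. euclideanreal) I) euclideanreal f"
    and "\<And>i. i \<in> I \<Longrightarrow> ((\<lambda>k. y k i) \<longlongrightarrow> z i) F"
  shows "((\<lambda>k. f (restrict (y k) I)) \<longlongrightarrow> f (restrict z I)) F"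
proof -
  have "limitin (product_topology (\<lambda>_. euclideanreal) I) (\<lambda>k. restrict (y k) I) (restrict z I) F"
    using assms(2) by (auto simp: limitin_componentwise)
  from continuous_map_limit[OF assms(1) this] show ?thesis
    by (simp add: comp_def)
qed

text \<open>Independence is supplied for families indexed by sets; here a family with one index is
  unpacked into a real variable. It serves both the pair of innovations and \<sigma>_s and the pair
  of tilted innovations and \<open>Y\<close>.\<close>

lemma (in prob_space) distr_pair_coordinate:
  fixes X Z :: "'i \<Rightarrow> 'a \<Rightarrow> real"
  assumes ind: "indep_var (PiM J (\<lambda>_. borel)) (\<lambda>\<omega>. \<lambda>i\<in>J. X i \<omega>) (PiM {s} (\<lambda>_. borel)) (\<lambda>\<omega>. \<lambda>i\<in>{s}. Z i \<omega>)"
  shows "distr M (PiM J (\<lambda>_. borel) \<Otimes>\<^sub>M borel) (\<lambda>\<omega>. (\<lambda>i\<in>J. X i \<omega>, Z s \<omega>)) =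
    distr M (PiM J (\<lambda>_. borel)) (\<lambda>\<omega>. \<lambda>i\<in>J. X i \<omega>) \<Otimes>\<^sub>M distr M borel (Z s)"
proof -
  let ?P = "PiM J (\<lambda>_. borel :: real measure)" and ?Q = "PiM {s} (\<lambda>_. borel :: real measure)"
  let ?e = "\<lambda>\<omega>. \<lambda>i\<in>J. X i \<omega>" and ?y = "\<lambda>\<omega>. \<lambda>i\<in>{s}. Z i \<omega>"
  have e [measurable]: "?e \<in> M \<rightarrow>\<^sub>M ?P" and y [measurable]: "?y \<in> M \<rightarrow>\<^sub>M ?Q"
    and joint: "distr M (?P \<Otimes>\<^sub>M ?Q) (\<lambda>\<omega>. (?e \<omega>, ?y \<omega>)) = distr M ?P ?e \<Otimes>\<^sub>M distr M ?Q ?y"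
    using ind unfolding indep_var_distribution_eq by (blast intro: sym)+
  have [measurable]: "(\<lambda>y. y s) \<in> ?Q \<rightarrow>\<^sub>M borel" by (rule measurable_component_singleton) simp
  have "distr M (?P \<Otimes>\<^sub>M borel) (\<lambda>\<omega>. (?e \<omega>, Z s \<omega>)) =
      distr (distr M (?P \<Otimes>\<^sub>M ?Q) (\<lambda>\<omega>. (?e \<omega>, ?y \<omega>))) (?P \<Otimes>\<^sub>M borel) (\<lambda>(e, y). (e, y s))"
    by (subst distr_distr) (auto simp: comp_def)
  also have "\<dots> = distr (distr M ?P ?e) ?P (\<lambda>e. e) \<Otimes>\<^sub>M distr (distr M ?Q ?y) borel (\<lambda>y. y s)"
    unfolding joint
  proof (rule pair_measure_distr[symmetric])
    show "sigma_finite_measure (distr (distr M ?Q ?y) borel (\<lambda>y. y s))"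
      by (intro prob_space_imp_sigma_finite prob_space.prob_space_distr prob_space_distr) auto
  qed auto
  also have "distr (distr M ?Q ?y) borel (\<lambda>y. y s) = distr M borel (Z s)"
    by (subst distr_distr) (auto simp: comp_def)
  also have "distr (distr M ?P ?e) ?P (\<lambda>e. e) = distr M ?P ?e"
    by (rule distr_id2) simp
  finally show ?thesis .
qed

text \<open>For a null set \<open>A\<close> both sides are 0, the right one by division by zero. The
  formula can therefore be applied at every level \<open>x\<close> of the conditioning.\<close>

lemma (in prob_space) integral_uniform_measure:
  fixes f :: "'a \<Rightarrow> real"
  assumes A [measurable]: "A \<in> events" and f [measurable]: "f \<in> borel_measurable M"
  shows "(\<integral>x. f x \<partial>uniform_measure M A) = (\<integral>x. f x * indicator A x \<partial>M) / prob A"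
proof (cases "prob A = 0")
  case True
  then have null: "AE x in M. x \<notin> A"
    by (intro AE_not_in) (auto simp: emeasure_eq_measure)
  have "AE x in uniform_measure M A. f x = 0"
    using null by (intro AE_uniform_measureI) auto
  then show ?thesis
    using True by (simp add: integral_eq_zero_AE)
next
  case False
  then have pos: "prob A > 0" by (simp add: zero_less_measure_iff)
  have "uniform_measure M A = density M (\<lambda>x. ennreal (indicator A x / prob A))"
    unfolding uniform_measure_def emeasure_eq_measure using pos
    by (intro density_cong) (auto simp: divide_ennreal[of 1, simplified] split: split_indicator)
  then have "(\<integral>x. f x \<partial>uniform_measure M A) = (\<integral>x. indicator A x / prob A * f x \<partial>M)"
    using pos by (simp add: integral_density)
  then show ?thesis by (simp add: mult.commute)
qed

abbreviation std_normal :: "real measure" where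
  "std_normal \<equiv> density lborel std_normal_density"

lemma prob_space_std_normal: "prob_space std_normal"
  by (rule prob_space_normal_density) simp

lemma integrable_std_normal_pow: "integrable std_normal (\<lambda>z. z ^ k)"
  by (subst integrable_density) (auto simp: integrable_std_normal_moment normal_density_nonneg)

text \<open>
  With \<open>c z = \<alpha>\<^sub>1 z\<^sup>2 + \<beta>\<^sub>1\<close>, the recursion reads \<open>(\<sigma>\<^sub>t)\<^sup>2 = \<alpha>\<^sub>0 + c \<epsilon>\<^sub>t (\<sigma>\<^sub>t\<^sub>-\<^sub>1)\<^sup>2\<close>, and
  its solution started at time \<open>s\<close> is \<open>(\<sigma>\<^sub>t)\<^sup>2 = \<alpha>\<^sub>0 * vol_load + (\<sigma>\<^sub>s)\<^sup>2 * vol_gain\<close>.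
\<close>

definition vol_gain :: "(real \<Rightarrow> real) \<Rightarrow> int \<Rightarrow> int \<Rightarrow> (int \<Rightarrow> real) \<Rightarrow> real" where
  "vol_gain c s t e = (\<Prod>i\<in>{s<..t}. c (e i))"

definition vol_load :: "(real \<Rightarrow> real) \<Rightarrow> int \<Rightarrow> int \<Rightarrow> (int \<Rightarrow> real) \<Rightarrow> real" where
  "vol_load c s t e = (\<Sum>j\<in>{s<..t}. vol_gain c j t e)"

text \<open>Dividing by \<open>x\<close> turns \<alpha>_0 into a = \<alpha>_0 / x^2 and \<sigma>_s
  into v = \<sigma>_s / x, and the value is \<zeta>_t / x. The limiting paths are those with a =
  0.\<close>

definition vol_path :: "(real \<Rightarrow> real) \<Rightarrow> int \<Rightarrow> real \<Rightarrow> real \<Rightarrow> (int \<Rightarrow> real) \<Rightarrow> int \<Rightarrow> real" where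
  "vol_path c s a v e t = sqrt (a * vol_load c s t e + v\<^sup>2 * vol_gain c s t e) * e (t + 1)"

lemma greaterThanAtMost_int_add_one: "s \<le> t \<Longrightarrow> {s<..t + 1} = insert (t + 1) {s<..t}" for s t :: int
  by auto

lemma vol_gain_same [simp]: "vol_gain c s s e = 1"
  by (simp add: vol_gain_def)

lemma vol_load_same [simp]: "vol_load c s s e = 0"
  by (simp add: vol_load_def)

lemma vol_gain_add_one: "s \<le> t \<Longrightarrow> vol_gain c s (t + 1) e = c (e (t + 1)) * vol_gain c s t e"
  by (simp add: vol_gain_def greaterThanAtMost_int_add_one)

lemma vol_gain_trans:
  "s \<le> t \<Longrightarrow> t \<le> u \<Longrightarrow> vol_gain c s u e = vol_gain c s t e * vol_gain c t u e"
  unfolding vol_gain_def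
  by (subst prod.union_disjoint[symmetric]) (auto intro!: prod.cong)

lemma vol_load_add_one:
  assumes "s \<le> t"
  shows "vol_load c s (t + 1) e = 1 + c (e (t + 1)) * vol_load c s t e"
proof -
  have "vol_load c s (t + 1) e = 1 + (\<Sum>j\<in>{s<..t}. vol_gain c j (t + 1) e)"
    using assms by (simp add: vol_load_def greaterThanAtMost_int_add_one)
  also have "(\<Sum>j\<in>{s<..t}. vol_gain c j (t + 1) e) = (\<Sum>j\<in>{s<..t}. c (e (t + 1)) * vol_gain c j t e)"
    by (intro sum.cong refl vol_gain_add_one) auto
  finally show ?thesis
    by (simp add: vol_load_def sum_distrib_left)
qed

lemma vol_gain_nonneg: "(\<And>z. c z \<ge> 0) \<Longrightarrow> vol_gain c s t e \<ge> 0"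
  unfolding vol_gain_def by (intro prod_nonneg) auto

lemma vol_load_nonneg: "(\<And>z. c z \<ge> 0) \<Longrightarrow> vol_load c s t e \<ge> 0"
  unfolding vol_load_def by (intro sum_nonneg vol_gain_nonneg) auto

text \<open>The sum of load and gain obeys u' = 1 + c u, the product obeys Q' = Q + c Q with Q \<ge>
  1. A bound in product form is wanted because it can be integrated one innovation at a
  time.\<close>

lemma vol_load_plus_gain_le:
  assumes c: "\<And>z. c z \<ge> 0" and "s \<le> t"
  shows "vol_load c s t e + vol_gain c s t e \<le> (\<Prod>i\<in>{s<..t}. 1 + c (e i))"
  using \<open>s \<le> t\<close>
proof (induction t rule: int_ge_induct)
  case (step t)
  let ?Q = "\<Prod>i\<in>{s<..t}. 1 + c (e i)"
  have "?Q \<ge> 1" using c by (intro prod_ge_1) auto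
  have "vol_load c s (t + 1) e + vol_gain c s (t + 1) e =
      1 + c (e (t + 1)) * (vol_load c s t e + vol_gain c s t e)"
    unfolding vol_load_add_one[OF step.hyps] vol_gain_add_one[OF step.hyps] by (simp add: algebra_simps)
  also have "\<dots> \<le> ?Q + c (e (t + 1)) * ?Q"
    using step.IH c \<open>?Q \<ge> 1\<close> by (intro add_mono mult_left_mono) auto
  also have "\<dots> = (\<Prod>i\<in>{s<..t + 1}. 1 + c (e i))"
    unfolding greaterThanAtMost_int_add_one[OF step.hyps] by (simp add: algebra_simps)
  finally show ?case .
qed simp

lemma vol_gain_cong: "(\<And>i. i \<in> {s<..t} \<Longrightarrow> e i = e' i) \<Longrightarrow> vol_gain c s t e = vol_gain c s t e'"
  unfolding vol_gain_def by (intro prod.cong) auto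

lemma vol_load_cong: "(\<And>i. i \<in> {s<..t} \<Longrightarrow> e i = e' i) \<Longrightarrow> vol_load c s t e = vol_load c s t e'"
  unfolding vol_load_def by (intro sum.cong vol_gain_cong) auto

lemma vol_path_cong:
  assumes "s \<le> t" "\<And>i. i \<in> {s<..t + 1} \<Longrightarrow> e i = e' i"
  shows "vol_path c s a v e t = vol_path c s a v e' t"
  using assms vol_gain_cong[of s t e e' c] vol_load_cong[of s t e e' c] by (simp add: vol_path_def)

lemma vol_gain_measurable:
  assumes "c \<in> borel_measurable borel" and J: "{s<..t} \<subseteq> J"
  shows "vol_gain c s t \<in> borel_measurable (PiM J (\<lambda>_. borel))"
proof -
  have "(\<lambda>e. c (e i)) \<in> borel_measurable (PiM J (\<lambda>_. borel))" if "i \<in> {s<..t}" for i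
    using that J by (intro measurable_compose[OF _ assms(1)] measurable_component_singleton) auto
  then show ?thesis
    unfolding vol_gain_def[abs_def] by (rule borel_measurable_prod)
qed

lemma vol_load_measurable:
  assumes "c \<in> borel_measurable borel" and J: "{s<..t} \<subseteq> J"
  shows "vol_load c s t \<in> borel_measurable (PiM J (\<lambda>_. borel))"
  unfolding vol_load_def[abs_def]
  by (intro borel_measurable_sum vol_gain_measurable assms) (use J in auto)

lemma borel_measurable_vol_path:
  assumes "s \<le> t" and c: "c \<in> borel_measurable borel" and J: "{s<..t + 1} \<subseteq> J"
    and g: "g \<in> M \<rightarrow>\<^sub>M PiM J (\<lambda>_. borel)" and h [measurable]: "h \<in> borel_measurable M"
  shows "(\<lambda>x. vol_path c s a (h x) (g x) t) \<in> borel_measurable M"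
proof -
  have J': "{s<..t} \<subseteq> J" "t + 1 \<in> J" using J \<open>s \<le> t\<close> by auto
  note m = vol_load_measurable[OF c J'(1)] vol_gain_measurable[OF c J'(1)]
    measurable_component_singleton[OF J'(2)]
  note [measurable] = m[THEN measurable_compose[OF g]]
  show ?thesis
    unfolding vol_path_def by measurable
qed

lemma tendsto_vol_path:
  "a \<longlonglongrightarrow> a0 \<Longrightarrow> v \<longlonglongrightarrow> v0 \<Longrightarrow> (\<lambda>k. vol_path c s (a k) (v k) e t) \<longlonglongrightarrow> vol_path c s a0 v0 e t"
  unfolding vol_path_def by (intro tendsto_intros)

section \<open>The GARCH path as a function of one volatility and the later innovations\<close>

context garch11
begin

definition arch_factor :: "real \<Rightarrow> real" where
  "arch_factor z = \<alpha>\<^sub>1 * z\<^sup>2 + \<beta>\<^sub>1"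

lemma arch_factor_nonneg: "arch_factor z \<ge> 0"
  using \<alpha>\<^sub>1_pos \<beta>\<^sub>1_nonneg by (simp add: arch_factor_def)

lemma arch_factor_pos: "z \<noteq> 0 \<Longrightarrow> arch_factor z > 0"
  using \<alpha>\<^sub>1_pos \<beta>\<^sub>1_nonneg by (simp add: arch_factor_def add_pos_nonneg)

lemma arch_factor_measurable [measurable]: "arch_factor \<in> borel_measurable borel"
  unfolding arch_factor_def[abs_def] by measurable

lemma measurable_innov [measurable]: "\<epsilon> t \<in> borel_measurable M"
  using distributed_measurable[OF innov_normal[of t]] by simp

declare measurable_\<zeta> [measurable] measurable_\<sigma> [measurable]

lemma innov_law: "distr M borel (\<epsilon> t) = std_normal"
  using distributed_distr_eq_density[OF innov_normal[of t]]
  by (simp cong: distr_cong)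

lemma volatility_law: "distr M borel (\<sigma> t) = distr M borel (\<sigma> 0)"
proof -
  let ?P = "PiM (UNIV :: int set) (\<lambda>_. borel :: (real \<times> real) measure)"
  have meas: "(\<lambda>\<omega> u. (\<zeta> (u + h) \<omega>, \<sigma> (u + h) \<omega>)) \<in> M \<rightarrow>\<^sub>M ?P" for h
    by (rule measurable_PiM_single') auto
  have "snd \<in> borel_measurable (borel :: (real \<times> real) measure)"
    by (simp flip: borel_prod)
  then have "(\<lambda>y. snd (y 0)) \<in> borel_measurable ?P"
    by (rule measurable_compose[rotated]) (rule measurable_component_singleton, simp)
  then have "distr M borel (\<sigma> h) = distr (distr M ?P (\<lambda>\<omega> u. (\<zeta> (u + h) \<omega>, \<sigma> (u + h) \<omega>))) borel (\<lambda>y. snd (y 0))" for h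
    by (subst distr_distr[OF _ meas]) (auto simp: comp_def)
  from this[of t] this[of 0] show ?thesis
    by (simp add: strictly_stationary[of t])
qed

text \<open>Used twice: it makes the volatility the positive root of its square, and it lets
  \<alpha>_0 be bounded by \<sigma>^2 in the domination argument.\<close>

lemma volatility_ge: "AE \<omega> in M. \<sigma> t \<omega> \<ge> sqrt \<alpha>\<^sub>0"
  using \<sigma>_eq[of t]
proof eventually_elim
  case (elim \<omega>)
  then show ?case
    using \<alpha>\<^sub>1_pos \<beta>\<^sub>1_nonneg by (simp add: real_sqrt_le_iff)
qed

lemma volatility_sq:
  "AE \<omega> in M. \<forall>t\<ge>s. (\<sigma> t \<omega>)\<^sup>2 =
     \<alpha>\<^sub>0 * vol_load arch_factor s t (\<lambda>i. \<epsilon> i \<omega>) + (\<sigma> s \<omega>)\<^sup>2 * vol_gain arch_factor s t (\<lambda>i. \<epsilon> i \<omega>)"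
proof -
  have "AE \<omega> in M. \<forall>t. \<sigma> t \<omega> =
        sqrt (\<alpha>\<^sub>0 + \<alpha>\<^sub>1 * (\<sigma> (t - 1) \<omega>)\<^sup>2 * (\<epsilon> t \<omega>)\<^sup>2 + \<beta>\<^sub>1 * (\<sigma> (t - 1) \<omega>)\<^sup>2)"
    using \<sigma>_eq by (simp add: AE_all_countable)
  then show ?thesis
  proof eventually_elim
    case (elim \<omega>)
    show ?case
    proof (intro allI impI)
      fix t assume "t \<ge> s"
      then show "(\<sigma> t \<omega>)\<^sup>2 =
        \<alpha>\<^sub>0 * vol_load arch_factor s t (\<lambda>i. \<epsilon> i \<omega>) + (\<sigma> s \<omega>)\<^sup>2 * vol_gain arch_factor s t (\<lambda>i. \<epsilon> i \<omega>)"
      proof (induction t rule: int_ge_induct)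
        case (step t)
        have "\<sigma> (t + 1) \<omega> = sqrt (\<alpha>\<^sub>0 + arch_factor (\<epsilon> (t + 1) \<omega>) * (\<sigma> t \<omega>)\<^sup>2)"
          using elim[rule_format, of "t + 1"] by (simp add: arch_factor_def algebra_simps)
        then have "(\<sigma> (t + 1) \<omega>)\<^sup>2 = \<alpha>\<^sub>0 + arch_factor (\<epsilon> (t + 1) \<omega>) * (\<sigma> t \<omega>)\<^sup>2"
          using \<alpha>\<^sub>0_pos arch_factor_nonneg by simp
        then show ?case
          unfolding vol_load_add_one[OF step.hyps] vol_gain_add_one[OF step.hyps] step.IH
          by (simp add: algebra_simps)
      qed simp
    qed
  qed
qed

text \<open>The exceptional set stems only from the countably many recursion equations, so the
  uncountable quantifier over \<open>x\<close> may stand inside the almost sure statement.\<close>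

lemma scaled_return_eq:
  "AE \<omega> in M. \<forall>t\<ge>s. \<forall>x>0. \<zeta> t \<omega> / x =
     vol_path arch_factor s (\<alpha>\<^sub>0 / x\<^sup>2) (\<sigma> s \<omega> / x) (\<lambda>i. \<epsilon> i \<omega>) t"
proof -
  have "AE \<omega> in M. \<forall>t. \<sigma> t \<omega> \<ge> sqrt \<alpha>\<^sub>0" "AE \<omega> in M. \<forall>t. \<zeta> t \<omega> = \<sigma> t \<omega> * \<epsilon> (t + 1) \<omega>"
    using volatility_ge \<zeta>_eq by (auto simp: AE_all_countable)
  then show ?thesis
    using volatility_sq[of s]
  proof eventually_elim
    case (elim \<omega>)
    show ?case
    proof (intro allI impI)
      fix t :: int and x :: real assume t: "t \<ge> s" and x: "x > 0"
      let ?e = "\<lambda>i. \<epsilon> i \<omega>"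
      have "\<sigma> t \<omega> \<ge> 0" using elim(1)[rule_format, of t] real_sqrt_gt_zero[OF \<alpha>\<^sub>0_pos] by linarith
      have "\<alpha>\<^sub>0 / x\<^sup>2 * vol_load arch_factor s t ?e + (\<sigma> s \<omega> / x)\<^sup>2 * vol_gain arch_factor s t ?e = (\<sigma> t \<omega>)\<^sup>2 / x\<^sup>2"
        unfolding elim(3)[rule_format, OF t] by (simp add: power_divide add_divide_distrib)
      then show "\<zeta> t \<omega> / x = vol_path arch_factor s (\<alpha>\<^sub>0 / x\<^sup>2) (\<sigma> s \<omega> / x) ?e t"
        using \<open>\<sigma> t \<omega> \<ge> 0\<close> x elim(2) by (simp add: vol_path_def real_sqrt_divide)
    qed
  qed
qed

text \<open>Three hypotheses meet here: the volatility up to \<open>s\<close> is independent of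
  later innovations, these are i.i.d. normal, and by stationarity \<sigma>_s has the law of
  \<sigma>_0, whose tail is the known one.\<close>

lemma innovations_volatility_law:
  assumes J: "finite J" "J \<noteq> {}" "J \<subseteq> {s<..}"
  shows "distr M (PiM J (\<lambda>_. borel) \<Otimes>\<^sub>M borel) (\<lambda>\<omega>. (\<lambda>i\<in>J. \<epsilon> i \<omega>, \<sigma> s \<omega>)) =
    PiM J (\<lambda>_. std_normal) \<Otimes>\<^sub>M distr M borel (\<sigma> 0)"
proof -
  let ?P = "PiM J (\<lambda>_. borel :: real measure)" and ?Q = "PiM {s} (\<lambda>_. borel :: real measure)"
  let ?e = "\<lambda>\<omega>. \<lambda>i\<in>J. \<epsilon> i \<omega>" and ?y = "\<lambda>\<omega>. \<lambda>i\<in>{s}. \<sigma> i \<omega>"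
  have "indep_var ?P ((\<lambda>e. restrict e J) \<circ> (\<lambda>\<omega>. \<lambda>t\<in>{s<..}. \<epsilon> t \<omega>))
      ?Q ((\<lambda>y. restrict y {s}) \<circ> (\<lambda>\<omega>. \<lambda>t\<in>{..s}. \<sigma> t \<omega>))"
    using J by (intro indep_var_compose[OF future_indep[of s]] measurable_restrict_subset) auto
  also have "(\<lambda>e. restrict e J) \<circ> (\<lambda>\<omega>. \<lambda>t\<in>{s<..}. \<epsilon> t \<omega>) = ?e"
    using J by (auto simp: fun_eq_iff restrict_def)
  also have "(\<lambda>y. restrict y {s}) \<circ> (\<lambda>\<omega>. \<lambda>t\<in>{..s}. \<sigma> t \<omega>) = ?y"
    by (auto simp: fun_eq_iff restrict_def)
  finally have "distr M (?P \<Otimes>\<^sub>M borel) (\<lambda>\<omega>. (?e \<omega>, \<sigma> s \<omega>)) = distr M ?P ?e \<Otimes>\<^sub>M distr M borel (\<sigma> s)"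
    by (rule distr_pair_coordinate)
  also have "distr M (PiM J (\<lambda>_. borel)) (\<lambda>\<omega>. \<lambda>i\<in>J. \<epsilon> i \<omega>) = PiM J (\<lambda>i. distr M borel (\<epsilon> i))"
    using J indep_vars_subset[OF innov_indep, of J]
    by (subst indep_vars_iff_distr_eq_PiM'[symmetric]) auto
  finally show ?thesis
    unfolding innov_law volatility_law[of s] .
qed

text \<open>Nonzero innovations make the gain positive even if \<beta>_1 = 0, and allow division by
  \<open>e 1\<close> in the exceedance threshold.\<close>

lemma AE_innovations_nonzero:
  assumes "finite J"
  shows "AE e in PiM J (\<lambda>_. std_normal). \<forall>i\<in>J. e i \<noteq> 0"
proof -
  have "AE z in std_normal. z \<noteq> (0::real)"
    using AE_lborel_singleton[of 0] by (subst AE_density) auto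
  then show ?thesis
    using assms by (intro AE_finite_allI AE_PiM_component prob_space_std_normal) auto
qed

end

section \<open>Exceedance expectations\<close>

lemma integrable_std_normal_power_prod:
  assumes "0 \<le> a" "0 \<le> b"
  shows "integrable std_normal (\<lambda>z. ((1 + (a * z\<^sup>2 + b)) * (1 + z\<^sup>2)) ^ j)"
proof -
  \<comment> \<open>One factor comes from 1 + a z^2 + b \<le> (1 + a + b) (1 + z^2), the other from
    1 + z^2 \<le> 2 max 1 (z^2), raised to the power 2 j.\<close>
  define C where "C = (1 + a + b) ^ j * 2 ^ (2 * j)"
  have bound: "((1 + (a * z\<^sup>2 + b)) * (1 + z\<^sup>2)) ^ j \<le> C * (1 + z ^ (4 * j))" for z :: real
  proof -
    have "1 + (a * z\<^sup>2 + b) \<le> (1 + a + b) * (1 + z\<^sup>2)"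
      using assms by (simp add: algebra_simps)
    then have "((1 + (a * z\<^sup>2 + b)) * (1 + z\<^sup>2)) ^ j \<le> ((1 + a + b) * (1 + z\<^sup>2) * (1 + z\<^sup>2)) ^ j"
      using assms by (intro power_mono mult_right_mono) auto
    also have "\<dots> = (1 + a + b) ^ j * (1 + z\<^sup>2) ^ (2 * j)"
      by (simp add: power_mult_distrib mult.assoc power_add[symmetric] mult_2)
    also have "(1 + z\<^sup>2) ^ (2 * j) \<le> (2 * max 1 (z\<^sup>2)) ^ (2 * j)"
      by (intro power_mono) auto
    also have "(2 * max 1 (z\<^sup>2)) ^ (2 * j) = 2 ^ (2 * j) * (max 1 (z\<^sup>2)) ^ (2 * j)"
      by (rule power_mult_distrib)
    also have "(max 1 (z\<^sup>2)) ^ (2 * j) \<le> 1 + z ^ (4 * j)"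
    proof (cases "z\<^sup>2 \<le> 1")
      case False
      then show ?thesis by (simp add: max_def flip: power_mult)
    qed (simp add: max_def zero_le_even_power)
    finally show ?thesis
      unfolding C_def using assms by (simp add: mult.assoc mult_left_mono)
  qed
  show ?thesis
  proof (rule Bochner_Integration.integrable_bound)
    interpret prob_space std_normal by (rule prob_space_std_normal)
    show "integrable std_normal (\<lambda>z. C * (1 + z ^ (4 * j)))"
      by (intro Bochner_Integration.integrable_mult_right Bochner_Integration.integrable_add
          integrable_std_normal_pow) simp
    show "AE z in std_normal. norm (((1 + (a * z\<^sup>2 + b)) * (1 + z\<^sup>2)) ^ j) \<le> norm (C * (1 + z ^ (4 * j)))"
    proof (rule AE_I2)
      fix z :: real
      have "0 \<le> ((1 + (a * z\<^sup>2 + b)) * (1 + z\<^sup>2)) ^ j" using assms by simp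
      then show "norm (((1 + (a * z\<^sup>2 + b)) * (1 + z\<^sup>2)) ^ j) \<le> norm (C * (1 + z ^ (4 * j)))"
        using bound[of z] by simp
    qed
  qed measurable
qed

section \<open>The weight of the limit, the dominating function and the passage to the limit\<close>

context garch11
begin

text \<open>This is the \<open>d\<close> of the overview: for a = 0 and v \<ge> 0 the absolute value
  of the path at time 0 is \<open>v * path_scale s e\<close>.\<close>

definition path_scale :: "int \<Rightarrow> (int \<Rightarrow> real) \<Rightarrow> real" where
  "path_scale s e = sqrt (vol_gain arch_factor s 0 e) * \<bar>e 1\<bar>"

lemma path_scale_measurable:
  assumes "s \<le> 0" "0 \<le> n"
  shows "path_scale s \<in> borel_measurable (PiM {s<..n + 1} (\<lambda>_. std_normal))"
proof -
  have [measurable]: "(\<lambda>e. e 1) \<in> borel_measurable (PiM {s<..n + 1} (\<lambda>_. borel :: real measure))"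
    "vol_gain arch_factor s 0 \<in> borel_measurable (PiM {s<..n + 1} (\<lambda>_. borel))"
    using assms by (auto intro!: vol_gain_measurable)
  have "path_scale s \<in> borel_measurable (PiM {s<..n + 1} (\<lambda>_. borel))"
    unfolding path_scale_def[abs_def] by measurable
  moreover have "sets (PiM {s<..n + 1} (\<lambda>_. std_normal)) = sets (PiM {s<..n + 1} (\<lambda>_. borel))"
    by (intro sets_PiM_cong) auto
  ultimately show ?thesis
    using measurable_cong_sets[OF _ refl] by blast
qed

lemma limit_integrand_measurable:
  assumes "s \<le> 0" "0 \<le> n" and f: "f \<in> borel_measurable (PiM {s..n} (\<lambda>_. borel))" and \<nu>: "sets \<nu> = sets borel"
  shows "(\<lambda>(e, y). f (\<lambda>t\<in>{s..n}. vol_path arch_factor s 0 (y / path_scale s e) e t))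
    \<in> borel_measurable (PiM {s<..n + 1} (\<lambda>_. std_normal) \<Otimes>\<^sub>M \<nu>)"
proof -
  have sets: "sets (PiM {s<..n + 1} (\<lambda>_. std_normal)) = sets (PiM {s<..n + 1} (\<lambda>_. borel))"
    by (intro sets_PiM_cong) auto
  have fst: "fst \<in> PiM {s<..n + 1} (\<lambda>_. std_normal) \<Otimes>\<^sub>M \<nu> \<rightarrow>\<^sub>M PiM {s<..n + 1} (\<lambda>_. borel)"
    using measurable_fst measurable_cong_sets[OF refl sets] by blast
  have snd: "snd \<in> PiM {s<..n + 1} (\<lambda>_. std_normal) \<Otimes>\<^sub>M \<nu> \<rightarrow>\<^sub>M borel"
    using measurable_snd measurable_cong_sets[OF refl \<nu>] by blast
  show ?thesis
    unfolding split_beta' using assms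
    by (intro measurable_compose[OF measurable_restrict f] borel_measurable_vol_path[where J="{s<..n + 1}"] fst
        borel_measurable_divide snd measurable_compose[OF measurable_fst path_scale_measurable]
        arch_factor_measurable) auto
qed

text \<open>
  The dominating function: \<open>(\<sigma>\<^sub>s)\<^sup>2 \<ge> \<alpha>\<^sub>0\<close> lets the additive term \<open>a = \<alpha>\<^sub>0 / x\<^sup>2\<close> be
  absorbed into the multiple of \<open>v\<^sup>2\<close>.
\<close>

definition envelope :: "int set \<Rightarrow> (int \<Rightarrow> real) \<Rightarrow> real" where
  "envelope J e = (\<Prod>i\<in>J. (1 + arch_factor (e i)) * (1 + (e i)\<^sup>2))"

lemma envelope_factor_ge_1: "(1 + arch_factor z) * (1 + z\<^sup>2) \<ge> 1"
proof -
  have "1 * 1 \<le> (1 + arch_factor z) * (1 + z\<^sup>2)"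
    using arch_factor_nonneg by (intro mult_mono) auto
  then show ?thesis by simp
qed

lemma envelope_ge_1: "envelope J e \<ge> 1"
  unfolding envelope_def by (intro prod_ge_1 envelope_factor_ge_1)

text \<open>The envelope is a product over independent coordinates, so the claim reduces to
  one-dimensional normal moments.\<close>

lemma integrable_envelope_power:
  assumes "finite J"
  shows "integrable (PiM J (\<lambda>_. std_normal)) (\<lambda>e. envelope J e ^ j)"
proof -
  interpret product_prob_space "\<lambda>_ :: int. std_normal"
    by (intro product_prob_spaceI prob_space_std_normal)
  have "integrable (PiM J (\<lambda>_. std_normal)) (\<lambda>e. \<Prod>i\<in>J. ((1 + arch_factor (e i)) * (1 + (e i)\<^sup>2)) ^ j)"
    using \<alpha>\<^sub>1_pos \<beta>\<^sub>1_nonneg unfolding arch_factor_def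
    by (intro product_integrable_prod[where f="\<lambda>_ z. ((1 + (\<alpha>\<^sub>1 * z\<^sup>2 + \<beta>\<^sub>1)) * (1 + z\<^sup>2)) ^ j"] assms
        integrable_std_normal_power_prod) auto
  then show ?thesis
    unfolding envelope_def prod_power_distrib .
qed

lemma vol_path_le_envelope:
  assumes "s \<le> 0" "0 \<le> n" "0 \<le> a" "a \<le> v\<^sup>2"
  shows "(vol_path arch_factor s a v e 0)\<^sup>2 \<le> v\<^sup>2 * envelope {s<..n + 1} e"
proof -
  let ?Q = "vol_load arch_factor s 0 e" and ?P = "vol_gain arch_factor s 0 e"
  let ?G = "\<lambda>i. (1 + arch_factor (e i)) * (1 + (e i)\<^sup>2)"
  have Q: "?Q \<ge> 0" and P: "?P \<ge> 0"
    by (auto intro: vol_load_nonneg vol_gain_nonneg arch_factor_nonneg)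
  have "(vol_path arch_factor s a v e 0)\<^sup>2 = (a * ?Q + v\<^sup>2 * ?P) * (e 1)\<^sup>2"
    using Q P \<open>0 \<le> a\<close> by (simp add: vol_path_def power_mult_distrib)
  \<comment> \<open>Replacing \<open>a\<close> by v^2 lets v^2 be factored out, leaving the sum of
    load and gain.\<close>
  also have "\<dots> \<le> (v\<^sup>2 * ?Q + v\<^sup>2 * ?P) * (e 1)\<^sup>2"
    using Q \<open>a \<le> v\<^sup>2\<close> by (intro mult_right_mono add_right_mono) auto
  also have "\<dots> = v\<^sup>2 * ((?Q + ?P) * (e 1)\<^sup>2)"
    by (simp add: algebra_simps)
  also have "(?Q + ?P) * (e 1)\<^sup>2 \<le> (\<Prod>i\<in>{s<..0}. 1 + arch_factor (e i)) * (e 1)\<^sup>2"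
    using assms arch_factor_nonneg by (intro mult_right_mono vol_load_plus_gain_le) auto
  \<comment> \<open>The square of \<open>e 1\<close> is absorbed by the factor of index 1, and each
    remaining 1 + c by its own factor. Since all factors are at least 1, the index set can
    afterwards be enlarged up to \<open>n + 1\<close>.\<close>
  also have "\<dots> \<le> (\<Prod>i\<in>{s<..0}. ?G i) * ?G 1"
  proof (intro mult_mono prod_mono conjI prod_nonneg)
    fix i
    have *: "1 * (1 + arch_factor (e i)) \<le> (1 + (e i)\<^sup>2) * (1 + arch_factor (e i))"
      using arch_factor_nonneg[of "e i"] by (intro mult_right_mono) auto
    then show "1 + arch_factor (e i) \<le> ?G i"
      by (simp add: mult.commute)
    show "0 \<le> 1 + arch_factor (e i)" "0 \<le> ?G i"
      using arch_factor_nonneg[of "e i"] by auto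
    have "1 * (e 1)\<^sup>2 \<le> (1 + arch_factor (e 1)) * (1 + (e 1)\<^sup>2)"
      using arch_factor_nonneg[of "e 1"] by (intro mult_mono) auto
    then show "(e 1)\<^sup>2 \<le> ?G 1" by simp
  qed auto
  also have "\<dots> = (\<Prod>i\<in>{s<..1}. ?G i)"
    using greaterThanAtMost_int_add_one[of s 0] \<open>s \<le> 0\<close> by (simp add: mult.commute)
  also have "\<dots> \<le> envelope {s<..n + 1} e"
    unfolding envelope_def using assms envelope_factor_ge_1 arch_factor_nonneg
    by (intro prod_mono2) auto
  finally show ?thesis
    by (simp add: mult_left_mono)
qed

text \<open>With \<open>e\<close> fixed, the exceedance at time 0 becomes a half-line for the scaled
  volatility, the form required for regular variation.\<close>

lemma exceedance_iff:
  assumes s: "s \<le> 0" and P: "vol_gain arch_factor s 0 e > 0" and e: "e 1 \<noteq> 0" and v: "v > 0" and a: "a \<ge> 0"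
  shows "\<bar>vol_path arch_factor s a v e 0\<bar> > 1 \<longleftrightarrow>
    v > sqrt ((1 / (e 1)\<^sup>2 - a * vol_load arch_factor s 0 e) / vol_gain arch_factor s 0 e)"
proof -
  let ?Q = "vol_load arch_factor s 0 e" and ?P = "vol_gain arch_factor s 0 e"
  have Q: "?Q \<ge> 0" by (intro vol_load_nonneg arch_factor_nonneg)
  have "\<bar>vol_path arch_factor s a v e 0\<bar> > 1 \<longleftrightarrow> (vol_path arch_factor s a v e 0)\<^sup>2 > 1"
    using abs_le_square_iff[of "vol_path arch_factor s a v e 0" 1] by (simp add: not_le[symmetric])
  also have "(vol_path arch_factor s a v e 0)\<^sup>2 = (a * ?Q + v\<^sup>2 * ?P) * (e 1)\<^sup>2"
    using Q P a by (simp add: vol_path_def power_mult_distrib)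
  also have "1 < \<dots> \<longleftrightarrow> 1 / (e 1)\<^sup>2 < a * ?Q + v\<^sup>2 * ?P"
    using e by (simp add: pos_divide_less_eq)
  also have "\<dots> \<longleftrightarrow> (1 / (e 1)\<^sup>2 - a * ?Q) / ?P < v\<^sup>2"
    using P by (subst pos_divide_less_eq) auto
  \<comment> \<open>The left radicand may be negative; \<open>sqrt\<close> is odd and strictly
    increasing on all reals, so the equivalence persists.\<close>
  also have "\<dots> \<longleftrightarrow> sqrt ((1 / (e 1)\<^sup>2 - a * ?Q) / ?P) < sqrt (v\<^sup>2)"
    by (rule real_sqrt_less_iff[symmetric])
  finally show ?thesis using v by simp
qed

text \<open>By Fubini the expectation is the integral over \<open>e\<close> of \<open>H k e\<close>,
  in which the volatility alone is integrated out. \<open>H k e\<close> divided by the tail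
  converges for almost every \<open>e\<close> and is dominated by a power of the envelope. The
  sequence is kept above \<open>x0\<close> throughout, so that the domination holds for every
  \<open>k\<close>.\<close>

lemma exceedance_expectation_tendsto_of_potter_bound:
  fixes n s :: int and X :: "nat \<Rightarrow> real"
  defines "I \<equiv> {s..n}" and "J \<equiv> {s<..n + 1}" and "\<mu> \<equiv> distr M borel (\<sigma> 0)"
  assumes s: "s \<le> 0" and n: "0 \<le> n"
    and rv: "regularly_varying_law \<mu> (2 * \<alpha>)"
    and \<nu>: "real_distribution \<nu>" and pareto: "\<And>x. x \<ge> 1 \<Longrightarrow> measure \<nu> {x<..} = x powr (- (2 * \<alpha>))"
    and f: "continuous_map (product_topology (\<lambda>_. euclideanreal) I) euclideanreal f"
    and f_bdd: "\<And>y. y \<in> PiE I (\<lambda>_. UNIV) \<Longrightarrow> \<bar>f y\<bar> \<le> B"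
    and X: "filterlim X at_top sequentially" and X_ge: "\<And>k. X k \<ge> x0" and x0: "x0 > 0"
    and K: "K > 0" and potter: "\<And>x c. x \<ge> x0 \<Longrightarrow> c > 0 \<Longrightarrow> measure \<mu> {x / c<..} \<le> K * (1 + c\<^sup>2) ^ j * measure \<mu> {x<..}"
  shows "(\<lambda>k. (\<integral>\<omega>. f (\<lambda>t\<in>I. \<zeta> t \<omega> / X k) * indicator {\<omega>. \<bar>\<zeta> 0 \<omega>\<bar> > X k} \<omega> \<partial>M) / measure \<mu> {X k<..}) \<longlonglongrightarrow>
    (\<integral>e. path_scale s e powr (2 * \<alpha>) *
      (\<integral>y. f (\<lambda>t\<in>I. vol_path arch_factor s 0 (y / path_scale s e) e t) \<partial>\<nu>) \<partial>PiM J (\<lambda>_. std_normal))"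
proof -
  interpret rv: regularly_varying_law \<mu> "2 * \<alpha>" by fact
  interpret \<nu>: real_distribution \<nu> by fact
  let ?L = "PiM J (\<lambda>_. std_normal)"
  interpret L: product_prob_space "\<lambda>_ :: int. std_normal"
    by (intro product_prob_spaceI prob_space_std_normal)
  interpret L: prob_space ?L by (intro prob_space_PiM prob_space_std_normal)
  interpret pair: pair_prob_space ?L \<mu> ..
  have J: "finite J" "J \<noteq> {}" "J \<subseteq> {s<..}" "1 \<in> J" "{s<..0} \<subseteq> J" using s n by (auto simp: J_def)
  have sets_L: "sets ?L = sets (PiM J (\<lambda>_. borel))" by (intro sets_PiM_cong) auto
  have sets_\<mu>: "sets \<mu> = sets borel" by (simp add: \<mu>_def)
  define a where "a k = \<alpha>\<^sub>0 / (X k)\<^sup>2" for k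
  have X_pos: "X k > 0" for k using X_ge[of k] x0 by linarith
  have a_nonneg: "a k \<ge> 0" for k using \<alpha>\<^sub>0_pos by (simp add: a_def)
  have a_lim: "a \<longlonglongrightarrow> 0"
    unfolding a_def by (intro real_tendsto_divide_at_top[OF tendsto_const] filterlim_pow_at_top X) simp
  have B: "\<bar>f (\<lambda>t\<in>I. g t)\<bar> \<le> B" for g by (rule f_bdd) auto
  have "B \<ge> 0" using B[of "\<lambda>_. 0"] by linarith
  have f_meas: "f \<in> borel_measurable (PiM I (\<lambda>_. borel))"
    by (rule borel_measurable_continuous_map_product[OF f])
  have \<mu>_ge: "AE v in \<mu>. v \<ge> sqrt \<alpha>\<^sub>0"
    unfolding \<mu>_def using volatility_ge[of 0] by (subst AE_distr_iff) auto
  define \<Phi> where "\<Phi> k e v = f (\<lambda>t\<in>I. vol_path arch_factor s (a k) (v / X k) e t) *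
      indicator {1<..} \<bar>vol_path arch_factor s (a k) (v / X k) e 0\<bar>" for k e v
  have \<Phi>_bdd: "\<bar>\<Phi> k e v\<bar> \<le> B" for k e v
    using B[of "\<lambda>t. vol_path arch_factor s (a k) (v / X k) e t"] \<open>B \<ge> 0\<close>
    by (auto simp: \<Phi>_def split: split_indicator)
  have \<Phi>_meas: "(\<lambda>(e, v). \<Phi> k e v) \<in> borel_measurable (PiM J (\<lambda>_. borel) \<Otimes>\<^sub>M borel)" for k
  proof -
    let ?p = "\<lambda>p t. vol_path arch_factor s (a k) (snd p / X k) (fst p) t"
    have path: "(\<lambda>p. ?p p t) \<in> borel_measurable (PiM J (\<lambda>_. borel) \<Otimes>\<^sub>M borel)" if "t \<in> I" for t
      using that by (intro borel_measurable_vol_path[where J=J] arch_factor_measurable measurable_fst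
          borel_measurable_divide measurable_snd) (auto simp: I_def J_def)
    have [measurable]: "(\<lambda>p. ?p p 0) \<in> borel_measurable (PiM J (\<lambda>_. borel) \<Otimes>\<^sub>M borel)"
      using s n by (intro path) (simp add: I_def)
    have [measurable]: "(\<lambda>p. f (\<lambda>t\<in>I. ?p p t)) \<in> borel_measurable (PiM J (\<lambda>_. borel) \<Otimes>\<^sub>M borel)"
      by (intro measurable_compose[OF measurable_restrict f_meas] path)
    show ?thesis
      unfolding \<Phi>_def split_beta' by measurable
  qed
  have \<Phi>_meas': "(\<lambda>(e, v). \<Phi> k e v) \<in> borel_measurable (?L \<Otimes>\<^sub>M \<mu>)" for k
    using \<Phi>_meas[of k] by (simp add: measurable_cong_sets[OF sets_pair_measure_cong[OF sets_L sets_\<mu>] refl])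
  have \<Phi>_meas_v: "\<Phi> k e \<in> borel_measurable \<mu>" if "e \<in> space ?L" for k e
    using measurable_compose[OF measurable_Pair1'[OF that] \<Phi>_meas'[of k]] by simp
  define H where "H k e = (\<integral>v. \<Phi> k e v \<partial>\<mu>)" for k e
  have expectation_eq: "(\<integral>\<omega>. f (\<lambda>t\<in>I. \<zeta> t \<omega> / X k) * indicator {\<omega>. \<bar>\<zeta> 0 \<omega>\<bar> > X k} \<omega> \<partial>M) = (\<integral>e. H k e \<partial>?L)" for k
  proof -
    have [measurable]: "(\<lambda>\<omega>. \<lambda>i\<in>J. \<epsilon> i \<omega>) \<in> M \<rightarrow>\<^sub>M PiM J (\<lambda>_. borel)"
      by (rule measurable_restrict) simp
    have [measurable]: "(\<lambda>\<omega>. (\<lambda>i\<in>J. \<epsilon> i \<omega>, \<sigma> s \<omega>)) \<in> M \<rightarrow>\<^sub>M PiM J (\<lambda>_. borel) \<Otimes>\<^sub>M borel"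
      by measurable
    have [measurable]: "(\<lambda>\<omega>. f (\<lambda>t\<in>I. \<zeta> t \<omega> / X k)) \<in> borel_measurable M"
      by (intro measurable_compose[OF measurable_restrict f_meas]) auto
    have "(\<integral>\<omega>. f (\<lambda>t\<in>I. \<zeta> t \<omega> / X k) * indicator {\<omega>. \<bar>\<zeta> 0 \<omega>\<bar> > X k} \<omega> \<partial>M) =
      (\<integral>\<omega>. (case (\<lambda>i\<in>J. \<epsilon> i \<omega>, \<sigma> s \<omega>) of (e, v) \<Rightarrow> \<Phi> k e v) \<partial>M)"
    proof (rule integral_cong_AE)
      show "(\<lambda>\<omega>. f (\<lambda>t\<in>I. \<zeta> t \<omega> / X k) * indicator {\<omega>. \<bar>\<zeta> 0 \<omega>\<bar> > X k} \<omega>) \<in> borel_measurable M"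
        by measurable
      show "(\<lambda>\<omega>. case (\<lambda>i\<in>J. \<epsilon> i \<omega>, \<sigma> s \<omega>) of (e, v) \<Rightarrow> \<Phi> k e v) \<in> borel_measurable M"
        by (rule measurable_compose[OF _ \<Phi>_meas]) measurable
      show "AE \<omega> in M. f (\<lambda>t\<in>I. \<zeta> t \<omega> / X k) * indicator {\<omega>. \<bar>\<zeta> 0 \<omega>\<bar> > X k} \<omega> =
        (case (\<lambda>i\<in>J. \<epsilon> i \<omega>, \<sigma> s \<omega>) of (e, v) \<Rightarrow> \<Phi> k e v)"
        using scaled_return_eq[of s]
      proof eventually_elim
        case (elim \<omega>)
        have eq: "\<zeta> t \<omega> / X k = vol_path arch_factor s (a k) (\<sigma> s \<omega> / X k) (\<lambda>i\<in>J. \<epsilon> i \<omega>) t" if "t \<in> I" for t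
        proof -
          have "\<zeta> t \<omega> / X k = vol_path arch_factor s (a k) (\<sigma> s \<omega> / X k) (\<lambda>i. \<epsilon> i \<omega>) t"
            using elim that X_pos[of k] by (simp add: I_def a_def)
          also have "\<dots> = vol_path arch_factor s (a k) (\<sigma> s \<omega> / X k) (\<lambda>i\<in>J. \<epsilon> i \<omega>) t"
            using that by (intro vol_path_cong) (auto simp: I_def J_def)
          finally show ?thesis .
        qed
        have "\<bar>\<zeta> 0 \<omega>\<bar> > X k \<longleftrightarrow> \<bar>\<zeta> 0 \<omega> / X k\<bar> > 1"
          using X_pos[of k] by (simp add: abs_divide pos_less_divide_eq)
        moreover have "0 \<in> I" using s n by (simp add: I_def)
        ultimately have ind: "indicator {\<omega>. \<bar>\<zeta> 0 \<omega>\<bar> > X k} \<omega> =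
            (indicator {1<..} \<bar>vol_path arch_factor s (a k) (\<sigma> s \<omega> / X k) (\<lambda>i\<in>J. \<epsilon> i \<omega>) 0\<bar> :: real)"
          using eq[of 0] by (simp add: indicator_def)
        have "(\<lambda>t\<in>I. \<zeta> t \<omega> / X k) = (\<lambda>t\<in>I. vol_path arch_factor s (a k) (\<sigma> s \<omega> / X k) (\<lambda>i\<in>J. \<epsilon> i \<omega>) t)"
          by (intro restrict_ext eq)
        with ind show ?case by (simp add: \<Phi>_def)
      qed
    qed
    also have "\<dots> = (\<integral>p. (case p of (e, v) \<Rightarrow> \<Phi> k e v) \<partial>distr M (PiM J (\<lambda>_. borel) \<Otimes>\<^sub>M borel) (\<lambda>\<omega>. (\<lambda>i\<in>J. \<epsilon> i \<omega>, \<sigma> s \<omega>)))"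
      by (rule integral_distr[symmetric]) (auto intro: \<Phi>_meas)
    also have "\<dots> = (\<integral>p. (case p of (e, v) \<Rightarrow> \<Phi> k e v) \<partial>(?L \<Otimes>\<^sub>M \<mu>))"
      unfolding \<mu>_def innovations_volatility_law[OF J(1-3)] ..
    also have "\<dots> = (\<integral>e. H k e \<partial>?L)"
      unfolding H_def
      by (subst pair.integral_fst'[symmetric])
        (auto intro!: pair.P.integrable_const_bound[where B=B] \<Phi>_meas'[unfolded split_beta'] simp: \<Phi>_bdd split_beta')
    finally show ?thesis .
  qed
  \<comment> \<open>By the envelope inequality an exceedance forces v > X / sqrt D, where \<mu>_ge
    supplies its premise a \<le> (v / X)^2. The Potter bound is then applied with c = sqrt
    D.\<close>
  have H_bound: "\<bar>H k e / rv.T (X k)\<bar> \<le> B * K * 2 ^ j * envelope J e ^ j" if e: "e \<in> space ?L" for k e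
  proof -
    define D where "D = envelope J e"
    have D: "D \<ge> 1" unfolding D_def by (rule envelope_ge_1)
    note [measurable] = \<Phi>_meas_v[OF e, of k]
    have "\<bar>H k e\<bar> \<le> (\<integral>v. \<bar>\<Phi> k e v\<bar> \<partial>\<mu>)" unfolding H_def by (rule integral_abs_bound)
    also have "\<dots> \<le> (\<integral>v. B * indicator {X k / sqrt D<..} v \<partial>\<mu>)"
    proof (rule integral_mono_AE)
      show "integrable \<mu> (\<lambda>v. \<bar>\<Phi> k e v\<bar>)"
        by (rule rv.integrable_const_bound[where B=B]) (auto simp: \<Phi>_bdd)
      show "integrable \<mu> (\<lambda>v. B * indicator {X k / sqrt D<..} v)"
        by (rule rv.integrable_const_bound[where B=B]) (auto simp: \<open>B \<ge> 0\<close> split: split_indicator)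
      show "AE v in \<mu>. \<bar>\<Phi> k e v\<bar> \<le> B * indicator {X k / sqrt D<..} v"
        using \<mu>_ge
      proof eventually_elim
        case (elim v)
        show ?case
        proof (cases "\<bar>vol_path arch_factor s (a k) (v / X k) e 0\<bar> > 1")
          case True
          have v: "v > 0" using elim real_sqrt_gt_zero[OF \<alpha>\<^sub>0_pos] by linarith
          have "\<alpha>\<^sub>0 \<le> v\<^sup>2" using power_mono[OF elim, of 2] \<alpha>\<^sub>0_pos by simp
          then have "a k \<le> (v / X k)\<^sup>2" by (simp add: a_def power_divide divide_right_mono)
          then have "(vol_path arch_factor s (a k) (v / X k) e 0)\<^sup>2 \<le> (v / X k)\<^sup>2 * D"
            unfolding D_def J_def by (intro vol_path_le_envelope s n a_nonneg)
          also have "\<dots> = (v / X k * sqrt D)\<^sup>2" using D by (simp only: power_mult_distrib) simp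
          finally have "\<bar>vol_path arch_factor s (a k) (v / X k) e 0\<bar> \<le> \<bar>v / X k * sqrt D\<bar>"
            unfolding abs_le_square_iff .
          moreover have "v / X k * sqrt D \<ge> 0" using v X_pos[of k] D by simp
          ultimately have "1 < v / X k * sqrt D" using True by linarith
          then have "v > X k / sqrt D" using X_pos[of k] D by (simp add: pos_divide_less_eq pos_less_divide_eq)
          then show ?thesis using \<Phi>_bdd[of k e v] by simp
        next
          case False
          then show ?thesis using \<open>B \<ge> 0\<close> by (simp add: \<Phi>_def split: split_indicator)
        qed
      qed
    qed
    also have "\<dots> = B * rv.T (X k / sqrt D)" by simp
    also have "\<dots> \<le> B * (K * (1 + (sqrt D)\<^sup>2) ^ j * rv.T (X k))"
      using D \<open>B \<ge> 0\<close> X_ge by (intro mult_left_mono potter) auto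
    \<comment> \<open>Here 1 + D \<le> 2 D because D \<ge> 1.\<close>
    also have "\<dots> \<le> B * (K * (2 * D) ^ j * rv.T (X k))"
      using D \<open>B \<ge> 0\<close> K by (intro mult_left_mono mult_right_mono power_mono) auto
    finally show ?thesis
      using rv.tail_pos[of "X k"] by (simp add: D_def pos_divide_le_eq power_mult_distrib mult_ac)
  qed
  have H_lim: "(\<lambda>k. H k e / rv.T (X k)) \<longlonglongrightarrow> path_scale s e powr (2 * \<alpha>) *
      (\<integral>y. f (\<lambda>t\<in>I. vol_path arch_factor s 0 (y / path_scale s e) e t) \<partial>\<nu>)" if e0: "\<forall>i\<in>J. e i \<noteq> 0" for e
  proof -
    let ?P = "vol_gain arch_factor s 0 e" and ?Q = "vol_load arch_factor s 0 e"
    define w where "w k = sqrt ((1 / (e 1)\<^sup>2 - a k * ?Q) / ?P)" for k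
    have P: "?P > 0"
      unfolding vol_gain_def using e0 J by (intro prod_pos arch_factor_pos) auto
    have e1: "e 1 \<noteq> 0" using e0 J by auto
    have d: "path_scale s e > 0" using P e1 by (simp add: path_scale_def)
    have "w \<longlonglongrightarrow> sqrt ((1 / (e 1)\<^sup>2 - 0 * ?Q) / ?P)"
      unfolding w_def using P by (intro tendsto_intros a_lim) auto
    also have "sqrt ((1 / (e 1)\<^sup>2 - 0 * ?Q) / ?P) = 1 / path_scale s e"
      by (simp add: path_scale_def real_sqrt_divide real_sqrt_mult mult.commute)
    finally have w: "w \<longlonglongrightarrow> 1 / path_scale s e" .
    define g where "g k v = f (\<lambda>t\<in>I. vol_path arch_factor s (a k) v e t)" for k v
    define h where "h v = f (\<lambda>t\<in>I. vol_path arch_factor s 0 v e t)" for v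
    have meas: "(\<lambda>v. f (\<lambda>t\<in>I. vol_path arch_factor s b v e t)) \<in> borel_measurable borel" for b
      unfolding vol_path_def by (intro measurable_compose[OF measurable_restrict f_meas]) measurable
    have "(\<lambda>k. (\<integral>v. g k (v / X k) * indicator {X k * w k<..} v \<partial>\<mu>) / rv.T (X k))
        \<longlonglongrightarrow> (1 / path_scale s e) powr (- (2 * \<alpha>)) * (\<integral>y. h (1 / path_scale s e * y) \<partial>\<nu>)"
    proof (rule rv.conditioned_tail_integral_tendsto[OF \<nu> pareto X w])
      show "\<bar>g k v\<bar> \<le> B" for k v unfolding g_def by (rule B)
      show "(\<lambda>k. g k (v k)) \<longlonglongrightarrow> h v0" if "v \<longlonglongrightarrow> v0" for v v0
        unfolding g_def h_def by (intro tendsto_continuous_map_product[OF f] tendsto_vol_path a_lim that)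
    qed (use d meas in \<open>auto simp: g_def h_def\<close>)
    also have "(1 / path_scale s e) powr (- (2 * \<alpha>)) = path_scale s e powr (2 * \<alpha>)"
      using d by (simp add: powr_minus_divide powr_divide)
    also have "(\<integral>y. h (1 / path_scale s e * y) \<partial>\<nu>) =
        (\<integral>y. f (\<lambda>t\<in>I. vol_path arch_factor s 0 (y / path_scale s e) e t) \<partial>\<nu>)"
      by (simp add: h_def)
    also have "(\<lambda>k. (\<integral>v. g k (v / X k) * indicator {X k * w k<..} v \<partial>\<mu>) / rv.T (X k)) = (\<lambda>k. H k e / rv.T (X k))"
    proof
      fix k
      have "H k e = (\<integral>v. g k (v / X k) * indicator {X k * w k<..} v \<partial>\<mu>)"
        unfolding H_def
      proof (rule integral_cong_AE)
        have mg: "g k \<in> borel_measurable borel" unfolding g_def by (rule meas)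
        have eq: "\<Phi> k e v = g k (v / X k) * indicator {1<..} \<bar>vol_path arch_factor s (a k) (v / X k) e 0\<bar>" for v
          by (simp add: \<Phi>_def g_def)
        show "\<Phi> k e \<in> borel_measurable \<mu>"
          unfolding eq[abs_def] vol_path_def measurable_cong_sets[OF sets_\<mu> refl] using mg by measurable
        show "(\<lambda>v. g k (v / X k) * indicator {X k * w k<..} v) \<in> borel_measurable \<mu>"
          unfolding measurable_cong_sets[OF sets_\<mu> refl] using mg by measurable
        show "AE v in \<mu>. \<Phi> k e v = g k (v / X k) * indicator {X k * w k<..} v"
          using \<mu>_ge
        proof eventually_elim
          case (elim v)
          then have "v > 0" using real_sqrt_gt_zero[OF \<alpha>\<^sub>0_pos] by linarith
          then have "v / X k > 0" using X_pos[of k] by simp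
          from exceedance_iff[OF s P e1 this a_nonneg[of k]]
          have "\<bar>vol_path arch_factor s (a k) (v / X k) e 0\<bar> > 1 \<longleftrightarrow> v > X k * w k"
            using X_pos[of k] by (simp add: w_def pos_less_divide_eq mult.commute)
          then show ?case unfolding eq by (simp add: indicator_def)
        qed
      qed
      then show "(\<integral>v. g k (v / X k) * indicator {X k * w k<..} v \<partial>\<mu>) / rv.T (X k) = H k e / rv.T (X k)" by simp
    qed
    finally show ?thesis .
  qed
  have H_meas [measurable]: "H k \<in> borel_measurable ?L" for k
    unfolding H_def[abs_def] using \<Phi>_meas'[of k] by (rule rv.borel_measurable_lebesgue_integral)
  have "(\<lambda>k. \<integral>e. H k e / rv.T (X k) \<partial>?L) \<longlonglongrightarrow>
    (\<integral>e. path_scale s e powr (2 * \<alpha>) *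
      (\<integral>y. f (\<lambda>t\<in>I. vol_path arch_factor s 0 (y / path_scale s e) e t) \<partial>\<nu>) \<partial>?L)"
  proof (rule integral_dominated_convergence[where w="\<lambda>e. B * K * 2 ^ j * envelope J e ^ j"])
    show "integrable ?L (\<lambda>e. B * K * 2 ^ j * envelope J e ^ j)"
      by (intro Bochner_Integration.integrable_mult_right integrable_envelope_power J)
    show "AE e in ?L. (\<lambda>k. H k e / rv.T (X k)) \<longlonglongrightarrow> path_scale s e powr (2 * \<alpha>) *
      (\<integral>y. f (\<lambda>t\<in>I. vol_path arch_factor s 0 (y / path_scale s e) e t) \<partial>\<nu>)"
      using AE_innovations_nonzero[OF J(1)] by eventually_elim (rule H_lim)
    show "AE e in ?L. norm (H k e / rv.T (X k)) \<le> B * K * 2 ^ j * envelope J e ^ j" for k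
      using H_bound by (intro AE_I2) simp
    show "(\<lambda>e. path_scale s e powr (2 * \<alpha>) *
      (\<integral>y. f (\<lambda>t\<in>I. vol_path arch_factor s 0 (y / path_scale s e) e t) \<partial>\<nu>)) \<in> borel_measurable ?L"
    proof -
      have [measurable]: "path_scale s \<in> borel_measurable ?L"
        using s n unfolding J_def by (rule path_scale_measurable)
      have [measurable]: "(\<lambda>e. \<integral>y. f (\<lambda>t\<in>I. vol_path arch_factor s 0 (y / path_scale s e) e t) \<partial>\<nu>) \<in> borel_measurable ?L"
        using f_meas s n unfolding I_def J_def
        by (intro \<nu>.borel_measurable_lebesgue_integral limit_integrand_measurable) auto
      show ?thesis by measurable
    qed
  qed measurable
  then show ?thesis
    by (simp add: expectation_eq)
qed

text \<open>Replacing \<open>X k\<close> by its maximum with \<open>x0\<close> changes only finitely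
  many terms.\<close>

lemma exceedance_expectation_tendsto:
  fixes n s :: int and X :: "nat \<Rightarrow> real"
  defines "\<mu> \<equiv> distr M borel (\<sigma> 0)"
  assumes s: "s \<le> 0" and n: "0 \<le> n"
    and rv: "regularly_varying_law \<mu> (2 * \<alpha>)"
    and \<nu>: "real_distribution \<nu>" and pareto: "\<And>x. x \<ge> 1 \<Longrightarrow> measure \<nu> {x<..} = x powr (- (2 * \<alpha>))"
    and f: "continuous_map (product_topology (\<lambda>_. euclideanreal) {s..n}) euclideanreal f"
    and f_bdd: "\<And>y. y \<in> PiE {s..n} (\<lambda>_. UNIV) \<Longrightarrow> \<bar>f y\<bar> \<le> B"
    and X: "filterlim X at_top sequentially"
  shows "(\<lambda>k. (\<integral>\<omega>. f (\<lambda>t\<in>{s..n}. \<zeta> t \<omega> / X k) * indicator {\<omega>. \<bar>\<zeta> 0 \<omega>\<bar> > X k} \<omega> \<partial>M) / measure \<mu> {X k<..}) \<longlonglongrightarrow>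
    (\<integral>e. path_scale s e powr (2 * \<alpha>) *
      (\<integral>y. f (\<lambda>t\<in>{s..n}. vol_path arch_factor s 0 (y / path_scale s e) e t) \<partial>\<nu>) \<partial>PiM {s<..n + 1} (\<lambda>_. std_normal))"
proof -
  interpret rv: regularly_varying_law \<mu> "2 * \<alpha>" by fact
  obtain K x0 :: real and j :: nat where K: "K > 0" and x0: "x0 > 0"
    and potter: "\<And>x c. x \<ge> x0 \<Longrightarrow> c > 0 \<Longrightarrow> rv.T (x / c) \<le> K * (1 + c\<^sup>2) ^ j * rv.T x"
    using rv.potter_bound by blast
  define X' where "X' k = max x0 (X k)" for k
  have X': "filterlim X' at_top sequentially"
    using X by (rule filterlim_at_top_mono) (simp add: X'_def)
  have "eventually (\<lambda>k. X k \<ge> x0) sequentially"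
    using X by (simp add: filterlim_at_top)
  then have ev: "eventually (\<lambda>k. X' k = X k) sequentially"
    by eventually_elim (simp add: X'_def)
  have "(\<lambda>k. (\<integral>\<omega>. f (\<lambda>t\<in>{s..n}. \<zeta> t \<omega> / X' k) * indicator {\<omega>. \<bar>\<zeta> 0 \<omega>\<bar> > X' k} \<omega> \<partial>M) / measure \<mu> {X' k<..}) \<longlonglongrightarrow>
    (\<integral>e. path_scale s e powr (2 * \<alpha>) *
      (\<integral>y. f (\<lambda>t\<in>{s..n}. vol_path arch_factor s 0 (y / path_scale s e) e t) \<partial>\<nu>) \<partial>PiM {s<..n + 1} (\<lambda>_. std_normal))"
    unfolding \<mu>_def
  proof (rule exceedance_expectation_tendsto_of_potter_bound)
    show "X' k \<ge> x0" for k by (simp add: X'_def)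
    show "measure (distr M borel (\<sigma> 0)) {x / c<..} \<le> K * (1 + c\<^sup>2) ^ j * measure (distr M borel (\<sigma> 0)) {x<..}"
      if "x \<ge> x0" "c > 0" for x c
      using potter[OF that] unfolding \<mu>_def .
  qed (use s n rv \<nu> pareto f f_bdd X' x0 K in \<open>auto simp: \<mu>_def\<close>)
  then show ?thesis
    by (rule Lim_transform_eventually) (use ev in eventually_elim, simp)
qed

text \<open>The test function 1 shows that the exceedance probability is asymptotically the total
  weight times the tail of \<sigma>, a result of Breiman type; in the quotient the tail cancels.
  That the total weight is nonzero will follow from its identification with
  \<open>tilt_norm\<close>.\<close>

lemma conditional_expectation_tendsto:
  fixes n s :: int and X :: "nat \<Rightarrow> real"
  defines "L \<equiv> PiM {s<..n + 1} (\<lambda>_. std_normal)"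
  assumes s: "s \<le> 0" and n: "0 \<le> n"
    and rv: "regularly_varying_law (distr M borel (\<sigma> 0)) (2 * \<alpha>)"
    and \<nu>: "real_distribution \<nu>" and pareto: "\<And>x. x \<ge> 1 \<Longrightarrow> measure \<nu> {x<..} = x powr (- (2 * \<alpha>))"
    and f: "continuous_map (product_topology (\<lambda>_. euclideanreal) {s..n}) euclideanreal f"
    and f_bdd: "\<And>y. y \<in> PiE {s..n} (\<lambda>_. UNIV) \<Longrightarrow> \<bar>f y\<bar> \<le> B"
    and X: "filterlim X at_top sequentially"
    and nonzero: "(\<integral>e. path_scale s e powr (2 * \<alpha>) \<partial>L) \<noteq> 0"
  shows "(\<lambda>k. (\<integral>\<omega>. f (\<lambda>t\<in>{s..n}. \<zeta> t \<omega> / X k) * indicator {\<omega>. \<bar>\<zeta> 0 \<omega>\<bar> > X k} \<omega> \<partial>M) /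
      prob {\<omega> \<in> space M. \<bar>\<zeta> 0 \<omega>\<bar> > X k}) \<longlonglongrightarrow>
    (\<integral>e. path_scale s e powr (2 * \<alpha>) *
      (\<integral>y. f (\<lambda>t\<in>{s..n}. vol_path arch_factor s 0 (y / path_scale s e) e t) \<partial>\<nu>) \<partial>L) /
    (\<integral>e. path_scale s e powr (2 * \<alpha>) \<partial>L)"
proof -
  interpret rv: regularly_varying_law "distr M borel (\<sigma> 0)" "2 * \<alpha>" by fact
  interpret \<nu>: real_distribution \<nu> by fact
  have "(\<integral>\<omega>. 1 * indicator {\<omega>. \<bar>\<zeta> 0 \<omega>\<bar> > x} \<omega> \<partial>M) = prob {\<omega> \<in> space M. \<bar>\<zeta> 0 \<omega>\<bar> > x}" for x
    by (simp add: Int_def conj_commute)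
  moreover have "(\<lambda>k. (\<integral>\<omega>. 1 * indicator {\<omega>. \<bar>\<zeta> 0 \<omega>\<bar> > X k} \<omega> \<partial>M) / rv.T (X k)) \<longlonglongrightarrow>
    (\<integral>e. path_scale s e powr (2 * \<alpha>) * (\<integral>y. 1 \<partial>\<nu>) \<partial>L)"
    unfolding L_def
    by (rule exceedance_expectation_tendsto[OF s n rv \<nu> pareto _ _ X, where f="\<lambda>_. 1" and B=1]) auto
  ultimately have one: "(\<lambda>k. prob {\<omega> \<in> space M. \<bar>\<zeta> 0 \<omega>\<bar> > X k} / rv.T (X k)) \<longlonglongrightarrow>
    (\<integral>e. path_scale s e powr (2 * \<alpha>) \<partial>L)"
    by (simp add: \<nu>.prob_space[unfolded \<nu>.space_eq_univ])
  have "rv.T x \<noteq> 0" for x using rv.tail_pos[of x] by linarith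
  then show ?thesis
    using tendsto_divide[OF exceedance_expectation_tendsto[OF s n rv \<nu> pareto f f_bdd X, folded L_def] one nonzero]
    by simp
qed

end

section \<open>Symmetrisation and half-line laws\<close>

text \<open>The distribution function of \<open>A\<close> yields masses of closed half-lines with
  positive end, whereas the uniqueness criterion for measures asks for open ones. Those are
  increasing unions of closed ones, whose ends stay positive also for x = 0.\<close>

lemma emeasure_greaterThan_eqI:
  fixes \<mu> \<nu> :: "real measure"
  assumes sets: "sets \<mu> = sets borel" "sets \<nu> = sets borel"
    and eq: "\<And>r. r > 0 \<Longrightarrow> emeasure \<mu> {r..} = emeasure \<nu> {r..}" and x: "x \<ge> 0"
  shows "emeasure \<mu> {x<..} = emeasure \<nu> {x<..}"
proof -
  define A where "A k = {x + 1 / Suc k..}" for k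
  have A: "incseq A" "range A \<subseteq> sets borel" "(\<Union>k. A k) = {x<..}"
  proof -
    have "1 / real (Suc k) \<ge> 1 / real (Suc k')" if "k \<le> k'" for k k' :: nat
      using that by (simp add: frac_le)
    then show "incseq A" unfolding A_def incseq_def
      by (force intro: order_trans[rotated] add_left_mono)
    show "(\<Union>k. A k) = {x<..}"
    proof (intro equalityI subsetI)
      fix z assume "z \<in> {x<..}"
      then obtain k where "1 / Suc k < z - x"
        using nat_approx_posE[of "z - x"] by auto
      then show "z \<in> (\<Union>k. A k)" by (auto simp: A_def intro!: exI[of _ k])
    next
      fix z assume "z \<in> (\<Union>k. A k)"
      then obtain k where "x + 1 / Suc k \<le> z" by (auto simp: A_def)
      moreover have "1 / real (Suc k) > 0" by simp
      ultimately have "x < z" by linarith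
      then show "z \<in> {x<..}" by simp
    qed
  qed (auto simp: A_def)
  have "(\<lambda>k. emeasure \<mu> (A k)) = (\<lambda>k. emeasure \<nu> (A k))"
  proof
    fix k
    have "1 / real (Suc k) > 0" by simp
    then have "x + 1 / real (Suc k) > 0" using x by linarith
    then show "emeasure \<mu> (A k) = emeasure \<nu> (A k)" unfolding A_def by (rule eq)
  qed
  moreover have "(\<lambda>k. emeasure \<mu> (A k)) \<longlonglongrightarrow> emeasure \<mu> {x<..}"
    using Lim_emeasure_incseq[of A \<mu>] A sets by simp
  moreover have "(\<lambda>k. emeasure \<nu> (A k)) \<longlonglongrightarrow> emeasure \<nu> {x<..}"
    using Lim_emeasure_incseq[of A \<nu>] A sets by simp
  ultimately show ?thesis
    using LIMSEQ_unique by fastforce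
qed

text \<open>Without mass on the nonpositive reals, the tail at a negative point equals the tail at
  0.\<close>

lemma measure_eqI_half_line:
  fixes \<mu> \<nu> :: "real measure"
  assumes "prob_space \<mu>" and sets: "sets \<mu> = sets borel" "sets \<nu> = sets borel"
    and null: "emeasure \<mu> {..0} = 0" "emeasure \<nu> {..0} = 0"
    and eq: "\<And>r. r > 0 \<Longrightarrow> emeasure \<mu> {r..} = emeasure \<nu> {r..}"
  shows "\<mu> = \<nu>"
proof (rule measure_eqI_lessThan)
  interpret prob_space \<mu> by fact
  fix x :: real
  show "emeasure \<mu> {x<..} < \<infinity>" by (simp add: emeasure_eq_measure)
  have tail: "emeasure \<theta> {x<..} = emeasure \<theta> {max 0 x<..}"
    if "sets \<theta> = sets borel" "emeasure \<theta> {..0} = 0" for \<theta> :: "real measure"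
  proof (rule emeasure_eq_AE)
    have "AE z in \<theta>. z \<notin> {..0}"
      using that by (intro AE_not_in) auto
    then show "AE z in \<theta>. z \<in> {x<..} \<longleftrightarrow> z \<in> {max 0 x<..}"
      by eventually_elim auto
  qed (use that in auto)
  have "emeasure \<mu> {max 0 x<..} = emeasure \<nu> {max 0 x<..}"
    by (rule emeasure_greaterThan_eqI[OF sets eq]) auto
  then show "emeasure \<mu> {x<..} = emeasure \<nu> {x<..}"
    using tail[OF sets(1) null(1)] tail[OF sets(2) null(2)] by simp
qed (use sets in auto)

section \<open>Even densities, absolute values and random signs\<close>

definition folded_density :: "(real \<Rightarrow> real) \<Rightarrow> real measure" where
  "folded_density q = density lborel (\<lambda>z. 2 * ennreal (q z) * indicator {0<..} z)"

lemma nn_integral_reflect_half_line: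
  fixes G :: "real \<Rightarrow> ennreal"
  assumes [measurable]: "G \<in> borel_measurable borel"
  shows "(\<integral>\<^sup>+z. G (- z) * indicator {0<..} z \<partial>lborel) + (\<integral>\<^sup>+z. G z * indicator {0<..} z \<partial>lborel) =
    (\<integral>\<^sup>+z. G z \<partial>lborel)"
proof -
  have "(\<integral>\<^sup>+z. G (- z) * indicator {0<..} z \<partial>lborel) = (\<integral>\<^sup>+z. G z * indicator {..<0} z \<partial>lborel)"
    by (subst nn_integral_real_affine[of _ "-1" 0]) (auto intro!: nn_integral_cong split: split_indicator)
  moreover have "(\<integral>\<^sup>+z. G z * indicator {..<0} z \<partial>lborel) + (\<integral>\<^sup>+z. G z * indicator {0<..} z \<partial>lborel) =
      (\<integral>\<^sup>+z. G z * indicator {..<0} z + G z * indicator {0<..} z \<partial>lborel)"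
    by (intro nn_integral_add[symmetric]) auto
  moreover have "\<dots> = (\<integral>\<^sup>+z. G z \<partial>lborel)"
    using AE_lborel_singleton[of "0::real"]
    by (intro nn_integral_cong_AE, eventually_elim) (auto split: split_indicator)
  ultimately show ?thesis by simp
qed

lemma emeasure_folded_density:
  assumes [measurable]: "q \<in> borel_measurable borel" "B \<in> sets borel"
  shows "emeasure (folded_density q) B = 2 * (\<integral>\<^sup>+z. ennreal (q z) * indicator B z * indicator {0<..} z \<partial>lborel)"
  unfolding folded_density_def
  by (simp add: emeasure_density nn_integral_cmult[symmetric] mult_ac)

lemma folded_density_null:
  assumes "q \<in> borel_measurable borel"
  shows "emeasure (folded_density q) {..0} = 0"
proof -
  have "(\<integral>\<^sup>+z. ennreal (q z) * indicator {..0} z * indicator {0<..} z \<partial>lborel) = (\<integral>\<^sup>+z. 0 \<partial>(lborel :: real measure))"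
    by (intro nn_integral_cong) (auto split: split_indicator)
  then show ?thesis
    using assms by (simp add: emeasure_folded_density)
qed

lemma emeasure_folded_density_UNIV:
  assumes [measurable]: "q \<in> borel_measurable borel" and even: "\<And>z. q (- z) = q z"
  shows "emeasure (folded_density q) UNIV = (\<integral>\<^sup>+z. ennreal (q z) \<partial>lborel)"
  using nn_integral_reflect_half_line[of "\<lambda>z. ennreal (q z)"]
  by (simp add: emeasure_folded_density even mult_2)

lemma sets_folded_density [simp, measurable_cong]: "sets (folded_density q) = sets borel"
  by (simp add: folded_density_def)

lemma (in prob_space) law_abs:
  assumes [measurable]: "X \<in> borel_measurable M" "q \<in> borel_measurable borel"
    and law: "distr M borel X = density lborel q" and even: "\<And>z. q (- z) = q z"
  shows "distr M borel (\<lambda>\<omega>. \<bar>X \<omega>\<bar>) = folded_density q"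
proof (rule measure_eqI)
  fix B assume "B \<in> sets (distr M borel (\<lambda>\<omega>. \<bar>X \<omega>\<bar>))"
  then have [measurable]: "B \<in> sets borel" by simp
  have "distr M borel (\<lambda>\<omega>. \<bar>X \<omega>\<bar>) = distr (distr M borel X) borel abs"
    by (subst distr_distr) (auto simp: comp_def)
  then have "emeasure (distr M borel (\<lambda>\<omega>. \<bar>X \<omega>\<bar>)) B = emeasure (density lborel q) (abs -` B)"
    by (simp add: law emeasure_distr)
  also have "\<dots> = (\<integral>\<^sup>+z. ennreal (q z) * indicator B \<bar>z\<bar> \<partial>lborel)"
    using measurable_sets[of "abs :: real \<Rightarrow> real" borel borel B]
    by (subst emeasure_density) (auto intro!: nn_integral_cong split: split_indicator)
  also have "\<dots> = (\<integral>\<^sup>+z. ennreal (q z) * indicator B \<bar>z\<bar> * indicator {0<..} z \<partial>lborel) +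
      (\<integral>\<^sup>+z. ennreal (q z) * indicator B \<bar>z\<bar> * indicator {0<..} z \<partial>lborel)"
    by (subst nn_integral_reflect_half_line[symmetric]) (auto simp: even)
  also have "(\<integral>\<^sup>+z. ennreal (q z) * indicator B \<bar>z\<bar> * indicator {0<..} z \<partial>lborel) =
      (\<integral>\<^sup>+z. ennreal (q z) * indicator B z * indicator {0<..} z \<partial>lborel)"
    by (intro nn_integral_cong) (auto split: split_indicator)
  finally show "emeasure (distr M borel (\<lambda>\<omega>. \<bar>X \<omega>\<bar>)) B = emeasure (folded_density q) B"
    by (simp add: emeasure_folded_density mult_2)
qed simp

lemma (in prob_space) AE_sign:
  assumes [measurable]: "S \<in> borel_measurable M"
    and S: "prob {\<omega> \<in> space M. S \<omega> = 1} = 1 / 2" "prob {\<omega> \<in> space M. S \<omega> = - 1} = 1 / 2"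
  shows "AE \<omega> in M. S \<omega> = 1 \<or> S \<omega> = - (1::real)"
proof -
  have "prob ({\<omega> \<in> space M. S \<omega> = 1} \<union> {\<omega> \<in> space M. S \<omega> = - 1}) = 1"
    using S by (subst finite_measure_Union) auto
  then have "AE \<omega> in M. \<omega> \<in> {\<omega> \<in> space M. S \<omega> = 1} \<union> {\<omega> \<in> space M. S \<omega> = - 1}"
    by (intro prob_eq_1[THEN iffD1]) auto
  then show ?thesis by eventually_elim auto
qed

text \<open>The converse of \<open>law_abs\<close>: an independent fair sign unfolds the law. The
  event splits into R in B with sign 1 and -R in B with sign -1, and the two probabilities 1/2
  cancel the factor 2 of \<open>folded_density\<close>.\<close>

lemma (in prob_space) law_times_sign:
  assumes R [measurable]: "R \<in> borel_measurable M" and S [measurable]: "S \<in> borel_measurable M"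
    and q [measurable]: "q \<in> borel_measurable borel"
    and law: "distr M borel R = folded_density q" and even: "\<And>z. q (- z) = q z"
    and S_law: "prob {\<omega> \<in> space M. S \<omega> = 1} = 1 / 2" "prob {\<omega> \<in> space M. S \<omega> = - 1} = 1 / 2"
    and ind: "indep_var borel R borel S"
  shows "distr M borel (\<lambda>\<omega>. R \<omega> * S \<omega>) = density lborel q"
proof (rule measure_eqI)
  fix B assume "B \<in> sets (distr M borel (\<lambda>\<omega>. R \<omega> * S \<omega>))"
  then have B [measurable]: "B \<in> sets borel" by simp
  have B' [measurable]: "uminus -` B \<in> sets (borel :: real measure)"
    using measurable_sets[of "uminus :: real \<Rightarrow> real" borel borel B] by simp
  have split: "emeasure M {\<omega> \<in> space M. R \<omega> \<in> C \<and> S \<omega> = u} =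
      emeasure (folded_density q) C * ennreal (1 / 2)"
    if C [measurable]: "C \<in> sets borel" and u: "prob {\<omega> \<in> space M. S \<omega> = u} = 1 / 2" for C u
  proof -
    have eq: "prob ((\<lambda>\<omega>. (R \<omega>, S \<omega>)) -` (C \<times> {u}) \<inter> space M) = prob (R -` C \<inter> space M) * prob (S -` {u} \<inter> space M)"
      by (rule indep_varD[OF ind]) auto
    have sets_eq: "(\<lambda>\<omega>. (R \<omega>, S \<omega>)) -` (C \<times> {u}) \<inter> space M = {\<omega> \<in> space M. R \<omega> \<in> C \<and> S \<omega> = u}"
      "S -` {u} \<inter> space M = {\<omega> \<in> space M. S \<omega> = u}" by auto
    have "emeasure M {\<omega> \<in> space M. R \<omega> \<in> C \<and> S \<omega> = u} = ennreal (prob (R -` C \<inter> space M)) * ennreal (1 / 2)"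
      using eq unfolding sets_eq u emeasure_eq_measure by (simp only: ennreal_mult'' zero_le_divide_1_iff zero_le_numeral)
    also have "ennreal (prob (R -` C \<inter> space M)) = emeasure (folded_density q) C"
      by (simp add: emeasure_eq_measure[symmetric] emeasure_distr flip: law)
    finally show ?thesis .
  qed
  have "emeasure (distr M borel (\<lambda>\<omega>. R \<omega> * S \<omega>)) B = emeasure M {\<omega> \<in> space M. R \<omega> * S \<omega> \<in> B}"
    by (auto simp: emeasure_distr intro!: arg_cong[where f="emeasure M"])
  also have "\<dots> = emeasure M ({\<omega> \<in> space M. R \<omega> \<in> B \<and> S \<omega> = 1} \<union> {\<omega> \<in> space M. R \<omega> \<in> uminus -` B \<and> S \<omega> = - 1})"
    using AE_sign[OF S S_law] by (intro emeasure_eq_AE) (auto elim!: eventually_mono)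
  also have "\<dots> = emeasure M {\<omega> \<in> space M. R \<omega> \<in> B \<and> S \<omega> = 1} + emeasure M {\<omega> \<in> space M. R \<omega> \<in> uminus -` B \<and> S \<omega> = - 1}"
    by (intro plus_emeasure[symmetric]) auto
  also have "\<dots> = (emeasure (folded_density q) (uminus -` B) + emeasure (folded_density q) B) * ennreal (1 / 2)"
    unfolding split[OF B S_law(1)] split[OF B' S_law(2)] distrib_right by (rule add.commute)
  also have "\<dots> = ((\<integral>\<^sup>+z. ennreal (q (- z)) * indicator B (- z) * indicator {0<..} z \<partial>lborel) +
     (\<integral>\<^sup>+z. ennreal (q z) * indicator B z * indicator {0<..} z \<partial>lborel)) * (2 * ennreal (1 / 2))"
  proof -
    have "(\<lambda>z. ennreal (q z) * indicator (uminus -` B) z * indicator {0<..} z) =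
        (\<lambda>z. ennreal (q (- z)) * indicator B (- z) * indicator {0<..} z)"
      by (auto simp: even fun_eq_iff split: split_indicator)
    moreover have "(2 * x + 2 * y) * h = (x + y) * (2 * h)" for x y h :: ennreal
      by (simp add: distrib_left distrib_right mult_ac)
    ultimately show ?thesis
      unfolding emeasure_folded_density[OF q B] emeasure_folded_density[OF q B'] by simp
  qed
  also have "2 * ennreal (1 / 2) = 1"
    by (subst ennreal_numeral[symmetric], subst ennreal_mult[symmetric]) auto
  also have "(\<integral>\<^sup>+z. ennreal (q (- z)) * indicator B (- z) * indicator {0<..} z \<partial>lborel) +
     (\<integral>\<^sup>+z. ennreal (q z) * indicator B z * indicator {0<..} z \<partial>lborel) = (\<integral>\<^sup>+z. ennreal (q z) * indicator B z \<partial>lborel)"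
    by (rule nn_integral_reflect_half_line) simp
  finally show "emeasure (distr M borel (\<lambda>\<omega>. R \<omega> * S \<omega>)) B = emeasure (density lborel q) B"
    by (simp add: emeasure_density)
qed simp

text \<open>A weight that is a product over coordinates tilts every coordinate separately; comparing
  both measures on boxes suffices.\<close>

lemma density_PiM:
  assumes I: "finite I" and M: "\<And>i. sigma_finite_measure (M i)"
    and f [measurable]: "\<And>i. f i \<in> borel_measurable (M i)"
    and dens: "\<And>i. sigma_finite_measure (density (M i) (f i))"
  shows "density (PiM I M) (\<lambda>x. \<Prod>i\<in>I. f i (x i)) = PiM I (\<lambda>i. density (M i) (f i))"
proof -
  interpret M: product_sigma_finite M using M by (simp add: product_sigma_finite_def)
  interpret D: product_sigma_finite "\<lambda>i. density (M i) (f i)" using dens by (simp add: product_sigma_finite_def)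
  show ?thesis
  proof (rule D.PiM_eqI[OF I])
    fix A assume "\<And>i. i \<in> I \<Longrightarrow> A i \<in> sets (density (M i) (f i))"
    then have A [measurable]: "\<And>i. i \<in> I \<Longrightarrow> A i \<in> sets (M i)" by simp
    have "emeasure (density (PiM I M) (\<lambda>x. \<Prod>i\<in>I. f i (x i))) (PiE I A) =
        (\<integral>\<^sup>+x. (\<Prod>i\<in>I. f i (x i)) * indicator (PiE I A) x \<partial>PiM I M)"
      using I A by (intro emeasure_density borel_measurable_prod_ennreal sets_PiM_I_finite) auto
    also have "\<dots> = (\<integral>\<^sup>+x. (\<Prod>i\<in>I. f i (x i) * indicator (A i) (x i)) \<partial>PiM I M)"
    proof (intro nn_integral_cong)
      fix x assume x: "x \<in> space (PiM I M)"
      have "indicator (PiE I A) x = (\<Prod>i\<in>I. indicator (A i) (x i) :: ennreal)"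
        using x I by (auto simp: space_PiM PiE_def Pi_iff split: split_indicator)
      then show "(\<Prod>i\<in>I. f i (x i)) * indicator (PiE I A) x = (\<Prod>i\<in>I. f i (x i) * indicator (A i) (x i))"
        by (simp add: prod.distrib)
    qed
    also have "\<dots> = (\<Prod>i\<in>I. \<integral>\<^sup>+z. f i z * indicator (A i) z \<partial>M i)"
      using A by (intro M.product_nn_integral_prod I) auto
    also have "\<dots> = (\<Prod>i\<in>I. emeasure (density (M i) (f i)) (A i))"
      using A by (intro prod.cong refl emeasure_density[symmetric]) auto
    finally show "emeasure (density (PiM I M) (\<lambda>x. \<Prod>i\<in>I. f i (x i))) (PiE I A) =
      (\<Prod>i\<in>I. emeasure (density (M i) (f i)) (A i))" .
  qed (auto intro!: sets_PiM_cong)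
qed

section \<open>From the Gamma law of half the square to the law of the absolute value\<close>

lemma gamma_density_measurable [measurable]: "gamma_density k \<theta> \<in> borel_measurable borel"
  unfolding gamma_density_def[abs_def] by measurable

text \<open>The substitution u = z^2 / 2 has du = z dz, which explains the extra \<open>z\<close>;
  the 2 on the right is that of \<open>folded_density\<close>. The divisor is the absolute moment of
  order 2 a of the standard normal law.\<close>

lemma gamma_density_half_square:
  assumes z: "z > 0"
  shows "gamma_density (a + 1 / 2) 1 (z\<^sup>2 / 2) * z =
    2 * (\<bar>z\<bar> powr (2 * a) / (2 powr a * Gamma (a + 1 / 2) / sqrt pi) * std_normal_density z)"
proof -
  have "(z\<^sup>2 / 2) powr (a - 1 / 2) * z = z powr (2 * a) * 2 powr (1 / 2) / 2 powr a"
  proof -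
    have "(z\<^sup>2 / 2) powr (a - 1 / 2) = (z powr 2) powr (a - 1 / 2) / 2 powr (a - 1 / 2)"
      using z by (simp add: powr_divide powr_numeral)
    also have "(z powr 2) powr (a - 1 / 2) = z powr (2 * a - 1)"
      by (simp add: powr_powr algebra_simps)
    finally show ?thesis
      using z by (simp add: powr_diff)
  qed
  moreover have "gamma_density (a + 1 / 2) 1 (z\<^sup>2 / 2) * z =
      ((z\<^sup>2 / 2) powr (a - 1 / 2) * z) * (exp (- z\<^sup>2 / 2) / Gamma (a + 1 / 2))"
    using z by (simp add: gamma_density_def)
  ultimately have "gamma_density (a + 1 / 2) 1 (z\<^sup>2 / 2) * z =
      z powr (2 * a) / 2 powr a * exp (- z\<^sup>2 / 2) / Gamma (a + 1 / 2) * sqrt 2"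
    by (simp add: powr_half_sqrt)
  also have "sqrt 2 = 2 * (sqrt pi / sqrt (2 * pi))"
    by (simp add: real_sqrt_mult real_div_sqrt)
  finally show ?thesis
    using z by (simp add: std_normal_density_def mult_ac)
qed

text \<open>The substitution rule is applied on compact intervals; half-lines are their increasing
  unions, and they determine a law on the positive reals.\<close>

lemma (in prob_space) law_abs_of_gamma:
  fixes a :: real
  defines "q \<equiv> \<lambda>z. \<bar>z\<bar> powr (2 * a) / (2 powr a * Gamma (a + 1 / 2) / sqrt pi) * std_normal_density z"
  assumes X [measurable]: "X \<in> borel_measurable M" and a: "a > 0"
    and dist: "distributed M lborel (\<lambda>\<omega>. (X \<omega>)\<^sup>2 / 2) (gamma_density (a + 1 / 2) 1)"
  shows "distr M borel (\<lambda>\<omega>. \<bar>X \<omega>\<bar>) = folded_density q"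
proof (rule measure_eqI_half_line)
  let ?g = "gamma_density (a + 1 / 2) 1"
  have q [measurable]: "q \<in> borel_measurable borel" unfolding q_def by measurable
  have law: "emeasure M {\<omega> \<in> space M. (X \<omega>)\<^sup>2 / 2 \<in> B} = emeasure (density lborel ?g) B" if "B \<in> sets borel" for B
    using distributed_emeasure[OF dist, of B] that
    by (simp add: emeasure_density vimage_def Int_def conj_commute)
  show "emeasure (distr M borel (\<lambda>\<omega>. \<bar>X \<omega>\<bar>)) {..0} = 0"
  proof -
    have "emeasure (distr M borel (\<lambda>\<omega>. \<bar>X \<omega>\<bar>)) {..0} = emeasure M {\<omega> \<in> space M. (X \<omega>)\<^sup>2 / 2 \<in> {..0}}"
      by (auto simp: emeasure_distr intro!: arg_cong[where f="emeasure M"])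
    also have "\<dots> = (\<integral>\<^sup>+z. ennreal (?g z) * indicator {..0} z \<partial>lborel)"
      by (subst law) (auto simp: emeasure_density)
    also have "\<dots> = (\<integral>\<^sup>+z. 0 \<partial>(lborel :: real measure))"
      by (intro nn_integral_cong) (auto simp: gamma_density_def split: split_indicator)
    finally show ?thesis by simp
  qed
  show "emeasure (folded_density q) {..0} = 0"
    by (rule folded_density_null) simp
  fix r :: real assume r: "r > 0"
  have step: "emeasure (density lborel ?g) {r\<^sup>2 / 2..(r + real k)\<^sup>2 / 2} = emeasure (folded_density q) {r..r + real k}" for k
  proof -
    have "emeasure (density lborel ?g) {r\<^sup>2 / 2..(r + real k)\<^sup>2 / 2} =
        (\<integral>\<^sup>+z. ennreal (?g z * indicator {r\<^sup>2 / 2..(r + real k)\<^sup>2 / 2} z) \<partial>lborel)"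
      by (subst emeasure_density) (auto intro!: nn_integral_cong split: split_indicator)
    also have "\<dots> = (\<integral>\<^sup>+z. ennreal (?g (z\<^sup>2 / 2) * z * indicator {r..r + real k} z) \<partial>lborel)"
    proof (rule nn_integral_substitution)
      show "set_borel_measurable borel {r\<^sup>2 / 2..(r + real k)\<^sup>2 / 2} ?g"
        unfolding set_borel_measurable_def by measurable
      show "((\<lambda>z. z\<^sup>2 / 2) has_real_derivative z) (at z)" for z :: real
        by (auto intro!: derivative_eq_intros)
    qed (use r in \<open>auto intro!: continuous_intros\<close>)
    also have "\<dots> = (\<integral>\<^sup>+z. 2 * (ennreal (q z) * indicator {r..r + real k} z * indicator {0<..} z) \<partial>lborel)"
    proof (intro nn_integral_cong)
      fix z :: real
      show "ennreal (?g (z\<^sup>2 / 2) * z * indicator {r..r + real k} z) =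
          2 * (ennreal (q z) * indicator {r..r + real k} z * indicator {0<..} z)"
      proof (cases "z \<in> {r..r + real k}")
        case True
        then have "z > 0" using r by auto
        then have "?g (z\<^sup>2 / 2) * z = 2 * q z" unfolding q_def by (rule gamma_density_half_square)
        moreover have "ennreal (2 * q z) = 2 * ennreal (q z)"
          using a by (subst ennreal_mult) (auto simp: q_def Gamma_real_pos less_imp_le)
        ultimately show ?thesis using True \<open>z > 0\<close> by simp
      qed simp
    qed
    also have "\<dots> = emeasure (folded_density q) {r..r + real k}"
      by (simp add: emeasure_folded_density nn_integral_cmult)
    finally show ?thesis .
  qed
  have "(\<Union>k. {r\<^sup>2 / 2..(r + real k)\<^sup>2 / 2}) = {r\<^sup>2 / 2..}" (is "?U = _")
  proof (intro equalityI subsetI)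
    fix z assume z: "z \<in> {r\<^sup>2 / 2..}"
    obtain k :: nat where k: "z \<le> real k" using real_arch_simple by blast
    \<comment> \<open>The index 2 k + 1 is a crude choice: its square exceeds 2 k, so the right end
      passes \<open>z\<close>.\<close>
    have "real k * 2 \<le> (r + real (2 * k + 1))\<^sup>2"
    proof -
      have "real k * 2 \<le> (real (2 * k + 1))\<^sup>2" by (simp add: power2_eq_square algebra_simps)
      also have "\<dots> \<le> (r + real (2 * k + 1))\<^sup>2" using r by (intro power_mono) auto
      finally show ?thesis .
    qed
    then have "z \<le> (r + real (2 * k + 1))\<^sup>2 / 2" using k by simp
    then show "z \<in> ?U" using z by (intro UN_I[of "2 * k + 1"]) auto
  qed auto
  moreover have "incseq (\<lambda>k. {r\<^sup>2 / 2..(r + real k)\<^sup>2 / 2})"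
    using r by (auto simp: incseq_def intro!: order_trans[OF _ divide_right_mono[OF power_mono]])
  ultimately have "(\<lambda>k. emeasure (density lborel ?g) {r\<^sup>2 / 2..(r + real k)\<^sup>2 / 2}) \<longlonglongrightarrow> emeasure (density lborel ?g) {r\<^sup>2 / 2..}"
    using Lim_emeasure_incseq[of "\<lambda>k. {r\<^sup>2 / 2..(r + real k)\<^sup>2 / 2}" "density lborel ?g"]
    by (simp add: image_subset_iff)
  moreover have "(\<lambda>k. emeasure (folded_density q) {r..r + real k}) \<longlonglongrightarrow> emeasure (folded_density q) {r..}"
  proof -
    have "(\<Union>k. {r..r + real k}) = {r..}"
    proof (intro equalityI subsetI)
      fix z assume z: "z \<in> {r..}"
      obtain k :: nat where "z - r \<le> real k" using real_arch_simple by blast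
      with z show "z \<in> (\<Union>k. {r..r + real k})" by (intro UN_I[of k]) auto
    qed auto
    then show ?thesis
      using Lim_emeasure_incseq[of "\<lambda>k. {r..r + real k}" "folded_density q"]
      by (simp add: incseq_def image_subset_iff)
  qed
  ultimately have lim: "emeasure (density lborel ?g) {r\<^sup>2 / 2..} = emeasure (folded_density q) {r..}"
    unfolding step by (rule LIMSEQ_unique)
  have "emeasure (distr M borel (\<lambda>\<omega>. \<bar>X \<omega>\<bar>)) {r..} = emeasure M {\<omega> \<in> space M. (X \<omega>)\<^sup>2 / 2 \<in> {r\<^sup>2 / 2..}}"
    using r abs_le_square_iff[of r] by (auto simp: emeasure_distr intro!: arg_cong[where f="emeasure M"])
  also have "\<dots> = emeasure (folded_density q) {r..}"
    unfolding lim[symmetric] by (rule law) simp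
  finally show "emeasure (distr M borel (\<lambda>\<omega>. \<bar>X \<omega>\<bar>)) {r..} = emeasure (folded_density q) {r..}" .
qed (auto intro: prob_space_distr)

section \<open>The tail process\<close>

locale garch11_tail_limit = garch11 M \<alpha>\<^sub>0 \<alpha>\<^sub>1 \<beta>\<^sub>1 \<epsilon> \<zeta> \<sigma> + tail: garch11_tail_vars N \<alpha>\<^sub>1 \<beta>\<^sub>1 \<alpha> m n A S E Y
  for M :: "'a measure" and N :: "'b measure"
    and \<alpha>\<^sub>0 \<alpha>\<^sub>1 \<beta>\<^sub>1 \<alpha> :: real
    and \<epsilon> \<zeta> \<sigma> :: "int \<Rightarrow> 'a \<Rightarrow> real"
    and A S E :: "int \<Rightarrow> 'b \<Rightarrow> real" and Y :: "'b \<Rightarrow> real"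
    and m n :: nat +
  assumes alpha_pos: "\<alpha> > 0"
    and alpha_eq: "expectation (\<lambda>\<omega>. (\<alpha>\<^sub>1 * (\<epsilon> 0 \<omega>)\<^sup>2 + \<beta>\<^sub>1) powr \<alpha>) = 1"
begin

abbreviation start :: int where "start \<equiv> - int m"

abbreviation innov_times :: "int set" where "innov_times \<equiv> {start<..int n + 1}"

definition tail_component :: "tail_index \<Rightarrow> 'b \<Rightarrow> real" where
  "tail_component i = (case i of IxA t \<Rightarrow> A t | IxS t \<Rightarrow> S t | IxE t \<Rightarrow> E t | IxY \<Rightarrow> Y)"

definition tail_indices :: "tail_index set" where
  "tail_indices = IxA ` {- int m..-1} \<union> IxS ` {- int m..int n} \<union> IxE ` {1..int n + 1} \<union> {IxY}"

text \<open>
  \<open>tilted_innov i\<close> plays the role of \<open>\<epsilon>\<^sub>i\<close> in the limit; note the shift by one relative to the times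
  of \<open>A\<close> and \<open>S\<close>, which comes from \<open>\<zeta>\<^sub>t = \<sigma>\<^sub>t \<epsilon>\<^sub>t\<^sub>+\<^sub>1\<close>.
\<close>

definition innov_abs :: "int \<Rightarrow> 'b \<Rightarrow> real" where
  "innov_abs i \<omega> = (if i \<le> 0 then sqrt ((A (i - 1) \<omega> powi (- 2) - \<beta>\<^sub>1) / \<alpha>\<^sub>1) else \<bar>E i \<omega>\<bar>)"

definition tilted_innov :: "int \<Rightarrow> 'b \<Rightarrow> real" where
  "tilted_innov i \<omega> = innov_abs i \<omega> * S (i - 1) \<omega>"

text \<open>The absolute moment of order \<open>2 \<alpha>\<close> of the standard normal law.\<close>

definition tilt_norm :: real where
  "tilt_norm = 2 powr \<alpha> * Gamma (\<alpha> + 1 / 2) / sqrt pi"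

text \<open>The density of the tilted law relative to the normal one. Innovations up to time 0 enter
  the exceedance through \<sigma>_0, the one at time 1 as the factor of \<sigma>_0 in \<zeta>_0, and
  later ones do not affect it.\<close>

definition tilt :: "int \<Rightarrow> real \<Rightarrow> real" where
  "tilt i z = (if i \<le> 0 then arch_factor z powr \<alpha> else if i = 1 then \<bar>z\<bar> powr (2 * \<alpha>) / tilt_norm else 1)"

definition tilted_density :: "int \<Rightarrow> real \<Rightarrow> real" where
  "tilted_density i z = tilt i z * std_normal_density z"

section \<open>The one-dimensional tilted laws\<close>

lemma powi_minus_two: "x powi (- 2) = inverse (x\<^sup>2)" for x :: real
  by (simp add: power_int_minus)

lemma tail_component_indep: "tail.indep_vars (\<lambda>_. borel) tail_component tail_indices"
  using tail.indep unfolding tail_component_def[abs_def] tail_indices_def .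

lemma tail_component_measurable: "i \<in> tail_indices \<Longrightarrow> tail_component i \<in> borel_measurable N"
  using tail_component_indep by (simp add: tail.indep_vars_def)

lemma A_measurable: "t \<in> {- int m..-1} \<Longrightarrow> A t \<in> borel_measurable N"
  using tail_component_measurable[of "IxA t"] by (auto simp: tail_indices_def tail_component_def)

lemma S_measurable: "t \<in> {- int m..int n} \<Longrightarrow> S t \<in> borel_measurable N"
  using tail_component_measurable[of "IxS t"] by (auto simp: tail_indices_def tail_component_def)

lemma E_measurable: "t \<in> {1..int n + 1} \<Longrightarrow> E t \<in> borel_measurable N"
  using tail_component_measurable[of "IxE t"] by (auto simp: tail_indices_def tail_component_def)

lemma Y_measurable: "Y \<in> borel_measurable N"
  using tail_component_measurable[of IxY] by (auto simp: tail_indices_def tail_component_def)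

lemma tilt_norm_pos: "tilt_norm > 0"
  using alpha_pos by (simp add: tilt_norm_def Gamma_real_pos)

lemma tilt_nonneg: "tilt i z \<ge> 0"
  using tilt_norm_pos by (simp add: tilt_def)

lemma tilt_measurable [measurable]: "tilt i \<in> borel_measurable borel"
  unfolding tilt_def[abs_def] by measurable

lemma tilted_density_measurable [measurable]: "tilted_density i \<in> borel_measurable borel"
  unfolding tilted_density_def[abs_def] by measurable

lemma tilted_density_even: "tilted_density i (- z) = tilted_density i z"
  by (simp add: tilted_density_def tilt_def arch_factor_def std_normal_density_def)

lemma tilted_density_nonneg: "tilted_density i z \<ge> 0"
  by (simp add: tilted_density_def tilt_nonneg normal_density_nonneg)

lemma density_tilted: "density std_normal (tilt i) = density lborel (tilted_density i)"
  by (subst density_density_eq)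
    (auto simp: tilted_density_def ennreal_mult' tilt_nonneg normal_density_nonneg mult.commute
      intro!: density_cong)

text \<open>The defining equation of \<alpha> is exactly the normalisation of these
  densities.\<close>

lemma volatility_tilt:
  assumes "i \<le> 0"
  shows "integrable lborel (tilted_density i)" "(\<integral>z. tilted_density i z \<partial>lborel) = 1"
proof -
  have td: "tilted_density i z = std_normal_density z * arch_factor z powr \<alpha>" for z
    using assms by (simp add: tilted_density_def tilt_def)
  have "1 = (\<integral>z. arch_factor z powr \<alpha> \<partial>distr M borel (\<epsilon> 0))"
    using alpha_eq by (subst integral_distr) (auto simp: arch_factor_def)
  also have "\<dots> = (\<integral>z. tilted_density i z \<partial>lborel)"
    unfolding innov_law by (subst integral_density) (auto simp: td[abs_def] normal_density_nonneg)
  finally show "(\<integral>z. tilted_density i z \<partial>lborel) = 1" ..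
  \<comment> \<open>A non-integrable function has integral 0 by convention, so the value 1 already
    implies integrability.\<close>
  then show "integrable lborel (tilted_density i)"
    using not_integrable_integral_eq by fastforce
qed

lemma prob_space_folded_volatility_tilt:
  assumes "i \<le> 0"
  shows "prob_space (folded_density (tilted_density i))"
proof
  have "space (folded_density (tilted_density i)) = UNIV" by (simp add: folded_density_def)
  then show "emeasure (folded_density (tilted_density i)) (space (folded_density (tilted_density i))) = 1"
    using volatility_tilt[OF assms]
    by (simp add: emeasure_folded_density_UNIV tilted_density_even nn_integral_eq_integral tilted_density_nonneg)
qed

text \<open>The point x = 1 / sqrt (\<alpha>_1 r^2 + \<beta>_1) makes \<open>r\<close> the lower
  limit of integration in the given distribution function, and r > 0 keeps it below
  \<beta>_1^(-1/2). The map is decreasing, so a distribution function turns into a tail; sqrt (2 /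
  pi) is twice the normal constant.\<close>

lemma A_tail:
  assumes i: "start < i" "i \<le> 0" and r: "r > 0"
  shows "emeasure N {\<omega> \<in> space N. A (i - 1) \<omega> \<le> 1 / sqrt (\<alpha>\<^sub>1 * r\<^sup>2 + \<beta>\<^sub>1)} =
    emeasure (folded_density (tilted_density i)) {r..}"
proof -
  define x where "x = 1 / sqrt (\<alpha>\<^sub>1 * r\<^sup>2 + \<beta>\<^sub>1)"
  have d: "\<alpha>\<^sub>1 * r\<^sup>2 + \<beta>\<^sub>1 > 0" using \<alpha>\<^sub>1_pos \<beta>\<^sub>1_nonneg r by (simp add: add_pos_nonneg)
  then have x: "x > 0" by (simp add: x_def)
  have "x powr (- 2) = \<alpha>\<^sub>1 * r\<^sup>2 + \<beta>\<^sub>1"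
    using x d by (simp add: powr_minus powr_numeral x_def power_divide)
  then have rx: "sqrt ((x powr (- 2) - \<beta>\<^sub>1) / \<alpha>\<^sub>1) = r"
    using \<alpha>\<^sub>1_pos r by simp
  have xb: "ereal x < (if \<beta>\<^sub>1 = 0 then \<infinity> else ereal (\<beta>\<^sub>1 powr (- 1 / 2)))"
  proof (cases "\<beta>\<^sub>1 = 0")
    case False
    then have "\<beta>\<^sub>1 > 0" using \<beta>\<^sub>1_nonneg by simp
    then have "x < 1 / sqrt \<beta>\<^sub>1"
      unfolding x_def using \<alpha>\<^sub>1_pos r d by (intro divide_strict_left_mono mult_pos_pos real_sqrt_gt_zero) auto
    then show ?thesis using False \<open>\<beta>\<^sub>1 > 0\<close> by (simp add: powr_minus_divide powr_half_sqrt)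
  qed simp
  have "i - 1 \<in> {- int m..-1}" using i by auto
  from tail.A_cdf[OF this x xb]
  have "tail.prob {\<omega> \<in> space N. A (i - 1) \<omega> \<le> x} =
     sqrt (2 / pi) * (LINT z:{r..}|lborel. (\<alpha>\<^sub>1 * z\<^sup>2 + \<beta>\<^sub>1) powr \<alpha> * exp (- (1 / 2) * z\<^sup>2))"
    unfolding rx .
  also have "\<dots> = (\<integral>z. 2 * (tilted_density i z * indicator {r..} z) \<partial>lborel)"
  proof -
    have "sqrt (2 / pi) * exp (- (1 / 2) * z\<^sup>2) = 2 * std_normal_density z" for z :: real
      by (simp add: std_normal_density_def real_sqrt_divide real_sqrt_mult field_simps)
    then have "sqrt (2 / pi) * (indicator {r..} z *\<^sub>R ((\<alpha>\<^sub>1 * z\<^sup>2 + \<beta>\<^sub>1) powr \<alpha> * exp (- (1 / 2) * z\<^sup>2))) =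
        2 * (tilted_density i z * indicator {r..} z)" for z
      using i by (simp add: tilted_density_def tilt_def arch_factor_def split: split_indicator)
    then show ?thesis
      unfolding set_lebesgue_integral_def integral_mult_right_zero[symmetric] by (simp only:)
  qed
  finally have "emeasure N {\<omega> \<in> space N. A (i - 1) \<omega> \<le> x} = ennreal (\<integral>z. 2 * (tilted_density i z * indicator {r..} z) \<partial>lborel)"
    by (simp add: tail.emeasure_eq_measure)
  also have "\<dots> = (\<integral>\<^sup>+z. ennreal (2 * (tilted_density i z * indicator {r..} z)) \<partial>lborel)"
    using volatility_tilt(1)[OF i(2)] tilted_density_nonneg
    by (intro nn_integral_eq_integral[symmetric] Bochner_Integration.integrable_mult_right
        integrable_real_mult_indicator) auto
  also have "\<dots> = 2 * (\<integral>\<^sup>+z. ennreal (tilted_density i z) * indicator {r..} z * indicator {0<..} z \<partial>lborel)"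
    using r tilted_density_nonneg
    by (subst nn_integral_cmult[symmetric])
      (auto intro!: nn_integral_cong simp: ennreal_mult' split: split_indicator)
  also have "\<dots> = emeasure (folded_density (tilted_density i)) {r..}"
    by (rule emeasure_folded_density[symmetric]) auto
  finally show ?thesis unfolding x_def .
qed

text \<open>The distribution function is prescribed only at positive points. Letting them decrease
  to 0 sends the corresponding \<open>r\<close> to infinity, where the tail of the probability law
  \<open>folded_density (tilted_density i)\<close> vanishes.\<close>

lemma AE_A_pos:
  assumes i: "start < i" "i \<le> 0"
  shows "AE \<omega> in N. A (i - 1) \<omega> > 0"
proof -
  interpret F: prob_space "folded_density (tilted_density i)"
    by (rule prob_space_folded_volatility_tilt[OF i(2)])
  have [measurable]: "A (i - 1) \<in> borel_measurable N" using i by (intro A_measurable) auto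
  have "(\<lambda>k. emeasure (folded_density (tilted_density i)) {real (Suc k)..}) \<longlonglongrightarrow>
      emeasure (folded_density (tilted_density i)) (\<Inter>k. {real (Suc k)..})"
    by (rule Lim_emeasure_decseq) (auto simp: decseq_def)
  also have "(\<Inter>k. {real (Suc k)..}) = {}"
  proof (rule equals0I)
    fix z :: real assume z: "z \<in> (\<Inter>k. {real (Suc k)..})"
    obtain k :: nat where "z < real k" using reals_Archimedean2 by blast
    moreover have "real (Suc k) \<le> z" using z by blast
    ultimately show False by simp
  qed
  finally have lim: "(\<lambda>k. emeasure (folded_density (tilted_density i)) {real (Suc k)..}) \<longlonglongrightarrow> 0" by simp
  have "emeasure N {\<omega> \<in> space N. A (i - 1) \<omega> \<le> 0} \<le> emeasure (folded_density (tilted_density i)) {real (Suc k)..}" for k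
  proof -
    have "sqrt (\<alpha>\<^sub>1 * (real (Suc k))\<^sup>2 + \<beta>\<^sub>1) \<ge> 0" using \<alpha>\<^sub>1_pos \<beta>\<^sub>1_nonneg by simp
    then have "1 / sqrt (\<alpha>\<^sub>1 * (real (Suc k))\<^sup>2 + \<beta>\<^sub>1) \<ge> 0" by (rule divide_nonneg_nonneg[OF zero_le_one])
    then have "emeasure N {\<omega> \<in> space N. A (i - 1) \<omega> \<le> 0} \<le>
        emeasure N {\<omega> \<in> space N. A (i - 1) \<omega> \<le> 1 / sqrt (\<alpha>\<^sub>1 * (real (Suc k))\<^sup>2 + \<beta>\<^sub>1)}"
      by (intro emeasure_mono Collect_mono conj_mono) (auto elim: order_trans)
    also have "\<dots> = emeasure (folded_density (tilted_density i)) {real (Suc k)..}"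
      by (rule A_tail[OF i]) simp
    finally show ?thesis .
  qed
  then have "emeasure N {\<omega> \<in> space N. A (i - 1) \<omega> \<le> 0} \<le> 0"
    by (intro LIMSEQ_le_const[OF lim]) auto
  then show ?thesis
    by (intro AE_I[where N="{\<omega> \<in> space N. A (i - 1) \<omega> \<le> 0}"]) auto
qed

lemma innov_abs_measurable:
  assumes i: "i \<in> innov_times"
  shows "innov_abs i \<in> borel_measurable N"
proof (cases "i \<le> 0")
  case True
  then have [measurable]: "A (i - 1) \<in> borel_measurable N" using i by (intro A_measurable) auto
  show ?thesis unfolding innov_abs_def[abs_def] powi_minus_two using True by simp
next
  case False
  then have [measurable]: "E i \<in> borel_measurable N" using i by (intro E_measurable) auto
  show ?thesis unfolding innov_abs_def[abs_def] using False by simp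
qed

lemma innov_abs_law_nonpos:
  assumes i: "start < i" "i \<le> 0"
  shows "distr N borel (innov_abs i) = folded_density (tilted_density i)"
proof -
  interpret F: prob_space "folded_density (tilted_density i)"
    by (rule prob_space_folded_volatility_tilt[OF i(2)])
  have [measurable]: "innov_abs i \<in> borel_measurable N" using i by (intro innov_abs_measurable) auto
  have [measurable]: "A (i - 1) \<in> borel_measurable N" using i by (intro A_measurable) auto
  interpret D: prob_space "distr N borel (innov_abs i)" by (rule tail.prob_space_distr) simp
  let ?F = "folded_density (tilted_density i)"
  have null: "emeasure ?F {..0} = 0" by (rule folded_density_null) simp
  have eq: "emeasure (distr N borel (innov_abs i)) {r..} = emeasure ?F {r..}" if r: "r > 0" for r
  proof -
    have "emeasure (distr N borel (innov_abs i)) {r..} = emeasure N {\<omega> \<in> space N. r \<le> innov_abs i \<omega>}"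
      by (auto simp: emeasure_distr intro!: arg_cong[where f="emeasure N"])
    also have "\<dots> = emeasure N {\<omega> \<in> space N. A (i - 1) \<omega> \<le> 1 / sqrt (\<alpha>\<^sub>1 * r\<^sup>2 + \<beta>\<^sub>1)}"
    proof (rule emeasure_eq_AE)
      show "AE \<omega> in N. \<omega> \<in> {\<omega> \<in> space N. r \<le> innov_abs i \<omega>} \<longleftrightarrow>
          \<omega> \<in> {\<omega> \<in> space N. A (i - 1) \<omega> \<le> 1 / sqrt (\<alpha>\<^sub>1 * r\<^sup>2 + \<beta>\<^sub>1)}"
        using AE_A_pos[OF i]
      proof eventually_elim
        case (elim \<omega>)
        let ?a = "A (i - 1) \<omega>" and ?d = "\<alpha>\<^sub>1 * r\<^sup>2 + \<beta>\<^sub>1"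
        have d: "?d > 0" using \<alpha>\<^sub>1_pos \<beta>\<^sub>1_nonneg r by (simp add: add_pos_nonneg)
        have "r \<le> innov_abs i \<omega> \<longleftrightarrow> sqrt (r\<^sup>2) \<le> sqrt ((inverse (?a\<^sup>2) - \<beta>\<^sub>1) / \<alpha>\<^sub>1)"
          using i r by (simp add: innov_abs_def powi_minus_two)
        \<comment> \<open>Monotonicity of \<open>sqrt\<close> on all reals also covers values of
          \<open>A\<close> that would make the radicand negative.\<close>
        also have "\<dots> \<longleftrightarrow> ?d \<le> inverse (?a\<^sup>2)"
          unfolding real_sqrt_le_iff using \<alpha>\<^sub>1_pos by (simp add: pos_le_divide_eq algebra_simps)
        also have "\<dots> \<longleftrightarrow> ?a\<^sup>2 \<le> 1 / ?d"
          using elim d by (simp add: field_simps)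
        also have "\<dots> \<longleftrightarrow> sqrt (?a\<^sup>2) \<le> sqrt (1 / ?d)"
          by (rule real_sqrt_le_iff[symmetric])
        also have "\<dots> \<longleftrightarrow> ?a \<le> 1 / sqrt ?d"
          using elim by (simp add: real_sqrt_divide)
        finally show ?case by simp
      qed
    qed auto
    also have "\<dots> = emeasure ?F {r..}" by (rule A_tail[OF i r])
    finally show ?thesis .
  qed
  have compl: "UNIV - {..0} = {0::real<..}" by auto
  have space_F: "space ?F = UNIV" by (simp add: folded_density_def)
  \<comment> \<open>Nonpositive values are excluded by total mass: the positive half-line already
    carries mass 1.\<close>
  have "emeasure (distr N borel (innov_abs i)) {0<..} = emeasure ?F {0<..}"
    using eq by (intro emeasure_greaterThan_eqI) auto
  then have "D.prob {0<..} = F.prob {0<..}"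
    by (simp add: measure_def)
  moreover have "F.prob {0<..} = 1"
    using F.prob_compl[of "{..0}"] null by (simp add: compl space_F measure_def)
  ultimately have "D.prob {..0} = 0"
    using D.prob_compl[of "{..0}"] by (simp add: compl)
  then have "emeasure (distr N borel (innov_abs i)) {..0} = 0"
    by (simp add: D.emeasure_eq_measure)
  then show ?thesis
    using eq null by (intro measure_eqI_half_line) (auto intro: D.prob_space_axioms)
qed

lemma innov_abs_law:
  assumes i: "i \<in> innov_times"
  shows "distr N borel (innov_abs i) = folded_density (tilted_density i)"
proof -
  consider "i \<le> 0" | "i = 1" | "i \<ge> 2" by linarith
  then show ?thesis
  proof cases
    case 1
    then show ?thesis using i by (intro innov_abs_law_nonpos) auto
  next
    case 2
    have E: "E 1 \<in> borel_measurable N" by (rule E_measurable) simp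
    have "innov_abs i = (\<lambda>\<omega>. \<bar>E 1 \<omega>\<bar>)" "tilted_density i =
        (\<lambda>z. \<bar>z\<bar> powr (2 * \<alpha>) / (2 powr \<alpha> * Gamma (\<alpha> + 1 / 2) / sqrt pi) * std_normal_density z)"
      using 2 by (auto simp: fun_eq_iff innov_abs_def tilted_density_def tilt_def tilt_norm_def)
    then show ?thesis
      using tail.law_abs_of_gamma[OF E alpha_pos tail.E1_gamma] by simp
  next
    case 3
    then have "distributed N lborel (E i) std_normal_density" using i by (intro tail.E_normal) auto
    then have "distr N borel (E i) = density lborel std_normal_density" "E i \<in> borel_measurable N"
      using distributed_distr_eq_density[of N lborel "E i"] distributed_measurable[of N lborel "E i"]
      by (auto cong: distr_cong)
    then have "distr N borel (\<lambda>\<omega>. \<bar>E i \<omega>\<bar>) = folded_density std_normal_density"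
      by (intro tail.law_abs) (auto simp: std_normal_density_def)
    moreover have "innov_abs i = (\<lambda>\<omega>. \<bar>E i \<omega>\<bar>)" "tilted_density i = std_normal_density"
      using 3 by (auto simp: fun_eq_iff innov_abs_def tilted_density_def tilt_def)
    ultimately show ?thesis by simp
  qed
qed

section \<open>The joint law of the tilted innovations and \<open>Y\<close>\<close>

lemma tail_component_pair_indep:
  assumes ab: "a \<in> tail_indices" "b \<in> tail_indices" "a \<noteq> b" and g [measurable]: "g \<in> borel_measurable borel"
  shows "tail.indep_var borel (\<lambda>\<omega>. g (tail_component a \<omega>)) borel (tail_component b)"
proof -
  have "tail.indep_var borel ((\<lambda>x. g (x a)) \<circ> (\<lambda>\<omega>. \<lambda>i\<in>{a}. tail_component i \<omega>))
      borel ((\<lambda>x. x b) \<circ> (\<lambda>\<omega>. \<lambda>i\<in>{b}. tail_component i \<omega>))"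
    using ab by (intro tail.indep_var_compose[OF tail.indep_var_restrict[OF tail_component_indep]]
        measurable_component_singleton measurable_compose[OF _ g]) auto
  then show ?thesis by (simp add: comp_def)
qed

lemma innov_abs_sign_indep:
  assumes i: "i \<in> innov_times"
  shows "tail.indep_var borel (innov_abs i) borel (S (i - 1))"
proof (cases "i \<le> 0")
  case True
  have "tail.indep_var borel (\<lambda>\<omega>. sqrt ((tail_component (IxA (i - 1)) \<omega> powi (- 2) - \<beta>\<^sub>1) / \<alpha>\<^sub>1))
      borel (tail_component (IxS (i - 1)))"
    using i True by (intro tail_component_pair_indep) (auto simp: tail_indices_def powi_minus_two)
  then show ?thesis
    using True by (simp add: tail_component_def innov_abs_def[abs_def])
next
  case False
  have "tail.indep_var borel (\<lambda>\<omega>. \<bar>tail_component (IxE i) \<omega>\<bar>) borel (tail_component (IxS (i - 1)))"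
    using i False by (intro tail_component_pair_indep) (auto simp: tail_indices_def)
  then show ?thesis
    using False by (simp add: tail_component_def innov_abs_def[abs_def])
qed

lemma tilted_innov_law:
  assumes i: "i \<in> innov_times"
  shows "distr N borel (tilted_innov i) = density lborel (tilted_density i)"
  unfolding tilted_innov_def[abs_def] using i
  by (intro tail.law_times_sign innov_abs_measurable S_measurable innov_abs_law innov_abs_sign_indep
      tail.S_pos tail.S_neg) (auto simp: tilted_density_even)

lemma tilted_innov_measurable:
  assumes i: "i \<in> innov_times"
  shows "tilted_innov i \<in> borel_measurable N"
  unfolding tilted_innov_def[abs_def] using i
  by (intro borel_measurable_times innov_abs_measurable S_measurable) auto

text \<open>Up to time 0 the mass 1 is the equation for \<alpha>. At time 1 no normal moment is
  computed: the density is that of \<open>tilted_innov 1\<close>, whose Gamma law is given, and this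
  also confirms \<open>tilt_norm\<close> as the normalising constant.\<close>

lemma prob_space_tilted: "prob_space (density lborel (tilted_density i))"
proof -
  consider "i \<le> 0" | "i = 1" | "i \<ge> 2" by linarith
  then show ?thesis
  proof cases
    case 1
    then show ?thesis
      using volatility_tilt[OF 1] tilted_density_nonneg
      by (intro prob_spaceI) (simp add: emeasure_density nn_integral_eq_integral)
  next
    case 2
    then have i: "i \<in> innov_times" by simp
    show ?thesis
      unfolding tilted_innov_law[OF i, symmetric]
      by (intro tail.prob_space_distr tilted_innov_measurable i)
  next
    case 3
    then have "tilted_density i = std_normal_density"
      by (simp add: fun_eq_iff tilted_density_def tilt_def)
    then show ?thesis using prob_space_std_normal by simp
  qed
qed

text \<open>The independent family is cut into disjoint blocks, each holding one sign and one of the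
  \<open>A\<close> or \<open>E\<close> variables; functions of disjoint blocks are
  independent.\<close>

lemma tilted_innov_joint_law:
  "distr N (PiM innov_times (\<lambda>_. borel) \<Otimes>\<^sub>M borel) (\<lambda>\<omega>. (\<lambda>i\<in>innov_times. tilted_innov i \<omega>, Y \<omega>)) =
    PiM innov_times (\<lambda>i. density lborel (tilted_density i)) \<Otimes>\<^sub>M distr N borel Y"
proof -
  \<comment> \<open>The innovations start after time \<open>start\<close>, so this index is free to carry \<open>Y\<close>.\<close>
  define K where "K i = (if i = start then {IxY} else if i \<le> 0 then {IxA (i - 1), IxS (i - 1)}
      else {IxE i, IxS (i - 1)})" for i
  define G where "G i x = (if i = start then x IxY else
      (if i \<le> 0 then sqrt ((inverse ((x (IxA (i - 1)))\<^sup>2) - \<beta>\<^sub>1) / \<alpha>\<^sub>1) else \<bar>x (IxE i)\<bar>) * x (IxS (i - 1)))"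
    for i and x :: "tail_index \<Rightarrow> real"
  define X where "X i = (if i = start then Y else tilted_innov i)" for i
  let ?I = "{start..int n + 1}"
  have "tail.indep_vars (\<lambda>i. PiM (K i) (\<lambda>_. borel)) (\<lambda>i \<omega>. \<lambda>j\<in>K i. tail_component j \<omega>) ?I"
    by (rule tail.indep_vars_restrict[OF tail_component_indep])
      (auto simp: K_def tail_indices_def disjoint_family_on_def)
  then have "tail.indep_vars (\<lambda>_. borel) (\<lambda>i. G i \<circ> (\<lambda>\<omega>. \<lambda>j\<in>K i. tail_component j \<omega>)) ?I"
  proof (rule tail.indep_vars_compose)
    fix i assume "i \<in> ?I"
    have comp: "(\<lambda>x. x j) \<in> borel_measurable (PiM (K i) (\<lambda>_. borel :: real measure))" if "j \<in> K i" for j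
      using that by (rule measurable_component_singleton)
    consider "i = start" | "i \<noteq> start" "i \<le> 0" | "i \<noteq> start" "i > 0" by linarith
    then show "G i \<in> borel_measurable (PiM (K i) (\<lambda>_. borel))"
    proof cases
      case 1
      then show ?thesis using comp[of IxY] by (simp add: G_def[abs_def] K_def)
    next
      case 2
      have [measurable]: "(\<lambda>x. x (IxA (i - 1))) \<in> borel_measurable (PiM (K i) (\<lambda>_. borel :: real measure))"
        "(\<lambda>x. x (IxS (i - 1))) \<in> borel_measurable (PiM (K i) (\<lambda>_. borel :: real measure))"
        using 2 by (auto intro!: comp simp: K_def)
      show ?thesis using 2 by (simp add: G_def[abs_def])
    next
      case 3
      have [measurable]: "(\<lambda>x. x (IxE i)) \<in> borel_measurable (PiM (K i) (\<lambda>_. borel :: real measure))"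
        "(\<lambda>x. x (IxS (i - 1))) \<in> borel_measurable (PiM (K i) (\<lambda>_. borel :: real measure))"
        using 3 by (auto intro!: comp simp: K_def)
      show ?thesis using 3 by (simp add: G_def[abs_def])
    qed
  qed
  also have "(\<lambda>i. G i \<circ> (\<lambda>\<omega>. \<lambda>j\<in>K i. tail_component j \<omega>)) = X"
    by (auto simp: fun_eq_iff G_def K_def X_def tilted_innov_def innov_abs_def tail_component_def powi_minus_two)
  finally have X: "tail.indep_vars (\<lambda>_. borel) X ?I" .
  have restr: "(\<lambda>i\<in>innov_times. X i \<omega>) = (\<lambda>i\<in>innov_times. tilted_innov i \<omega>)" for \<omega>
    by (auto simp: X_def fun_eq_iff restrict_def)
  have "tail.indep_var (PiM innov_times (\<lambda>_. borel)) (\<lambda>\<omega>. \<lambda>i\<in>innov_times. X i \<omega>)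
      (PiM {start} (\<lambda>_. borel)) (\<lambda>\<omega>. \<lambda>i\<in>{start}. X i \<omega>)"
    by (rule tail.indep_var_restrict[OF X]) auto
  then have "distr N (PiM innov_times (\<lambda>_. borel) \<Otimes>\<^sub>M borel) (\<lambda>\<omega>. (\<lambda>i\<in>innov_times. X i \<omega>, X start \<omega>)) =
    distr N (PiM innov_times (\<lambda>_. borel)) (\<lambda>\<omega>. \<lambda>i\<in>innov_times. X i \<omega>) \<Otimes>\<^sub>M distr N borel (X start)"
    by (rule tail.distr_pair_coordinate)
  also have "X start = Y" by (simp add: X_def)
  also have "distr N (PiM innov_times (\<lambda>_. borel)) (\<lambda>\<omega>. \<lambda>i\<in>innov_times. X i \<omega>) =
      PiM innov_times (\<lambda>i. distr N borel (X i))"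
  proof (rule tail.indep_vars_iff_distr_eq_PiM'[THEN iffD1])
    show X': "tail.indep_vars (\<lambda>_. borel) X innov_times"
      by (rule tail.indep_vars_subset[OF X]) auto
    show "innov_times \<noteq> {}" by simp
    show "X i \<in> borel_measurable N" if "i \<in> innov_times" for i
      using X' that by (simp add: tail.indep_vars_def)
  qed
  also have "\<dots> = PiM innov_times (\<lambda>i. density lborel (tilted_density i))"
    by (intro PiM_cong refl) (auto simp: X_def tilted_innov_law)
  finally show ?thesis unfolding restr .
qed

text \<open>The weight d^(2 \<alpha>) is the product of the powers of order \<alpha> of the
  volatility factors and the power of order 2 \<alpha> of \<bar>\<open>e 1\<close>\<bar>, because
  \<open>path_scale\<close> contains the square root of the gain.\<close>

lemma prod_tilt:
  "(\<Prod>i\<in>innov_times. tilt i (e i)) = path_scale start e powr (2 * \<alpha>) / tilt_norm"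
proof -
  have split: "innov_times = insert 1 {start<..0} \<union> {2..int n + 1}" by auto
  have "(\<Prod>i\<in>innov_times. tilt i (e i)) = (\<Prod>i\<in>insert 1 {start<..0}. tilt i (e i)) * (\<Prod>i\<in>{2..int n + 1}. tilt i (e i))"
    unfolding split by (rule prod.union_disjoint) auto
  also have "(\<Prod>i\<in>{2..int n + 1}. tilt i (e i)) = 1"
    by (intro prod.neutral) (auto simp: tilt_def)
  also have "(\<Prod>i\<in>insert 1 {start<..0}. tilt i (e i)) = tilt 1 (e 1) * (\<Prod>i\<in>{start<..0}. tilt i (e i))"
    by (rule prod.insert) auto
  also have "(\<Prod>i\<in>{start<..0}. tilt i (e i)) = (\<Prod>i\<in>{start<..0}. arch_factor (e i) powr \<alpha>)"
    by (intro prod.cong) (auto simp: tilt_def)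
  also have "\<dots> = vol_gain arch_factor start 0 e powr \<alpha>"
    unfolding vol_gain_def using arch_factor_nonneg by (simp add: prod_powr_distrib)
  also have "tilt 1 (e 1) * vol_gain arch_factor start 0 e powr \<alpha> * 1 = path_scale start e powr (2 * \<alpha>) / tilt_norm"
  proof -
    have P: "vol_gain arch_factor start 0 e \<ge> 0" by (intro vol_gain_nonneg arch_factor_nonneg)
    then have "sqrt (vol_gain arch_factor start 0 e) powr (2 * \<alpha>) = vol_gain arch_factor start 0 e powr \<alpha>"
      by (simp add: powr_half_sqrt[symmetric] powr_powr)
    then show ?thesis
      using P
      by (simp add: tilt_def path_scale_def powr_mult)
  qed
  finally show ?thesis .
qed

section \<open>The tail process as a limiting path of the tilted innovations\<close>

lemma AE_innov_abs_pos:
  assumes i: "i \<in> innov_times"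
  shows "AE \<omega> in N. innov_abs i \<omega> > 0"
proof -
  note [measurable] = innov_abs_measurable[OF i]
  have "emeasure N {\<omega> \<in> space N. innov_abs i \<omega> \<le> 0} = emeasure (distr N borel (innov_abs i)) {..0}"
    by (auto simp: emeasure_distr intro!: arg_cong[where f="emeasure N"])
  also have "\<dots> = 0"
    unfolding innov_abs_law[OF i] by (rule folded_density_null) simp
  finally show ?thesis
    by (intro AE_I[where N="{\<omega> \<in> space N. innov_abs i \<omega> \<le> 0}"]) auto
qed

lemma AE_Y_pos: "AE \<omega> in N. Y \<omega> > 0"
proof -
  note [measurable] = Y_measurable
  have "tail.prob {\<omega> \<in> space N. Y \<omega> > 1} = 1" using tail.Y_pareto[of 1] by simp
  then have "AE \<omega> in N. \<omega> \<in> {\<omega> \<in> space N. Y \<omega> > 1}"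
    by (intro tail.prob_eq_1[THEN iffD1]) auto
  then show ?thesis by eventually_elim auto
qed

text \<open>By construction the volatility factor of the tilted innovation at time i \<le> 0 is
  A^(-2) at time i - 1. Splitting the gain at \<open>t\<close> or at 0 cancels the part shared by
  the path and its scale: before time 0 the product of the \<open>A\<close> remains, after time 0
  the product of the later factors.\<close>

lemma tail_process_eq_vol_path:
  assumes t: "t \<in> {start..int n}" and Y: "Y \<omega> > 0"
    and S: "\<And>i. i \<in> innov_times \<Longrightarrow> S (i - 1) \<omega> = 1 \<or> S (i - 1) \<omega> = - 1"
    and pos: "\<And>i. i \<in> innov_times \<Longrightarrow> innov_abs i \<omega> > 0"
    and A: "\<And>i. i \<in> innov_times \<Longrightarrow> i \<le> 0 \<Longrightarrow> A (i - 1) \<omega> > 0"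
  shows "garch11_tail_process \<alpha>\<^sub>1 \<beta>\<^sub>1 A S E Y t \<omega> =
    vol_path arch_factor start 0 (Y \<omega> / path_scale start (\<lambda>i. tilted_innov i \<omega>)) (\<lambda>i. tilted_innov i \<omega>) t"
proof -
  let ?e = "\<lambda>i. tilted_innov i \<omega>"
  let ?g = "\<lambda>s t. vol_gain arch_factor s t ?e"
  have e_sq: "(?e i)\<^sup>2 = (innov_abs i \<omega>)\<^sup>2" and e_abs: "\<bar>?e i\<bar> = innov_abs i \<omega>" if "i \<in> innov_times" for i
    using S[OF that] pos[OF that] by (auto simp: tilted_innov_def)
  have factor_pos: "arch_factor (?e i) > 0" if "i \<in> innov_times" for i
    using e_abs[OF that] pos[OF that] by (intro arch_factor_pos) auto
  have g_pos: "?g s u > 0" if "start \<le> s" "u \<le> int n + 1" for s u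
    unfolding vol_gain_def using that by (intro prod_pos factor_pos) auto
  have one: "1 \<in> innov_times" by auto
  have E1: "\<bar>?e 1\<bar> = \<bar>E 1 \<omega>\<bar>" "\<bar>E 1 \<omega>\<bar> > 0"
    using e_abs[OF one] pos[OF one] by (auto simp: innov_abs_def)
  have scale: "path_scale start ?e = sqrt (?g start 0) * \<bar>E 1 \<omega>\<bar>"
    by (simp add: path_scale_def E1)
  have path: "vol_path arch_factor start 0 (Y \<omega> / path_scale start ?e) ?e t =
      Y \<omega> / (sqrt (?g start 0) * \<bar>E 1 \<omega>\<bar>) * sqrt (?g start t) * (innov_abs (t + 1) \<omega> * S t \<omega>)"
  proof -
    have "sqrt (y\<^sup>2 * g) = y * sqrt g" if "y > 0" for y g :: real
      using that by (simp add: real_sqrt_mult)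
    moreover have "Y \<omega> / (sqrt (?g start 0) * \<bar>E 1 \<omega>\<bar>) > 0"
      using Y E1 g_pos[of start 0] by simp
    moreover have "?e (t + 1) = innov_abs (t + 1) \<omega> * S t \<omega>" by (simp add: tilted_innov_def)
    ultimately show ?thesis by (simp add: vol_path_def scale)
  qed
  consider "t = 0" | "t < 0" | "t > 0" by linarith
  then show ?thesis
  proof cases
    case 1
    then show ?thesis
      unfolding path using g_pos[of start 0] E1 by (simp add: garch11_tail_process_def innov_abs_def)
  next
    case 2
    have factor: "arch_factor (?e i) = inverse ((A (i - 1) \<omega>)\<^sup>2)" if i: "i \<in> {t<..0}" for i
    proof -
      have i': "i \<in> innov_times" "i \<le> 0" using i t by auto
      \<comment> \<open>Positivity of the root makes the radicand positive, so squaring undoes the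
        root.\<close>
      have "sqrt ((inverse ((A (i - 1) \<omega>)\<^sup>2) - \<beta>\<^sub>1) / \<alpha>\<^sub>1) > 0"
        using pos[OF i'(1)] i'(2) by (simp add: innov_abs_def powi_minus_two)
      then have "(innov_abs i \<omega>)\<^sup>2 = (inverse ((A (i - 1) \<omega>)\<^sup>2) - \<beta>\<^sub>1) / \<alpha>\<^sub>1"
        using i'(2) by (simp add: innov_abs_def powi_minus_two)
      then show ?thesis
        using \<alpha>\<^sub>1_pos by (simp add: arch_factor_def e_sq[OF i'(1)])
    qed
    have "sqrt (?g t 0) = sqrt (\<Prod>i\<in>{t<..0}. inverse ((A (i - 1) \<omega>)\<^sup>2))"
      unfolding vol_gain_def by (simp add: factor)
    also have "(\<Prod>i\<in>{t<..0}. inverse ((A (i - 1) \<omega>)\<^sup>2)) = (inverse (\<Prod>i\<in>{t<..0}. A (i - 1) \<omega>))\<^sup>2"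
      by (simp add: prod_inversef[symmetric] comp_def power_inverse prod_power_distrib)
    \<comment> \<open>The substitution i to 1 - i removes the shift between innovation times and the
      times of \<open>A\<close>.\<close>
    also have "(\<Prod>i\<in>{t<..0}. A (i - 1) \<omega>) = (\<Prod>i=1..- t. A (- i) \<omega>)"
      by (rule prod.reindex_bij_witness[of _ "\<lambda>i. 1 - i" "\<lambda>i. 1 - i"]) auto
    finally have "sqrt (?g t 0) = \<bar>inverse (\<Prod>i=1..- t. A (- i) \<omega>)\<bar>" by simp
    moreover have A_prod: "(\<Prod>i=1..- t. A (- i) \<omega>) > 0"
    proof (rule prod_pos)
      fix i assume "i \<in> {1..- t}"
      then show "A (- i) \<omega> > 0" using A[of "1 - i"] t by auto
    qed
    ultimately have gt: "sqrt (?g t 0) = inverse (\<Prod>i=1..- t. A (- i) \<omega>)" by simp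
    have "?g start 0 = ?g start t * ?g t 0"
      using t 2 by (intro vol_gain_trans) auto
    then have g0: "sqrt (?g start 0) = sqrt (?g start t) * inverse (\<Prod>i=1..- t. A (- i) \<omega>)"
      by (simp add: real_sqrt_mult gt)
    \<comment> \<open>Here \<open>g\<close> is the square root of the gain from \<open>start\<close>
      to \<open>t\<close>; cancelling it removes the dependence on \<open>start\<close>.\<close>
    have cancel: "y / (g * inverse p * d) * g * (r * s) = y * p * (r / d) * s" if "g > 0" "p > 0" for y g p d r s :: real
      using that by (simp add: field_simps)
    have "sqrt (?g start t) > 0" using g_pos[of start t] t by simp
    note cancel = cancel[OF this A_prod]
    show ?thesis
      unfolding path g0 cancel using 2 by (simp add: garch11_tail_process_def innov_abs_def)
  next
    case 3
    have "sqrt (\<Prod>i\<in>X. h i) = (\<Prod>i\<in>X. sqrt (h i))" for X :: "int set" and h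
      by (induction X rule: infinite_finite_induct) (simp_all add: real_sqrt_mult)
    then have "sqrt (?g 0 t) = (\<Prod>i\<in>{0<..t}. sqrt (arch_factor (?e i)))"
      unfolding vol_gain_def .
    also have "\<dots> = (\<Prod>i=1..t. sqrt (\<alpha>\<^sub>1 * (E i \<omega>)\<^sup>2 + \<beta>\<^sub>1))"
    proof (intro prod.cong)
      show "sqrt (arch_factor (?e i)) = sqrt (\<alpha>\<^sub>1 * (E i \<omega>)\<^sup>2 + \<beta>\<^sub>1)" if "i \<in> {1..t}" for i
        using that t e_sq[of i] by (simp add: arch_factor_def innov_abs_def)
    qed auto
    finally have gt: "sqrt (?g 0 t) = (\<Prod>i=1..t. sqrt (\<alpha>\<^sub>1 * (E i \<omega>)\<^sup>2 + \<beta>\<^sub>1))" .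
    have "?g start t = ?g start 0 * ?g 0 t"
      using 3 by (intro vol_gain_trans) auto
    then have "sqrt (?g start t) = sqrt (?g start 0) * (\<Prod>i=1..t. sqrt (\<alpha>\<^sub>1 * (E i \<omega>)\<^sup>2 + \<beta>\<^sub>1))"
      by (simp add: real_sqrt_mult gt)
    then show ?thesis
      unfolding path using 3 g_pos[of start 0] E1
      by (simp add: garch11_tail_process_def innov_abs_def)
  qed
qed

lemma AE_tail_process_eq_vol_path:
  "AE \<omega> in N. \<forall>t\<in>{start..int n}. garch11_tail_process \<alpha>\<^sub>1 \<beta>\<^sub>1 A S E Y t \<omega> =
    vol_path arch_factor start 0 (Y \<omega> / path_scale start (\<lambda>i. tilted_innov i \<omega>)) (\<lambda>i. tilted_innov i \<omega>) t"
proof -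
  have "AE \<omega> in N. \<forall>i\<in>innov_times. S (i - 1) \<omega> = 1 \<or> S (i - 1) \<omega> = - 1"
    by (intro AE_finite_allI tail.AE_sign S_measurable tail.S_pos tail.S_neg) auto
  moreover have "AE \<omega> in N. \<forall>i\<in>innov_times. innov_abs i \<omega> > 0"
    by (intro AE_finite_allI AE_innov_abs_pos) auto
  moreover have "AE \<omega> in N. \<forall>i\<in>{start<..0}. A (i - 1) \<omega> > 0"
    by (intro AE_finite_allI AE_A_pos) auto
  ultimately show ?thesis
    using AE_Y_pos by eventually_elim (intro ballI tail_process_eq_vol_path, auto)
qed

lemma tail_process_measurable:
  assumes t: "t \<in> {start..int n}"
  shows "garch11_tail_process \<alpha>\<^sub>1 \<beta>\<^sub>1 A S E Y t \<in> borel_measurable N"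
proof -
  note [measurable] = Y_measurable S_measurable[OF t]
  have [measurable]: "E 1 \<in> borel_measurable N" by (rule E_measurable) simp
  consider "t = 0" | "t < 0" | "t > 0" by linarith
  then show ?thesis
  proof cases
    case 1
    then show ?thesis unfolding garch11_tail_process_def[abs_def] using S_measurable[of 0] by simp
  next
    case 2
    have [measurable]: "(\<lambda>\<omega>. \<Prod>i = 1..- t. A (- i) \<omega>) \<in> borel_measurable N"
      using t by (intro borel_measurable_prod A_measurable) auto
    have [measurable]: "A t \<in> borel_measurable N" using t 2 by (intro A_measurable) auto
    show ?thesis
      unfolding garch11_tail_process_def[abs_def] powi_minus_two using 2 by simp
  next
    case 3
    have [measurable]: "E (t + 1) \<in> borel_measurable N" using t 3 by (intro E_measurable) auto
    have [measurable]: "(\<lambda>\<omega>. \<Prod>i = 1..t. sqrt (\<alpha>\<^sub>1 * (E i \<omega>)\<^sup>2 + \<beta>\<^sub>1)) \<in> borel_measurable N"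
    proof (rule borel_measurable_prod)
      fix i assume "i \<in> {1..t}"
      then have [measurable]: "E i \<in> borel_measurable N" using t by (intro E_measurable) auto
      show "(\<lambda>\<omega>. sqrt (\<alpha>\<^sub>1 * (E i \<omega>)\<^sup>2 + \<beta>\<^sub>1)) \<in> borel_measurable N" by measurable
    qed
    show ?thesis
      unfolding garch11_tail_process_def[abs_def] using 3 by simp
  qed
qed

text \<open>The change of measure that links the two sides: the weight left by regular variation is,
  up to \<open>tilt_norm\<close>, the density of the law of the tilted innovations.\<close>

lemma PiM_tilted:
  "PiM innov_times (\<lambda>i. density lborel (tilted_density i)) =
    density (PiM innov_times (\<lambda>_. std_normal)) (\<lambda>e. ennreal (path_scale start e powr (2 * \<alpha>) / tilt_norm))"
proof -
  have "PiM innov_times (\<lambda>i. density lborel (tilted_density i)) =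
      density (PiM innov_times (\<lambda>_. std_normal)) (\<lambda>e. \<Prod>i\<in>innov_times. ennreal (tilt i (e i)))"
    unfolding density_tilted[symmetric]
  proof (rule density_PiM[symmetric])
    show "sigma_finite_measure (density std_normal (tilt i))" for i
      unfolding density_tilted by (intro prob_space_imp_sigma_finite prob_space_tilted)
    show "sigma_finite_measure std_normal"
      by (intro prob_space_imp_sigma_finite prob_space_std_normal)
  qed auto
  then show ?thesis
    by (simp add: prod_ennreal tilt_nonneg prod_tilt)
qed

text \<open>The expectation of the tail process is brought to the very form of the limit of the
  conditional expectations. Applied to the constant 1, it evaluates the total weight.\<close>

lemma tail_process_expectation:
  assumes f: "f \<in> borel_measurable (PiM {start..int n} (\<lambda>_. borel))"
    and f_bdd: "\<And>y. y \<in> PiE {start..int n} (\<lambda>_. UNIV) \<Longrightarrow> \<bar>f y\<bar> \<le> B"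
  shows "(\<integral>\<omega>. f (\<lambda>t\<in>{start..int n}. garch11_tail_process \<alpha>\<^sub>1 \<beta>\<^sub>1 A S E Y t \<omega>) \<partial>N) =
    (\<integral>e. path_scale start e powr (2 * \<alpha>) *
      (\<integral>y. f (\<lambda>t\<in>{start..int n}. vol_path arch_factor start 0 (y / path_scale start e) e t) \<partial>distr N borel Y)
      \<partial>PiM innov_times (\<lambda>_. std_normal)) / tilt_norm"
proof -
  let ?I = "{start..int n}" and ?P = "PiM innov_times (\<lambda>_. borel :: real measure)"
  let ?L = "PiM innov_times (\<lambda>_. std_normal)" and ?Q = "PiM innov_times (\<lambda>i. density lborel (tilted_density i))"
  let ?\<nu> = "distr N borel Y"
  define h where "h e y = f (\<lambda>t\<in>?I. vol_path arch_factor start 0 (y / path_scale start e) e t)" for e y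
  note Y_measurable [measurable]
  interpret \<nu>: prob_space ?\<nu> by (rule tail.prob_space_distr) simp
  interpret Q: prob_space ?Q by (intro prob_space_PiM prob_space_tilted)
  interpret pair: pair_prob_space ?Q ?\<nu> ..
  have sets_L: "sets ?L = sets ?P" and sets_Q: "sets ?Q = sets ?P"
    by (auto intro!: sets_PiM_cong)
  have hL: "(\<lambda>(e, y). h e y) \<in> borel_measurable (?L \<Otimes>\<^sub>M ?\<nu>)"
    unfolding h_def using f by (intro limit_integrand_measurable) auto
  have h [measurable]: "(\<lambda>(e, y). h e y) \<in> borel_measurable (?P \<Otimes>\<^sub>M borel)"
    using hL measurable_cong_sets[OF sets_pair_measure_cong[OF sets_L sets_distr] refl] by blast
  have hQ: "(\<lambda>(e, y). h e y) \<in> borel_measurable (?Q \<Otimes>\<^sub>M ?\<nu>)"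
    using h measurable_cong_sets[OF sets_pair_measure_cong[OF sets_Q sets_distr] refl] by blast
  have h_bdd: "\<bar>h e y\<bar> \<le> B" for e y unfolding h_def by (rule f_bdd) auto
  have W [measurable]: "(\<lambda>\<omega>. \<lambda>i\<in>innov_times. tilted_innov i \<omega>) \<in> N \<rightarrow>\<^sub>M ?P"
    by (intro measurable_restrict tilted_innov_measurable)
  have "(\<integral>\<omega>. f (\<lambda>t\<in>?I. garch11_tail_process \<alpha>\<^sub>1 \<beta>\<^sub>1 A S E Y t \<omega>) \<partial>N) =
      (\<integral>\<omega>. (case (\<lambda>i\<in>innov_times. tilted_innov i \<omega>, Y \<omega>) of (e, y) \<Rightarrow> h e y) \<partial>N)"
  proof (rule integral_cong_AE)
    show "(\<lambda>\<omega>. f (\<lambda>t\<in>?I. garch11_tail_process \<alpha>\<^sub>1 \<beta>\<^sub>1 A S E Y t \<omega>)) \<in> borel_measurable N"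
      by (intro measurable_compose[OF measurable_restrict f] tail_process_measurable)
    show "(\<lambda>\<omega>. case (\<lambda>i\<in>innov_times. tilted_innov i \<omega>, Y \<omega>) of (e, y) \<Rightarrow> h e y) \<in> borel_measurable N"
      by (rule measurable_compose[OF _ h]) measurable
    show "AE \<omega> in N. f (\<lambda>t\<in>?I. garch11_tail_process \<alpha>\<^sub>1 \<beta>\<^sub>1 A S E Y t \<omega>) =
        (case (\<lambda>i\<in>innov_times. tilted_innov i \<omega>, Y \<omega>) of (e, y) \<Rightarrow> h e y)"
      using AE_tail_process_eq_vol_path
    proof eventually_elim
      case (elim \<omega>)
      let ?e = "\<lambda>i. tilted_innov i \<omega>" and ?e' = "\<lambda>i\<in>innov_times. tilted_innov i \<omega>"
      have scale: "path_scale start ?e' = path_scale start ?e"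
        unfolding path_scale_def by (auto intro!: vol_gain_cong)
      have "garch11_tail_process \<alpha>\<^sub>1 \<beta>\<^sub>1 A S E Y t \<omega> =
          vol_path arch_factor start 0 (Y \<omega> / path_scale start ?e') ?e' t" if "t \<in> ?I" for t
      proof -
        have "vol_path arch_factor start 0 (Y \<omega> / path_scale start ?e) ?e' t =
            vol_path arch_factor start 0 (Y \<omega> / path_scale start ?e) ?e t"
          using that by (intro vol_path_cong) auto
        then show ?thesis using elim that scale by simp
      qed
      then have "(\<lambda>t\<in>?I. garch11_tail_process \<alpha>\<^sub>1 \<beta>\<^sub>1 A S E Y t \<omega>) =
          (\<lambda>t\<in>?I. vol_path arch_factor start 0 (Y \<omega> / path_scale start ?e') ?e' t)"
        by (intro restrict_ext)
      then show ?case by (simp add: h_def)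
    qed
  qed
  also have "\<dots> = (\<integral>p. (case p of (e, y) \<Rightarrow> h e y)
      \<partial>distr N (?P \<Otimes>\<^sub>M borel) (\<lambda>\<omega>. (\<lambda>i\<in>innov_times. tilted_innov i \<omega>, Y \<omega>)))"
    by (rule integral_distr[symmetric]) (auto intro: h W measurable_Pair)
  also have "\<dots> = (\<integral>p. (case p of (e, y) \<Rightarrow> h e y) \<partial>(?Q \<Otimes>\<^sub>M ?\<nu>))"
    unfolding tilted_innov_joint_law ..
  also have "\<dots> = (\<integral>e. (\<integral>y. h e y \<partial>?\<nu>) \<partial>?Q)"
    by (subst pair.integral_fst'[symmetric])
      (auto intro!: pair.P.integrable_const_bound[where B=B] hQ[unfolded split_beta'] simp: h_bdd split_beta')
  also have "\<dots> = (\<integral>e. (path_scale start e powr (2 * \<alpha>) / tilt_norm) *\<^sub>R (\<integral>y. h e y \<partial>?\<nu>) \<partial>?L)"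
    unfolding PiM_tilted
  proof (rule integral_density)
    have [measurable]: "path_scale start \<in> borel_measurable ?L"
      by (rule path_scale_measurable) auto
    show "(\<lambda>e. path_scale start e powr (2 * \<alpha>) / tilt_norm) \<in> borel_measurable ?L" by measurable
    show "(\<lambda>e. \<integral>y. h e y \<partial>?\<nu>) \<in> borel_measurable ?L"
      by (rule \<nu>.borel_measurable_lebesgue_integral[OF hL])
  qed (use tilt_norm_pos in auto)
  also have "\<dots> = (\<integral>e. path_scale start e powr (2 * \<alpha>) * (\<integral>y. h e y \<partial>?\<nu>) / tilt_norm \<partial>?L)"
    by simp
  also have "\<dots> = (\<integral>e. path_scale start e powr (2 * \<alpha>) * (\<integral>y. h e y \<partial>?\<nu>) \<partial>?L) / tilt_norm"
    by (rule integral_divide_zero)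
  finally show ?thesis unfolding h_def .
qed

end

section \<open>Weak convergence of the conditioned path\<close>

theorem proposition6p3:
  fixes M :: "'a measure" and N :: "'b measure"
    and \<alpha>\<^sub>0 \<alpha>\<^sub>1 \<beta>\<^sub>1 \<alpha> :: real
    and \<epsilon> \<zeta> \<sigma> :: "int \<Rightarrow> 'a \<Rightarrow> real"
    and A S E :: "int \<Rightarrow> 'b \<Rightarrow> real" and Y :: "'b \<Rightarrow> real"
    and m n :: nat
  assumes garch: "garch11 M \<alpha>\<^sub>0 \<alpha>\<^sub>1 \<beta>\<^sub>1 \<epsilon> \<zeta> \<sigma>"
    and alpha_pos: "\<alpha> > 0"
    and alpha_eq: "prob_space.expectation M (\<lambda>\<omega>. (\<alpha>\<^sub>1 * (\<epsilon> 0 \<omega>)\<^sup>2 + \<beta>\<^sub>1) powr \<alpha>) = 1"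
    and regularly_varying: "\<And>u. u > 0 \<Longrightarrow>
        ((\<lambda>x. measure M {\<omega> \<in> space M. \<sigma> 0 \<omega> > u * x} / measure M {\<omega> \<in> space M. \<sigma> 0 \<omega> > x})
          \<longlongrightarrow> u powr (- 2 * \<alpha>)) at_top"
    and tail_vars: "garch11_tail_vars N \<alpha>\<^sub>1 \<beta>\<^sub>1 \<alpha> m n A S E Y"
  shows "weak_conv_along (product_topology (\<lambda>_. euclideanreal) {- int m..int n})
           (\<lambda>x. fdd (uniform_measure M {\<omega> \<in> space M. \<bar>\<zeta> 0 \<omega>\<bar> > x}) {- int m..int n}
                  (\<lambda>t \<omega>. \<zeta> t \<omega> / x))
           (fdd N {- int m..int n} (garch11_tail_process \<alpha>\<^sub>1 \<beta>\<^sub>1 A S E Y))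
           at_top"
  unfolding weak_conv_along_def
proof (intro allI impI, elim conjE)
  interpret garch11_tail_limit M N \<alpha>\<^sub>0 \<alpha>\<^sub>1 \<beta>\<^sub>1 \<alpha> \<epsilon> \<zeta> \<sigma> A S E Y m n
    using garch tail_vars alpha_pos alpha_eq
    by (simp add: garch11_tail_limit_def garch11_tail_limit_axioms_def)
  let ?I = "{- int m..int n}" and ?Z = "garch11_tail_process \<alpha>\<^sub>1 \<beta>\<^sub>1 A S E Y"
  let ?L = "PiM innov_times (\<lambda>_. std_normal)" and ?\<nu> = "distr N borel Y"
  fix f :: "(int \<Rightarrow> real) \<Rightarrow> real"
  assume f: "continuous_map (product_topology (\<lambda>_. euclideanreal) ?I) euclideanreal f"
    and bdd: "bounded (f ` topspace (product_topology (\<lambda>_. euclideanreal) ?I))"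
  obtain B where B: "\<And>y. y \<in> PiE ?I (\<lambda>_. UNIV) \<Longrightarrow> \<bar>f y\<bar> \<le> B"
    using bdd by (auto simp: bounded_iff)
  have f_meas: "f \<in> borel_measurable (PiM ?I (\<lambda>_. borel))"
    by (rule borel_measurable_continuous_map_product[OF f])
  note Y_measurable [measurable]
  interpret \<nu>: real_distribution ?\<nu> by (rule tail.real_distribution_distr) simp
  have pareto: "measure ?\<nu> {x<..} = x powr (- (2 * \<alpha>))" if "x \<ge> 1" for x
  proof -
    have "measure ?\<nu> {x<..} = tail.prob {\<omega> \<in> space N. Y \<omega> > x}"
      by (auto simp: measure_distr intro!: arg_cong[where f="measure N"])
    then show ?thesis using tail.Y_pareto[OF that] by simp
  qed
  have rv: "regularly_varying_law (distr M borel (\<sigma> 0)) (2 * \<alpha>)"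
  proof -
    interpret \<mu>: real_distribution "distr M borel (\<sigma> 0)" by (rule real_distribution_distr) simp
    have "measure (distr M borel (\<sigma> 0)) {x<..} = prob {\<omega> \<in> space M. \<sigma> 0 \<omega> > x}" for x
      by (auto simp: measure_distr intro!: arg_cong[where f="measure M"])
    then show ?thesis
      using regularly_varying by unfold_locales simp
  qed
  have norm: "(\<integral>e. path_scale start e powr (2 * \<alpha>) \<partial>?L) = tilt_norm"
  proof -
    \<comment> \<open>The tail process lives on a probability space, so the expectation of 1
      determines the total weight without integrating it.\<close>
    have "1 = (\<integral>e. path_scale start e powr (2 * \<alpha>) \<partial>?L) / tilt_norm"
      using tail_process_expectation[of "\<lambda>_. 1" 1]
      by (simp add: tail.prob_space \<nu>.prob_space[unfolded \<nu>.space_eq_univ])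
    then show ?thesis using tilt_norm_pos by (simp add: field_simps)
  qed
  have fdd_M: "(\<integral>y. f y \<partial>fdd (uniform_measure M {\<omega> \<in> space M. \<bar>\<zeta> 0 \<omega>\<bar> > x}) ?I (\<lambda>t \<omega>. \<zeta> t \<omega> / x)) =
    (\<integral>\<omega>. f (\<lambda>t\<in>?I. \<zeta> t \<omega> / x) * indicator {\<omega>. \<bar>\<zeta> 0 \<omega>\<bar> > x} \<omega> \<partial>M) /
      prob {\<omega> \<in> space M. \<bar>\<zeta> 0 \<omega>\<bar> > x}" for x
  proof -
    have meas: "(\<lambda>\<omega>. \<lambda>t\<in>?I. \<zeta> t \<omega> / x) \<in> M \<rightarrow>\<^sub>M PiM ?I (\<lambda>_. borel)"
      by (rule measurable_restrict) simp
    have "(\<integral>y. f y \<partial>fdd (uniform_measure M {\<omega> \<in> space M. \<bar>\<zeta> 0 \<omega>\<bar> > x}) ?I (\<lambda>t \<omega>. \<zeta> t \<omega> / x)) =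
        (\<integral>\<omega>. f (\<lambda>t\<in>?I. \<zeta> t \<omega> / x) \<partial>uniform_measure M {\<omega> \<in> space M. \<bar>\<zeta> 0 \<omega>\<bar> > x})"
      unfolding fdd_def using meas f_meas
      by (intro integral_distr) (auto simp: measurable_cong_sets[OF sets_uniform_measure refl])
    also have "\<dots> = (\<integral>\<omega>. f (\<lambda>t\<in>?I. \<zeta> t \<omega> / x) * indicator {\<omega> \<in> space M. \<bar>\<zeta> 0 \<omega>\<bar> > x} \<omega> \<partial>M) /
        prob {\<omega> \<in> space M. \<bar>\<zeta> 0 \<omega>\<bar> > x}"
      by (rule integral_uniform_measure) (auto intro: measurable_compose[OF meas f_meas])
    also have "(\<integral>\<omega>. f (\<lambda>t\<in>?I. \<zeta> t \<omega> / x) * indicator {\<omega> \<in> space M. \<bar>\<zeta> 0 \<omega>\<bar> > x} \<omega> \<partial>M) =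
        (\<integral>\<omega>. f (\<lambda>t\<in>?I. \<zeta> t \<omega> / x) * indicator {\<omega>. \<bar>\<zeta> 0 \<omega>\<bar> > x} \<omega> \<partial>M)"
      by (intro Bochner_Integration.integral_cong) (auto split: split_indicator)
    finally show ?thesis .
  qed
  have "(\<integral>y. f y \<partial>fdd N ?I ?Z) = (\<integral>\<omega>. f (\<lambda>t\<in>?I. ?Z t \<omega>) \<partial>N)"
    unfolding fdd_def by (intro integral_distr measurable_restrict tail_process_measurable f_meas)
  also have "\<dots> = (\<integral>e. path_scale start e powr (2 * \<alpha>) *
      (\<integral>y. f (\<lambda>t\<in>?I. vol_path arch_factor start 0 (y / path_scale start e) e t) \<partial>?\<nu>) \<partial>?L) / tilt_norm"
    using f_meas B by (rule tail_process_expectation)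
  finally have fdd_N: "(\<integral>y. f y \<partial>fdd N ?I ?Z) = (\<integral>e. path_scale start e powr (2 * \<alpha>) *
      (\<integral>y. f (\<lambda>t\<in>?I. vol_path arch_factor start 0 (y / path_scale start e) e t) \<partial>?\<nu>) \<partial>?L) /
      (\<integral>e. path_scale start e powr (2 * \<alpha>) \<partial>?L)"
    unfolding norm .
  show "((\<lambda>x. \<integral>y. f y \<partial>fdd (uniform_measure M {\<omega> \<in> space M. \<bar>\<zeta> 0 \<omega>\<bar> > x}) ?I (\<lambda>t \<omega>. \<zeta> t \<omega> / x))
      \<longlongrightarrow> (\<integral>y. f y \<partial>fdd N ?I ?Z)) at_top"
  \<comment> \<open>Skorohod's theorem and dominated convergence are sequential, so the limit is
    taken along arbitrary sequences tending to infinity.\<close>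
  proof (rule tendsto_at_topI_sequentially)
    fix X :: "nat \<Rightarrow> real" assume X: "filterlim X at_top sequentially"
    show "(\<lambda>k. \<integral>y. f y \<partial>fdd (uniform_measure M {\<omega> \<in> space M. \<bar>\<zeta> 0 \<omega>\<bar> > X k}) ?I (\<lambda>t \<omega>. \<zeta> t \<omega> / X k))
        \<longlonglongrightarrow> (\<integral>y. f y \<partial>fdd N ?I ?Z)"
      unfolding fdd_M fdd_N
      by (rule conditional_expectation_tendsto[where B=B])
        (use norm tilt_norm_pos rv \<nu>.real_distribution_axioms pareto f B X in auto)
  qed
qed

end
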